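(* Let $q\in\mathbb N$, $d\in(0,1/2)$, and let $w:\mathbb T\to\mathbb C^{q\times q}$ be of the form $w(e^{i\theta})=|1-e^{i\theta}|^{-2d}g(e^{i\theta})g(e^{i\theta})^*$, where the entries of $g(z)$ are rational functions of $z$ with no poles in the closed unit disk and $\det g(z)$ has no zeros in the closed unit disk. Let $\mathbf y=(y_1^\top,y_2^\top,\dots)^\top$ with $y_k\in\mathbb C^{q\times q}$ satisfy $\sum_{k=1}^\infty\|y_k\|<\infty$, and let $\kappa\in(0,d/(1-d))$. Let $\mathbf z=(z_1^\top,z_2^\top,\dots)^\top$, $z_k\in\mathbb C^{q\times q}$, be the solution to $T_\infty(w)\mathbf z=\mathbf y$, and for $n\in\mathbb N$ let $\mathbf z_n=(z_{1,n}^\top,\dots,z_{n,n}^\top)^\top$, $z_{k,n}\in\mathbb C^{q\times q}$, be the solution to $T_n(w)\mathbf z_n=\mathbf y_n$, where $\mathbf y_n=(y_1^\top,\dots,y_n^\top)^\top$. Then $$\sum_{k=1}^n\|z_k-z_{k,n}\|=O\big(n^{-d+\kappa(1-d)}\big)+O\Big(\sum_{t=[n^\kappa]+1}^\infty\|y_t\|\Big),\qquad n\to\infty.$$ In particular, $\lim_{n\to\infty}\sum_{k=1}^n\|z_k-z_{k,n}\|=0$.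
   Context: $\mathbb N=\{1,2,\dots\}$; $\mathbb T$ is the unit circle and $\mathbb D$ the open unit disk in $\mathbb C$; $\|a\|$ is the spectral norm and $a^*$ the Hermitian conjugate of a matrix $a$; $[x]$ is the floor of $x\in\mathbb R$. Put $\gamma(k)=\int_{-\pi}^{\pi}e^{-ik\theta}w(e^{i\theta})\frac{d\theta}{2\pi}\in\mathbb C^{q\times q}$ for $k\in\mathbb Z$, $T_n(w)=(\gamma(s-t))_{1\le s,t\le n}\in\mathbb C^{qn\times qn}$ (which is invertible) and $T_\infty(w)=(\gamma(s-t))_{s,t\ge1}$. For a finite or semi-infinite block matrix $A$, $A^{s,t}\in\mathbb C^{q\times q}$ denotes its $(s,t)$ block. The inverse $T_\infty(w)^{-1}$ is the following semi-infinite block matrix. There is a rational $g_\sharp:\mathbb T\to\mathbb C^{q\times q}$ with the same two properties as $g$ (entries rational without poles in the closed unit disk, determinant without zeros there) such that $g(e^{i\theta})g(e^{i\theta})^*=g_\sharp(e^{i\theta})^*g_\sharp(e^{i\theta})$ for all $\theta$; fix one. Put $h_\sharp(z)=(1-z)^{-d}g_\sharp(z)$ (principal branch), $\tilde h(z)=\{h_\sharp(\overline z)\}^*$, and define $\{\tilde a_k\}_{k\ge0}\subset\mathbb C^{q\times q}$ by $-\tilde h(z)^{-1}=\sum_{k=0}^\infty z^k\tilde a_k$, $z\in\mathbb D$. Then $(T_\infty(w)^{-1})^{s,t}=\sum_{\ell=1}^{\min(s,t)}\tilde a_{s-\ell}^*\tilde a_{t-\ell}$ for $s,t\in\mathbb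 N$. "The solution" $\mathbf z$ to $T_\infty(w)\mathbf z=\mathbf y$ means $\mathbf z=T_\infty(w)^{-1}\mathbf y$, i.e. $z_s=\sum_{t=1}^\infty(T_\infty(w)^{-1})^{s,t}y_t$ for $s\in\mathbb N$ (absolutely convergent); likewise $z_{s,n}=\sum_{t=1}^n(T_n(w)^{-1})^{s,t}y_t$ for $s\in\{1,\dots,n\}$. *)

theory Defs
  imports
    "HOL-Analysis.Analysis"
    "HOL-Computational_Algebra.Polynomial"
    "HOL-Library.Landau_Symbols"
begin

text \<open>The $q \times q$ matrices are those of type \<open>complex^'q^'q\<close>, with $q$ the cardinality
  of \<open>'q\<close>. Block sequences and block matrices are functions on \<open>nat\<close>; their blocks are numbered
  from 1, and the values at index 0 are irrelevant.\<close>

definition spectral_norm :: "complex^'n^'m \<Rightarrow> real" where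
  "spectral_norm A = onorm (\<lambda>x. A *v x)"

definition hermitian_conj :: "complex^'n^'m \<Rightarrow> complex^'m^'n" where
  "hermitian_conj A = (\<chi> i j. cnj (A $ j $ i))"

definition mscale :: "complex \<Rightarrow> complex^'n^'m \<Rightarrow> complex^'n^'m" where
  "mscale c A = (\<chi> i j. c * A $ i $ j)"

text \<open>A function into \<open>complex\<close> is total, so the value of a rational function at its poles is
  left unconstrained rather than set to 0. Coprimality of \<open>p\<close> and \<open>r\<close> is not needed: common
  factors of \<open>p\<close> and \<open>r\<close> without zeros in the closed disk do no harm.\<close>

definition rational_no_poles_cdisk :: "(complex \<Rightarrow> complex) \<Rightarrow> bool" where
  "rational_no_poles_cdisk f \<longleftrightarrow>
     (\<exists>p r :: complex poly. (\<forall>z. poly r z \<noteq> 0 \<longrightarrow> f z = poly p z / poly r z) \<and>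
        (\<forall>z. norm z \<le> 1 \<longrightarrow> poly r z \<noteq> 0))"

definition rational_invertible_cdisk :: "(complex \<Rightarrow> complex^'q^'q) \<Rightarrow> bool" where
  "rational_invertible_cdisk g \<longleftrightarrow>
     (\<forall>i j. rational_no_poles_cdisk (\<lambda>z. g z $ i $ j)) \<and>
     (\<forall>z. norm z \<le> 1 \<longrightarrow> det (g z) \<noteq> 0)"

definition fourier_coeff :: "(complex \<Rightarrow> complex^'q^'q) \<Rightarrow> int \<Rightarrow> complex^'q^'q" where
  "fourier_coeff w k =
     (1 / (2 * pi)) *\<^sub>R
       (LINT \<theta>:{-pi..pi}|lborel. mscale (exp (- \<i> * of_int k * of_real \<theta>)) (w (exp (\<i> * of_real \<theta>))))"

text \<open>The blocks of $T_\infty(w)$; those with $1 \le s, t \le n$ form $T_n(w)$.\<close>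

definition toeplitz :: "(complex \<Rightarrow> complex^'q^'q) \<Rightarrow> nat \<Rightarrow> nat \<Rightarrow> complex^'q^'q" where
  "toeplitz w s t = fourier_coeff w (int s - int t)"

definition is_block_inverse ::
    "nat \<Rightarrow> (nat \<Rightarrow> nat \<Rightarrow> complex^'q^'q) \<Rightarrow> (nat \<Rightarrow> nat \<Rightarrow> complex^'q^'q) \<Rightarrow> bool" where
  "is_block_inverse n A B \<longleftrightarrow>
     (\<forall>s\<in>{1..n}. \<forall>t\<in>{1..n}.
        (\<Sum>u=1..n. A s u ** B u t) = (if s = t then mat 1 else 0) \<and>
        (\<Sum>u=1..n. B s u ** A u t) = (if s = t then mat 1 else 0))"

text \<open>Analogous to \<^const>\<open>matrix_inv\<close>. For invertible \<open>A\<close> the blocks with indices in \<open>{1..n}\<close>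
  are uniquely determined; no others are meaningful.\<close>

definition block_inverse ::
    "nat \<Rightarrow> (nat \<Rightarrow> nat \<Rightarrow> complex^'q^'q) \<Rightarrow> nat \<Rightarrow> nat \<Rightarrow> complex^'q^'q" where
  "block_inverse n A = (SOME B. is_block_inverse n A B)"

definition h_sharp :: "real \<Rightarrow> (complex \<Rightarrow> complex^'q^'q) \<Rightarrow> complex \<Rightarrow> complex^'q^'q" where
  "h_sharp d g_sharp z = mscale ((1 - z) powr of_real (- d)) (g_sharp z)"

definition h_tilde :: "real \<Rightarrow> (complex \<Rightarrow> complex^'q^'q) \<Rightarrow> complex \<Rightarrow> complex^'q^'q" where
  "h_tilde d g_sharp z = hermitian_conj (h_sharp d g_sharp (cnj z))"

text \<open>The blocks of $T_\infty(w)^{-1}$ in terms of the coefficients \<open>a k\<close> of the power series of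
  $-\tilde h(z)^{-1}$.\<close>

definition toeplitz_inf_inverse :: "(nat \<Rightarrow> complex^'q^'q) \<Rightarrow> nat \<Rightarrow> nat \<Rightarrow> complex^'q^'q" where
  "toeplitz_inf_inverse a s t =
     (\<Sum>l=1..min s t. hermitian_conj (a (s - l)) ** a (t - l))"

end

theory Submission
  imports Defs "HOL-Complex_Analysis.Cauchy_Integral_Formula"
begin

text \<open>
  Write $w = h h^* = k^* k$ with $h = (1-z)^{-d} g$ and $k = (1-z)^{-d} g_\sharp$, and let
  $u = h^* k^{-1} = h^{-1} k^*$, which is unitary on the circle. If the trigonometric polynomial
  $X$ is a column of $T_n(w)^{-1}$, with right-hand side $z^t$, then $kX$ has no coefficients of
  index below 1 and $u k X = h^* X$ has none of index above $n$. Accordingly $kX = F + p + u^* r$,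
  where $F$ is the corresponding vector for $n = \infty$, $p$ is supported on indices
  $\le 0$ and $r$ on indices $> n$, and $p = p_0 + H^* H p$ for the Hankel operator
  $H = P_{>n} u P_{\le 0}$. The scalar factor of $u$ has an argument of modulus at most
  $\pi d < \pi/2$, so that $u$ is at distance less than 1 from the anti-analytic functions and $H$ is
  a strict contraction in $\ell^2$, uniformly in $n$; moreover its entries are $O(1/(i+j))$, which
  turns $\ell^2$ bounds for $p$ and $r$ into pointwise ones. The result is that column $t$ of
  $T_n(w)^{-1} - T_\infty(w)^{-1}$ has $\ell^1$ norm $O((n-t+1)^{-d+\varepsilon})$ for every
  $\varepsilon > 0$, and the theorem follows by summation against $y$.

  To avoid conditionally convergent series, $1 - z$ is first replaced by $1 - rz$ with $r < 1$. The
  estimates do not depend on $r$, so they persist as $r \to 1$, and with them the invertibility of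
  $T_n(w)$.
\<close>

text \<open>The coefficient exponents \<open>d - 1\<close> of h and \<open>- 1 - d\<close> of the
  inverse of k balance exactly: the entries of H are of the size of those of the Hilbert matrix,
  whose rows are square-summable but not summable. Therefore the equation for p cannot be solved by
  l1 estimates. It is solved in l2, and half a power of n is then gained from a square-summable row
  of H. Two kernels of this size compose to a kernel with a logarithm, and this is what \<epsilon>
  pays for.

  The loss is harmless. The error of column t is small only when t stays away from n, so the sum
  over t is cut at n^\<kappa>, and the columns beyond are charged to the tail of y. Up to \<epsilon>
  the cut gives the exponent -d(1 - \<kappa>), which lies below the required -d + \<kappa>(1 - d) by
  \<kappa>(1 - 2d), a positive margin because d < 1/2.

  The l2 norm is only a functional on the Wiener algebra, which is not complete for it. Existence of
  p therefore needs a separate argument in the Wiener norm. It uses a weighted summability of the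
  inverse of k that the decay \<open>- 1 - d\<close> alone does not provide; it holds for each r < 1
  without uniformity, and no estimate depends on it.\<close>

unbundle no fps_syntax

section \<open>Complex matrices\<close>

text \<open>The norm inherited from nested vectors is the Frobenius norm. It is both
  submultiplicative and induced by an inner product, so it serves everywhere; the spectral norm
  enters only in the final comparison.\<close>

lemma norm_matrix_power2: "(norm (A :: complex^'n^'m))\<^sup>2 = (\<Sum>i\<in>UNIV. \<Sum>j\<in>UNIV. (cmod (A $ i $ j))\<^sup>2)"
  by (simp add: norm_vec_def L2_set_def sum_nonneg)

lemma norm_matrix_mult_le:
  fixes A :: "complex^'n^'m" and B :: "complex^'k^'n"
  shows "norm (A ** B) \<le> norm A * norm B"
proof (rule power2_le_imp_le)
  have "(norm (A ** B))\<^sup>2 = (\<Sum>i\<in>UNIV. \<Sum>j\<in>UNIV. (cmod (\<Sum>k\<in>UNIV. A $ i $ k * B $ k $ j))\<^sup>2)"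
    by (simp add: norm_matrix_power2 matrix_matrix_mult_def)
  also have "\<dots> \<le> (\<Sum>i\<in>UNIV. \<Sum>j\<in>UNIV. (\<Sum>k\<in>UNIV. (cmod (A $ i $ k))\<^sup>2) * (\<Sum>k\<in>UNIV. (cmod (B $ k $ j))\<^sup>2))"
  proof (intro sum_mono)
    fix i j
    have "cmod (\<Sum>k\<in>UNIV. A $ i $ k * B $ k $ j) \<le> (\<Sum>k\<in>UNIV. cmod (A $ i $ k) * cmod (B $ k $ j))"
      by (rule order_trans[OF norm_sum]) (simp add: norm_mult)
    hence "(cmod (\<Sum>k\<in>UNIV. A $ i $ k * B $ k $ j))\<^sup>2 \<le> (\<Sum>k\<in>UNIV. cmod (A $ i $ k) * cmod (B $ k $ j))\<^sup>2"
      by (intro power_mono) auto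
    also have "\<dots> \<le> (\<Sum>k\<in>UNIV. (cmod (A $ i $ k))\<^sup>2) * (\<Sum>k\<in>UNIV. (cmod (B $ k $ j))\<^sup>2)"
      by (rule Cauchy_Schwarz_ineq_sum)
    finally show "(cmod (\<Sum>k\<in>UNIV. A $ i $ k * B $ k $ j))\<^sup>2
        \<le> (\<Sum>k\<in>UNIV. (cmod (A $ i $ k))\<^sup>2) * (\<Sum>k\<in>UNIV. (cmod (B $ k $ j))\<^sup>2)" .
  qed
  also have "\<dots> = (\<Sum>i\<in>UNIV. \<Sum>k\<in>UNIV. (cmod (A $ i $ k))\<^sup>2) * (\<Sum>j\<in>UNIV. \<Sum>k\<in>UNIV. (cmod (B $ k $ j))\<^sup>2)"
    by (simp add: sum_product)
  also have "(\<Sum>j\<in>UNIV. \<Sum>k\<in>UNIV. (cmod (B $ k $ j))\<^sup>2) = (norm B)\<^sup>2"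
    unfolding norm_matrix_power2 by (rule sum.swap)
  finally show "(norm (A ** B))\<^sup>2 \<le> (norm A * norm B)\<^sup>2"
    by (simp add: norm_matrix_power2 power_mult_distrib)
qed simp

lemma bounded_bilinear_matrix_mult:
  "bounded_bilinear ((**) :: complex^'n^'m \<Rightarrow> complex^'k^'n \<Rightarrow> complex^'k^'m)"
proof
  show "\<exists>K. \<forall>(A :: complex^'n^'m) (B :: complex^'k^'n). norm (A ** B) \<le> norm A * norm B * K"
    by (rule exI[of _ 1]) (simp add: norm_matrix_mult_le)
qed (auto simp: matrix_matrix_mult_def vec_eq_iff algebra_simps sum.distrib scaleR_sum_right)

interpretation mmult: bounded_bilinear "(**) :: complex^'n^'m \<Rightarrow> complex^'k^'n \<Rightarrow> complex^'k^'m"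
  by (rule bounded_bilinear_matrix_mult)

lemma norm_hermitian_conj [simp]: "norm (hermitian_conj A) = norm A"
proof -
  have "(norm (hermitian_conj A))\<^sup>2 = (norm A)\<^sup>2"
    unfolding norm_matrix_power2 hermitian_conj_def by (subst sum.swap) simp
  thus ?thesis by simp
qed

lemma bounded_linear_hermitian_conj: "bounded_linear (hermitian_conj :: complex^'n^'m \<Rightarrow> complex^'m^'n)"
proof (rule bounded_linear_intro[where K = 1])
  show "norm (hermitian_conj A) \<le> norm A * 1" for A :: "complex^'n^'m" by simp
qed (auto simp: hermitian_conj_def vec_eq_iff)

lemmas hermitian_conj_zero [simp] = linear_0[OF bounded_linear.linear[OF bounded_linear_hermitian_conj]]
lemmas hermitian_conj_add = linear_add[OF bounded_linear.linear[OF bounded_linear_hermitian_conj]]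
lemmas hermitian_conj_minus = linear_neg[OF bounded_linear.linear[OF bounded_linear_hermitian_conj]]
lemmas hermitian_conj_sum = linear_sum[OF bounded_linear.linear[OF bounded_linear_hermitian_conj]]
lemmas hermitian_conj_scaleR = linear_scale[OF bounded_linear.linear[OF bounded_linear_hermitian_conj]]

lemma hermitian_conj_hermitian_conj [simp]: "hermitian_conj (hermitian_conj A) = A"
  by (simp add: hermitian_conj_def vec_eq_iff)

lemma hermitian_conj_mult: "hermitian_conj (A ** B) = hermitian_conj B ** hermitian_conj A"
  by (simp add: hermitian_conj_def vec_eq_iff matrix_matrix_mult_def mult.commute)

lemma hermitian_conj_mat_1 [simp]: "hermitian_conj (mat 1) = mat 1"
  by (auto simp: hermitian_conj_def vec_eq_iff mat_def)

text \<open>The real inner product of X and Y is the real part of the trace of X^H Y, so left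
  multiplication has the conjugate transpose as its adjoint.\<close>

lemma inner_matrix_mult_left:
  fixes A :: "complex^'n^'m" and B :: "complex^'k^'n"
  shows "(A ** B) \<bullet> C = B \<bullet> (hermitian_conj A ** C)"
proof -
  have *: "(x * y) \<bullet> z = y \<bullet> (cnj x * z)" for x y z :: complex
    by (simp add: inner_complex_def algebra_simps)
  have "(A ** B) \<bullet> C = (\<Sum>i\<in>UNIV. \<Sum>j\<in>UNIV. \<Sum>k\<in>UNIV. (A $ i $ k * B $ k $ j) \<bullet> C $ i $ j)"
    by (simp add: inner_vec_def matrix_matrix_mult_def inner_sum_left)
  also have "\<dots> = (\<Sum>i\<in>UNIV. \<Sum>k\<in>UNIV. \<Sum>j\<in>UNIV. (A $ i $ k * B $ k $ j) \<bullet> C $ i $ j)"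
    by (intro sum.cong refl sum.swap)
  also have "\<dots> = (\<Sum>k\<in>UNIV. \<Sum>i\<in>UNIV. \<Sum>j\<in>UNIV. (A $ i $ k * B $ k $ j) \<bullet> C $ i $ j)"
    by (rule sum.swap)
  also have "\<dots> = (\<Sum>k\<in>UNIV. \<Sum>j\<in>UNIV. \<Sum>i\<in>UNIV. (A $ i $ k * B $ k $ j) \<bullet> C $ i $ j)"
    by (intro sum.cong refl sum.swap)
  also have "\<dots> = B \<bullet> (hermitian_conj A ** C)"
    by (simp add: inner_vec_def matrix_matrix_mult_def inner_sum_right hermitian_conj_def *)
  finally show ?thesis .
qed

lemma mscale_mult_left: "mscale c A ** B = mscale c (A ** B)"
  by (simp add: mscale_def vec_eq_iff matrix_matrix_mult_def sum_distrib_left mult.assoc)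

lemma mscale_mult_right: "A ** mscale c B = mscale c (A ** B)"
  by (simp add: mscale_def vec_eq_iff matrix_matrix_mult_def sum_distrib_left mult.left_commute)

lemma mscale_mscale [simp]: "mscale b (mscale c A) = mscale (b * c) A"
  by (simp add: mscale_def mult.assoc)

lemma mscale_1 [simp]: "mscale 1 A = A"
  by (simp add: mscale_def)

lemma mscale_of_real: "mscale (of_real c) A = c *\<^sub>R A"
  by (simp add: mscale_def vec_eq_iff complex_eq_iff)

lemma hermitian_conj_mscale: "hermitian_conj (mscale c A) = mscale (cnj c) (hermitian_conj A)"
  by (simp add: mscale_def hermitian_conj_def vec_eq_iff)

lemma norm_mscale: "norm (mscale c A) = cmod c * norm A"
proof -
  have "(norm (mscale c A))\<^sup>2 = (cmod c * norm A)\<^sup>2"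
    unfolding norm_matrix_power2 power_mult_distrib mscale_def
    by (simp add: norm_mult power_mult_distrib sum_distrib_left)
  thus ?thesis by (simp add: power2_eq_iff_nonneg)
qed

lemma bounded_bilinear_mscale: "bounded_bilinear (mscale :: complex \<Rightarrow> complex^'n^'m \<Rightarrow> complex^'n^'m)"
proof
  show "\<exists>K. \<forall>c (A :: complex^'n^'m). norm (mscale c A) \<le> norm c * norm A * K"
    by (rule exI[of _ 1]) (simp add: norm_mscale)
qed (auto simp: mscale_def vec_eq_iff algebra_simps)

interpretation mscale: bounded_bilinear "mscale :: complex \<Rightarrow> complex^'n^'m \<Rightarrow> complex^'n^'m"
  by (rule bounded_bilinear_mscale)


lemma norm_matrix_vector_mult_le: "norm (A *v x) \<le> norm (A :: complex^'n^'m) * norm x"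
proof (rule power2_le_imp_le)
  have "(norm (A *v x))\<^sup>2 = (\<Sum>i\<in>UNIV. (cmod (\<Sum>j\<in>UNIV. A $ i $ j * x $ j))\<^sup>2)"
    by (simp add: norm_vec_def L2_set_def sum_nonneg matrix_vector_mult_def)
  also have "\<dots> \<le> (\<Sum>i\<in>UNIV. (\<Sum>j\<in>UNIV. (cmod (A $ i $ j))\<^sup>2) * (\<Sum>j\<in>UNIV. (cmod (x $ j))\<^sup>2))"
  proof (intro sum_mono)
    fix i
    have "cmod (\<Sum>j\<in>UNIV. A $ i $ j * x $ j) \<le> (\<Sum>j\<in>UNIV. cmod (A $ i $ j) * cmod (x $ j))"
      by (rule order_trans[OF norm_sum]) (simp add: norm_mult)
    hence "(cmod (\<Sum>j\<in>UNIV. A $ i $ j * x $ j))\<^sup>2 \<le> (\<Sum>j\<in>UNIV. cmod (A $ i $ j) * cmod (x $ j))\<^sup>2"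
      by (intro power_mono) auto
    also have "\<dots> \<le> (\<Sum>j\<in>UNIV. (cmod (A $ i $ j))\<^sup>2) * (\<Sum>j\<in>UNIV. (cmod (x $ j))\<^sup>2)"
      by (rule Cauchy_Schwarz_ineq_sum)
    finally show "(cmod (\<Sum>j\<in>UNIV. A $ i $ j * x $ j))\<^sup>2
        \<le> (\<Sum>j\<in>UNIV. (cmod (A $ i $ j))\<^sup>2) * (\<Sum>j\<in>UNIV. (cmod (x $ j))\<^sup>2)" .
  qed
  also have "\<dots> = (norm A * norm x)\<^sup>2"
    by (simp add: norm_matrix_power2 power_mult_distrib norm_vec_def[of x] L2_set_def sum_nonneg sum_distrib_right)
  finally show "(norm (A *v x))\<^sup>2 \<le> (norm A * norm x)\<^sup>2" .
qed simp

lemma spectral_norm_le_norm: "spectral_norm (A :: complex^'n^'m) \<le> norm A"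
  unfolding spectral_norm_def by (rule onorm_bound) (simp_all add: norm_matrix_vector_mult_le)

lemma spectral_norm_nonneg: "0 \<le> spectral_norm (A :: complex^'n^'m)"
  unfolding spectral_norm_def by (rule onorm_pos_le) (rule matrix_vector_mul_bounded_linear)

text \<open>Each entry is a component of the image of a unit vector. The crude factor is harmless,
  since the theorem is a statement up to constants.\<close>

lemma norm_le_spectral_norm: "norm (A :: complex^'n^'m) \<le> real (CARD('m) * CARD('n)) * spectral_norm A"
proof -
  have entry: "cmod (A $ i $ j) \<le> spectral_norm A" for i j
  proof -
    have "cmod (A $ i $ j) = cmod ((A *v axis j 1) $ i)"
      by (simp add: matrix_vector_mult_def axis_def if_distrib[of "(*) _"] cong: if_cong)
    also have "\<dots> \<le> norm (A *v axis j 1)" by (rule Finite_Cartesian_Product.norm_nth_le)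
    also have "\<dots> \<le> onorm ((*v) A) * norm (axis j 1 :: complex^'n)"
      by (rule onorm) (rule matrix_vector_mul_bounded_linear)
    also have "norm (axis j 1 :: complex^'n) = 1" by (simp add: norm_vec_def L2_set_def axis_def if_distrib[of norm] if_distrib[of "\<lambda>x. x\<^sup>2"] cong: if_cong)
    finally show ?thesis by (simp add: spectral_norm_def)
  qed
  have "norm A \<le> (\<Sum>i\<in>UNIV. norm (A $ i))" unfolding norm_vec_def by (rule L2_set_le_sum) simp
  also have "\<dots> \<le> (\<Sum>i\<in>(UNIV::'m set). \<Sum>j\<in>UNIV. cmod (A $ i $ j))"
    unfolding norm_vec_def by (intro sum_mono L2_set_le_sum) simp
  also have "\<dots> \<le> (\<Sum>i\<in>(UNIV::'m set). \<Sum>j\<in>(UNIV::'n set). spectral_norm A)"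
    by (intro sum_mono entry)
  finally show ?thesis by simp
qed

section \<open>The Wiener algebra of matrix-valued Fourier series\<close>

text \<open>Elements are the coefficient sequences themselves, so that supports and projections are
  plain index conditions. The function on the circle is recovered by \<open>ev\<close>, injectively
  by \<open>ev_eqI\<close>.\<close>

typedef 'q wiener = "{f :: int \<Rightarrow> complex^'q^'q. (\<lambda>k. norm (f k)) summable_on UNIV}"
  morphisms coeff_at Wiener
  by (rule exI[of _ "\<lambda>_. 0"]) simp

lemma summable_coeff_at: "(\<lambda>k. norm (coeff_at f k)) summable_on A"
  using coeff_at[of f] by (auto intro: summable_on_subset)

lemma wiener_eqI: "(\<And>k. coeff_at f k = coeff_at g k) \<Longrightarrow> f = g"
  by (metis coeff_at_inject ext)

lemma abs_summable_on_add:
  fixes f g :: "'a \<Rightarrow> 'b::real_normed_vector"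
  assumes "(\<lambda>k. norm (f k)) summable_on A" "(\<lambda>k. norm (g k)) summable_on A"
  shows "(\<lambda>k. norm (f k + g k)) summable_on A"
  by (rule summable_on_comparison_test[OF summable_on_add[OF assms]]) (auto intro: norm_triangle_ineq)

setup_lifting type_definition_wiener

instantiation wiener :: (finite) real_vector
begin

lift_definition zero_wiener :: "'a wiener" is "\<lambda>_. 0" by simp
lift_definition plus_wiener :: "'a wiener \<Rightarrow> 'a wiener \<Rightarrow> 'a wiener" is "\<lambda>f g k. f k + g k"
  by (rule abs_summable_on_add)
lift_definition minus_wiener :: "'a wiener \<Rightarrow> 'a wiener \<Rightarrow> 'a wiener" is "\<lambda>f g k. f k - g k"
  using abs_summable_on_add[of f UNIV "\<lambda>k. - g k" for f g] by simp
lift_definition uminus_wiener :: "'a wiener \<Rightarrow> 'a wiener" is "\<lambda>f k. - f k" by simp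
lift_definition scaleR_wiener :: "real \<Rightarrow> 'a wiener \<Rightarrow> 'a wiener" is "\<lambda>c f k. c *\<^sub>R f k"
  by (auto intro: summable_on_cmult_right)

instance
  by standard (transfer; simp add: algebra_simps fun_eq_iff)+

end

lemmas coeff_at_simps [simp] =
  zero_wiener.rep_eq plus_wiener.rep_eq minus_wiener.rep_eq uminus_wiener.rep_eq scaleR_wiener.rep_eq

instantiation wiener :: (finite) real_normed_vector
begin

definition norm_wiener :: "'a wiener \<Rightarrow> real" where
  "norm_wiener f = (\<Sum>\<^sub>\<infinity>k. norm (coeff_at f k))"
definition sgn_wiener :: "'a wiener \<Rightarrow> 'a wiener" where
  "sgn_wiener f = f /\<^sub>R norm f"
definition dist_wiener :: "'a wiener \<Rightarrow> 'a wiener \<Rightarrow> real" where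
  "dist_wiener f g = norm (f - g)"
definition uniformity_wiener :: "('a wiener \<times> 'a wiener) filter" where
  "uniformity_wiener = (INF e\<in>{0 <..}. principal {(x, y). dist x y < e})"
definition open_wiener :: "'a wiener set \<Rightarrow> bool" where
  "open_wiener U = (\<forall>x\<in>U. \<forall>\<^sub>F (x', y) in uniformity. x' = x \<longrightarrow> y \<in> U)"

instance
proof
  fix f g :: "'a wiener" and c :: real
  show "dist f g = norm (f - g)" by (rule dist_wiener_def)
  show "sgn f = f /\<^sub>R norm f" by (rule sgn_wiener_def)
  show "uniformity = (INF e\<in>{0 <..}. principal {(x, y :: 'a wiener). dist x y < e})"
    by (rule uniformity_wiener_def)
  show "open U = (\<forall>x\<in>U. \<forall>\<^sub>F (x', y) in uniformity. x' = x \<longrightarrow> y \<in> U)" for U :: "'a wiener set"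
    by (rule open_wiener_def)
  show "norm f = 0 \<longleftrightarrow> f = 0"
  proof
    assume "norm f = 0"
    hence "norm (coeff_at f k) = 0" for k
      unfolding norm_wiener_def
      by (intro nonneg_infsum_le_0D[where A = UNIV and f = "\<lambda>k. norm (coeff_at f k)"])
         (auto intro: summable_coeff_at)
    thus "f = 0" by (intro wiener_eqI) simp
  qed (simp add: norm_wiener_def)
  show "norm (f + g) \<le> norm f + norm g"
    unfolding norm_wiener_def
    using infsum_mono[OF summable_coeff_at[of "f + g" UNIV]
        summable_on_add[OF summable_coeff_at[of f UNIV] summable_coeff_at[of g UNIV]]]
    by (simp add: infsum_add summable_coeff_at norm_triangle_ineq)
  show "norm (c *\<^sub>R f) = \<bar>c\<bar> * norm f"
    unfolding norm_wiener_def by (simp add: infsum_cmult_right summable_coeff_at)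
qed

end

lemma has_sum_norm_wiener: "((\<lambda>k. norm (coeff_at f k)) has_sum norm f) UNIV"
  unfolding norm_wiener_def by (rule has_sum_infsum) (rule summable_coeff_at)

lemma infsum_norm_coeff_at_le: "(\<Sum>\<^sub>\<infinity>k\<in>A. norm (coeff_at f k)) \<le> norm f"
  unfolding norm_wiener_def by (rule infsum_mono_neutral) (auto intro: summable_coeff_at)

lemma sum_norm_coeff_at_le: "finite A \<Longrightarrow> (\<Sum>k\<in>A. norm (coeff_at f k)) \<le> norm f"
  using infsum_norm_coeff_at_le[of f A] by simp

lemma norm_coeff_at_le: "norm (coeff_at f k) \<le> norm f"
  using sum_norm_coeff_at_le[of "{k}" f] by simp

lemma bounded_linear_coeff_at: "bounded_linear (\<lambda>f. coeff_at f k)"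
  by (rule bounded_linear_intro[where K = 1]) (auto simp: norm_coeff_at_le)

lemma coeff_at_Wiener:
  assumes "\<And>A. finite A \<Longrightarrow> (\<Sum>k\<in>A. norm (f k)) \<le> C"
  shows "coeff_at (Wiener f) = f" and "norm (Wiener f) \<le> C"
proof -
  have s: "(\<lambda>k. norm (f k)) summable_on UNIV"
    by (rule nonneg_bdd_above_summable_on) (auto intro!: bdd_aboveI[where M = C] assms)
  thus c: "coeff_at (Wiener f) = f" by (intro Wiener_inverse) simp
  show "norm (Wiener f) \<le> C"
    unfolding norm_wiener_def c by (rule infsum_le_finite_sums[OF s]) (use assms in auto)
qed

text \<open>Completeness allows the Neumann series for p to be summed inside the algebra. Bounds on
  partial sums that are uniform in the finite index set survive the coefficientwise limit.\<close>

instance wiener :: (finite) banach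
proof
  fix X :: "nat \<Rightarrow> 'a wiener"
  assume X: "Cauchy X"
  have "Cauchy (\<lambda>n. coeff_at (X n) k)" for k
    by (rule bounded_linear.Cauchy[OF bounded_linear_coeff_at X])
  hence "\<exists>l. (\<lambda>n. coeff_at (X n) k) \<longlonglongrightarrow> l" for k
    using Cauchy_convergent_iff convergent_def by blast
  then obtain L where L: "\<And>k. (\<lambda>n. coeff_at (X n) k) \<longlonglongrightarrow> L k" by metis
  have close: "\<exists>N. \<forall>n\<ge>N. \<forall>A. finite A \<longrightarrow> (\<Sum>k\<in>A. norm (L k - coeff_at (X n) k)) \<le> e" if "e > 0" for e
  proof -
    from X that obtain N where N: "\<And>m n. m \<ge> N \<Longrightarrow> n \<ge> N \<Longrightarrow> norm (X m - X n) < e"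
      unfolding Cauchy_iff by blast
    have "(\<Sum>k\<in>A. norm (L k - coeff_at (X n) k)) \<le> e" if "n \<ge> N" "finite A" for n A
    proof (rule LIMSEQ_le_const2)
      show "(\<lambda>m. \<Sum>k\<in>A. norm (coeff_at (X m) k - coeff_at (X n) k)) \<longlonglongrightarrow> (\<Sum>k\<in>A. norm (L k - coeff_at (X n) k))"
        by (intro tendsto_intros L)
      show "\<exists>M. \<forall>m\<ge>M. (\<Sum>k\<in>A. norm (coeff_at (X m) k - coeff_at (X n) k)) \<le> e"
        using sum_norm_coeff_at_le[OF \<open>finite A\<close>, of "X _ - X n"] N[OF _ \<open>n \<ge> N\<close>]
        by (intro exI[of _ N] allI impI) (smt (verit) minus_wiener.rep_eq sum.cong)
    qed
    thus ?thesis by blast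
  qed
  obtain N where N: "\<And>A. finite A \<Longrightarrow> (\<Sum>k\<in>A. norm (L k - coeff_at (X N) k)) \<le> 1"
    using close[of 1] by auto
  define Y where "Y = Wiener L"
  have "(\<Sum>k\<in>A. norm (L k)) \<le> 1 + norm (X N)" if "finite A" for A
  proof -
    have "(\<Sum>k\<in>A. norm (L k)) \<le> (\<Sum>k\<in>A. norm (L k - coeff_at (X N) k) + norm (coeff_at (X N) k))"
      by (intro sum_mono) (metis norm_triangle_sub add.commute)
    also have "\<dots> \<le> 1 + norm (X N)"
      using N[OF that] sum_norm_coeff_at_le[OF that, of "X N"] by (simp add: sum.distrib)
    finally show ?thesis .
  qed
  hence Y: "coeff_at Y = L" unfolding Y_def by (rule coeff_at_Wiener)
  have "X \<longlonglongrightarrow> Y"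
  proof (rule LIMSEQ_I)
    fix e :: real assume "e > 0"
    then obtain M where M: "\<And>n A. n \<ge> M \<Longrightarrow> finite A \<Longrightarrow> (\<Sum>k\<in>A. norm (L k - coeff_at (X n) k)) \<le> e/2"
      using close[of "e/2"] by auto
    have "norm (X n - Y) < e" if "n \<ge> M" for n
    proof -
      have "norm (Y - X n) \<le> e/2"
        unfolding norm_wiener_def
        by (rule infsum_le_finite_sums[OF summable_coeff_at]) (use M[OF that] in \<open>auto simp: Y\<close>)
      thus ?thesis using \<open>e > 0\<close> by (simp add: norm_minus_commute)
    qed
    thus "\<exists>M. \<forall>n\<ge>M. norm (X n - Y) < e" by blast
  qed
  thus "convergent X" by (rule convergentI)
qed

lemma summable_on_norm_product:
  fixes f :: "'a \<Rightarrow> 'c::real_normed_vector" and g :: "'b \<Rightarrow> 'd::real_normed_vector"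
  assumes f: "(\<lambda>j. norm (f j)) summable_on A" and g: "(\<lambda>l. norm (g l)) summable_on B"
  shows "(\<lambda>(j, l). norm (f j) * norm (g l)) summable_on A \<times> B"
proof (rule summable_on_SigmaI)
  show "((\<lambda>l. case (j, l) of (j, l) \<Rightarrow> norm (f j) * norm (g l)) has_sum
      norm (f j) * infsum (\<lambda>l. norm (g l)) B) B" for j
    using g by (auto intro: has_sum_cmult_right)
  show "(\<lambda>j. norm (f j) * infsum (\<lambda>l. norm (g l)) B) summable_on A"
    using f by (rule summable_on_cmult_left)
qed auto

text \<open>The change of variables that turns the double family of a convolution into a product
  family, for which absolute summability is immediate.\<close>

lemma bij_shear: "bij_betw (\<lambda>(k, j). (j, k - j)) UNIV (UNIV :: (int \<times> int) set)"
  by (rule bij_betwI[where g = "\<lambda>(j, l). (j + l, j)"]) auto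

lemma summable_on_norm_convolution:
  fixes f g :: "'q::finite wiener"
  shows "(\<lambda>(k, j). norm (coeff_at f j) * norm (coeff_at g (k - j))) summable_on UNIV \<times> UNIV"
  using summable_on_reindex_bij_betw[OF bij_shear,
      of "\<lambda>(j, l). norm (coeff_at f j) * norm (coeff_at g l)"]
    summable_on_norm_product[OF summable_coeff_at[of f UNIV] summable_coeff_at[of g UNIV]]
  by (simp add: case_prod_unfold)

lemma summable_on_norm_convolution_row:
  fixes f g :: "'q::finite wiener"
  shows "(\<lambda>j. norm (coeff_at f j) * norm (coeff_at g (k - j))) summable_on A"
  using summable_on_SigmaD1[OF summable_on_norm_convolution[of f g], of k]
  by (auto intro: summable_on_subset)

lemma abs_summable_convolution_row:
  fixes f g :: "'q::finite wiener"
  shows "(\<lambda>j. norm (coeff_at f j ** coeff_at g (k - j))) summable_on A"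
  by (rule summable_on_comparison_test[OF summable_on_norm_convolution_row])
     (auto intro: norm_matrix_mult_le)

lemma summable_convolution_row:
  fixes f g :: "'q::finite wiener"
  shows "(\<lambda>j. coeff_at f j ** coeff_at g (k - j)) summable_on A"
  by (rule abs_summable_summable) (rule abs_summable_convolution_row)

lemma norm_convolution_le:
  fixes f g :: "'q::finite wiener"
  shows "norm (\<Sum>\<^sub>\<infinity>j. coeff_at f j ** coeff_at g (k - j))
    \<le> (\<Sum>\<^sub>\<infinity>j. norm (coeff_at f j) * norm (coeff_at g (k - j)))"
  by (rule order_trans[OF norm_infsum_bound])
     (auto intro!: infsum_mono abs_summable_convolution_row summable_on_norm_convolution_row norm_matrix_mult_le)

lemma summable_on_convolution_norms:
  fixes f g :: "'q::finite wiener"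
  shows "(\<lambda>k. \<Sum>\<^sub>\<infinity>j. norm (coeff_at f j) * norm (coeff_at g (k - j))) summable_on UNIV"
  using summable_on_Sigma_banach[OF summable_on_norm_convolution[of f g]] by simp

instantiation wiener :: (finite) times
begin

lift_definition times_wiener :: "'a wiener \<Rightarrow> 'a wiener \<Rightarrow> 'a wiener" is
  "\<lambda>f g k. \<Sum>\<^sub>\<infinity>j. f j ** g (k - j)"
  subgoal for f g
    using summable_on_comparison_test[OF summable_on_convolution_norms norm_convolution_le,
        of "Wiener f" "Wiener g"]
    by (simp add: Wiener_inverse)
  done

instance ..

end

lemma coeff_at_mult: "coeff_at (f * g) k = (\<Sum>\<^sub>\<infinity>j. coeff_at f j ** coeff_at g (k - j))"
  by (simp add: times_wiener.rep_eq)

lemma has_sum_coeff_at_mult: "((\<lambda>j. coeff_at f j ** coeff_at g (k - j)) has_sum coeff_at (f * g) k) UNIV"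
  unfolding coeff_at_mult by (rule has_sum_infsum) (rule summable_convolution_row)

lemma norm_wiener_mult_le: "norm (f * g) \<le> norm f * norm (g :: 'q::finite wiener)"
proof -
  have "norm (f * g) \<le> (\<Sum>\<^sub>\<infinity>k. \<Sum>\<^sub>\<infinity>j. norm (coeff_at f j) * norm (coeff_at g (k - j)))"
    unfolding norm_wiener_def coeff_at_mult
    by (rule infsum_mono[OF _ summable_on_convolution_norms norm_convolution_le])
       (simp add: summable_coeff_at flip: coeff_at_mult)
  also have "\<dots> = infsum (\<lambda>(k, j). norm (coeff_at f j) * norm (coeff_at g (k - j))) (UNIV \<times> UNIV)"
    by (subst infsum_Sigma'_banach) (use summable_on_norm_convolution in auto)
  also have "\<dots> = infsum (\<lambda>(j, l). norm (coeff_at f j) * norm (coeff_at g l)) (UNIV \<times> UNIV)"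
    using infsum_reindex_bij_betw[OF bij_shear,
      of "\<lambda>(j, l). norm (coeff_at f j) * norm (coeff_at g l)"] by (simp add: case_prod_unfold)
  also have "\<dots> = (\<Sum>\<^sub>\<infinity>j. \<Sum>\<^sub>\<infinity>l. norm (coeff_at f j) * norm (coeff_at g l))"
    by (subst infsum_Sigma'_banach)
       (use summable_on_norm_product[OF summable_coeff_at[of f UNIV] summable_coeff_at[of g UNIV]] in auto)
  also have "\<dots> = norm f * norm g"
    unfolding norm_wiener_def by (simp add: infsum_cmult_right' infsum_cmult_left')
  finally show ?thesis .
qed

lemma bounded_bilinear_wiener_mult: "bounded_bilinear ((*) :: 'q::finite wiener \<Rightarrow> _)"
proof
  fix f f' g g' :: "'q wiener" and r :: real
  show "(f + f') * g = f * g + f' * g"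
    by (rule wiener_eqI) (simp add: coeff_at_mult mmult.add_left infsum_add summable_convolution_row)
  show "f * (g + g') = f * g + f * g'"
    by (rule wiener_eqI) (simp add: coeff_at_mult mmult.add_right infsum_add summable_convolution_row)
  show "(r *\<^sub>R f) * g = r *\<^sub>R (f * g)"
    by (rule wiener_eqI) (simp add: coeff_at_mult mmult.scaleR_left infsum_scaleR_right summable_convolution_row)
  show "f * (r *\<^sub>R g) = r *\<^sub>R (f * g)"
    by (rule wiener_eqI) (simp add: coeff_at_mult mmult.scaleR_right infsum_scaleR_right summable_convolution_row)
  show "\<exists>K. \<forall>f g :: 'q wiener. norm (f * g) \<le> norm f * norm g * K"
    by (rule exI[of _ 1]) (simp add: norm_wiener_mult_le)
qed

lift_definition monom_at :: "int \<Rightarrow> complex^'q^'q \<Rightarrow> 'q::finite wiener" is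
  "\<lambda>k A j. if j = k then A else 0"
  subgoal for k A
    by (rule finite_nonzero_values_imp_summable_on) (rule finite_subset[of _ "{k}"], auto)
  done

lemma coeff_at_monom_at: "coeff_at (monom_at k A) j = (if j = k then A else 0)"
  by (simp add: monom_at.rep_eq)

lemma norm_monom_at [simp]: "norm (monom_at k A) = norm A"
proof -
  have "((\<lambda>j. norm (coeff_at (monom_at k A) j)) has_sum norm A) UNIV"
    by (rule has_sum_finite_neutralI[of "{k}"]) (auto simp: coeff_at_monom_at)
  thus ?thesis using has_sum_norm_wiener has_sum_unique by blast
qed

lemma has_sum_monom_at: "((\<lambda>k. monom_at k (coeff_at f k)) has_sum f) UNIV"
proof -
  have s: "(\<lambda>k. monom_at k (coeff_at f k)) summable_on UNIV"
    by (rule abs_summable_summable) (simp add: summable_coeff_at)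
  have "coeff_at (\<Sum>\<^sub>\<infinity>k. monom_at k (coeff_at f k)) j = coeff_at f j" for j
  proof -
    have "((\<lambda>k. coeff_at (monom_at k (coeff_at f k)) j) has_sum
        coeff_at (\<Sum>\<^sub>\<infinity>k. monom_at k (coeff_at f k)) j) UNIV"
      by (rule has_sum_bounded_linear[OF bounded_linear_coeff_at has_sum_infsum[OF s]])
    moreover have "((\<lambda>k. coeff_at (monom_at k (coeff_at f k)) j) has_sum coeff_at f j) UNIV"
      by (rule has_sum_finite_neutralI[of "{j}"]) (auto simp: coeff_at_monom_at)
    ultimately show ?thesis by (rule has_sum_unique)
  qed
  hence "(\<Sum>\<^sub>\<infinity>k. monom_at k (coeff_at f k)) = f" by (rule wiener_eqI)
  thus ?thesis using has_sum_infsum[OF s] by simp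
qed

text \<open>Monomials span a dense subspace. Associativity, the rule for \<open>star\<close> of a
  product and multiplicativity of \<open>ev\<close> are all reduced to monomials this way, one
  factor at a time, instead of rearranging multiple sums.\<close>

lemma bounded_linear_eq_on_monoms:
  fixes S T :: "'q::finite wiener \<Rightarrow> 'c::real_normed_vector"
  assumes "bounded_linear S" "bounded_linear T" "\<And>k A. S (monom_at k A) = T (monom_at k A)"
  shows "S f = T f"
  using has_sum_bounded_linear[OF assms(1) has_sum_monom_at[of f]]
    has_sum_bounded_linear[OF assms(2) has_sum_monom_at[of f]]
  by (simp add: assms(3) has_sum_unique)

lemma coeff_at_monom_at_mult: "coeff_at (monom_at k A * f) j = A ** coeff_at f (j - k)"
proof -
  have "((\<lambda>i. coeff_at (monom_at k A) i ** coeff_at f (j - i)) has_sum A ** coeff_at f (j - k)) UNIV"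
    by (rule has_sum_finite_neutralI[of "{k}"]) (auto simp: coeff_at_monom_at)
  thus ?thesis using has_sum_coeff_at_mult has_sum_unique by blast
qed

lemma coeff_at_mult_monom_at: "coeff_at (f * monom_at k A) j = coeff_at f (j - k) ** A"
proof -
  have "((\<lambda>i. coeff_at f i ** coeff_at (monom_at k A) (j - i)) has_sum coeff_at f (j - k) ** A) UNIV"
    by (rule has_sum_finite_neutralI[of "{j - k}"]) (auto simp: coeff_at_monom_at)
  thus ?thesis using has_sum_coeff_at_mult has_sum_unique by blast
qed

lemma monom_at_mult: "monom_at j A * monom_at k B = monom_at (j + k) (A ** B)"
  by (rule wiener_eqI) (auto simp: coeff_at_mult_monom_at coeff_at_monom_at)

lemma wiener_mult_assoc: "(f * g) * h = f * (g * (h :: 'q::finite wiener))"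
proof -
  note L = bounded_bilinear.bounded_linear_left[OF bounded_bilinear_wiener_mult]
  note R = bounded_bilinear.bounded_linear_right[OF bounded_bilinear_wiener_mult]
  note C = bounded_linear_compose
  have mmm: "(monom_at i A * monom_at j B) * monom_at k C = monom_at i A * (monom_at j B * monom_at k C)"
    for i j k and A B C :: "complex^'q^'q"
    by (simp add: monom_at_mult matrix_mul_assoc add.assoc)
  have mm: "(monom_at i A * monom_at j B) * h = monom_at i A * (monom_at j B * h)" for i j A B
    by (rule bounded_linear_eq_on_monoms[OF R C[OF R R] mmm])
  have m: "(monom_at i A * g) * h = monom_at i A * (g * h)" for i A
    by (rule bounded_linear_eq_on_monoms[OF C[OF L R] C[OF R L] mm])
  show ?thesis
    by (rule bounded_linear_eq_on_monoms[OF C[OF L L] L m])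
qed

text \<open>The class does not ask for a unit of norm 1: here \<open>1\<close> has norm
  \<open>norm (mat 1)\<close>, the square root of q in the Frobenius norm.\<close>

instantiation wiener :: (finite) "{ring_1, real_normed_algebra}"
begin

definition one_wiener :: "'a wiener" where "one_wiener = monom_at 0 (mat 1)"

instance
proof
  fix a b c :: "'a wiener" and r :: real
  show "a * b * c = a * (b * c)" by (rule wiener_mult_assoc)
  show "1 * a = a" by (rule wiener_eqI) (simp add: one_wiener_def coeff_at_monom_at_mult)
  show "a * 1 = a" by (rule wiener_eqI) (simp add: one_wiener_def coeff_at_mult_monom_at)
  show "(a + b) * c = a * c + b * c"
    by (rule bounded_bilinear.add_left[OF bounded_bilinear_wiener_mult])
  show "a * (b + c) = a * b + a * c"
    by (rule bounded_bilinear.add_right[OF bounded_bilinear_wiener_mult])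
  show "r *\<^sub>R a * b = r *\<^sub>R (a * b)"
    by (rule bounded_bilinear.scaleR_left[OF bounded_bilinear_wiener_mult])
  show "a * r *\<^sub>R b = r *\<^sub>R (a * b)"
    by (rule bounded_bilinear.scaleR_right[OF bounded_bilinear_wiener_mult])
  show "norm (a * b) \<le> norm a * norm b" by (rule norm_wiener_mult_le)
  show "(0 :: 'a wiener) \<noteq> 1"
  proof
    assume "(0 :: 'a wiener) = 1"
    hence "coeff_at (0 :: 'a wiener) 0 $ i $ i = coeff_at 1 0 $ i $ i" for i by simp
    thus False by (simp add: one_wiener_def coeff_at_monom_at mat_def)
  qed
qed

end

lemma coeff_at_one: "coeff_at 1 k = (if k = 0 then mat 1 else 0)"
  by (simp add: one_wiener_def coeff_at_monom_at)

text \<open>Pointwise conjugate transposition of the function on the circle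
  (\<open>ev_star\<close>), which reverses the frequencies; analytic series become
  anti-analytic.\<close>

lift_definition star :: "'q::finite wiener \<Rightarrow> 'q wiener" is "\<lambda>f k. hermitian_conj (f (- k))"
  subgoal for f
    using bij_uminus[where ?'a = int] summable_on_reindex_bij_betw[of uminus UNIV UNIV "\<lambda>k. norm (f k)"] by simp
  done

lemma coeff_at_star [simp]: "coeff_at (star f) k = hermitian_conj (coeff_at f (- k))"
  by (simp add: star.rep_eq)

lemma star_star [simp]: "star (star f) = f"
  by (rule wiener_eqI) simp

lemma norm_star [simp]: "norm (star f) = norm f"
  unfolding norm_wiener_def
  using bij_uminus[where ?'a = int] infsum_reindex_bij_betw[of uminus UNIV UNIV "\<lambda>k. norm (coeff_at f k)"] by simp

lemma bounded_linear_star: "bounded_linear (star :: 'q::finite wiener \<Rightarrow> _)"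
proof (rule bounded_linear_intro[where K = 1])
  show "star (f + g) = star f + star g" for f g :: "'q wiener"
    by (rule wiener_eqI) (simp add: hermitian_conj_add)
  show "star (r *\<^sub>R f) = r *\<^sub>R star f" for r and f :: "'q wiener"
    by (rule wiener_eqI) (simp add: hermitian_conj_scaleR)
qed simp

lemma star_one [simp]: "star 1 = 1"
  by (rule wiener_eqI) (simp add: coeff_at_one)

lemma star_monom_at: "star (monom_at k A) = monom_at (- k) (hermitian_conj A)"
  by (rule wiener_eqI) (auto simp: coeff_at_monom_at)

lemma star_mult: "star (f * g) = star g * star f"
proof -
  have m: "star (monom_at i A * g) = star g * star (monom_at i A)" for i A
    by (rule wiener_eqI)
       (simp add: coeff_at_monom_at_mult coeff_at_mult_monom_at star_monom_at hermitian_conj_mult)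
  show ?thesis
    by (rule bounded_linear_eq_on_monoms[OF
        bounded_linear_compose[OF bounded_linear_star bounded_linear_mult_left]
        bounded_linear_compose[OF bounded_linear_mult_right bounded_linear_star] m])
qed

text \<open>For half-lines S these are the Riesz projections: \<open>restr {..0}\<close> and
  \<open>restr {n + 1..}\<close> are the two projections in the Hankel operator.\<close>

lift_definition restr :: "int set \<Rightarrow> 'q::finite wiener \<Rightarrow> 'q wiener" is
  "\<lambda>S f k. if k \<in> S then f k else 0"
  by (rule summable_on_comparison_test) auto

lemma coeff_at_restr [simp]: "coeff_at (restr S f) k = (if k \<in> S then coeff_at f k else 0)"
  by (simp add: restr.rep_eq)

lemma norm_restr_le: "norm (restr S f) \<le> norm f"
  unfolding norm_wiener_def by (rule infsum_mono) (auto intro: summable_coeff_at simp del: coeff_at_restr, auto)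

lemma bounded_linear_restr: "bounded_linear (restr S)"
proof (rule bounded_linear_intro[where K = 1])
  show "restr S (f + g) = restr S f + restr S g" for f g
    by (rule wiener_eqI) simp
  show "restr S (r *\<^sub>R f) = r *\<^sub>R restr S f" for r f
    by (rule wiener_eqI) simp
qed (simp add: norm_restr_le)

definition supported :: "int set \<Rightarrow> 'q::finite wiener \<Rightarrow> bool" where
  "supported S f \<longleftrightarrow> (\<forall>k. k \<notin> S \<longrightarrow> coeff_at f k = 0)"

lemma supported_restr: "supported S (restr S f)"
  by (simp add: supported_def)


lemma supported_star: "supported S f \<Longrightarrow> supported (uminus ` S) (star f)"
  unfolding supported_def by (auto simp: image_iff) (metis hermitian_conj_zero minus_minus)

lemma supported_mult:
  assumes "supported S f" "supported T g" "\<And>i j. i \<in> S \<Longrightarrow> j \<in> T \<Longrightarrow> i + j \<in> U"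
  shows "supported U (f * g)"
  unfolding supported_def
proof (intro allI impI)
  fix k assume "k \<notin> U"
  hence "coeff_at f j ** coeff_at g (k - j) = 0" for j
  proof (cases "j \<in> S")
    case True
    hence "k - j \<notin> T" using assms(3)[of j "k - j"] \<open>k \<notin> U\<close> by auto
    thus ?thesis using assms(2) by (simp add: supported_def mmult.zero_right)
  next
    case False
    thus ?thesis using assms(1) by (simp add: supported_def mmult.zero_left)
  qed
  thus "coeff_at (f * g) k = 0" by (simp add: coeff_at_mult)
qed


lemma supported_mono: "supported S f \<Longrightarrow> S \<subseteq> T \<Longrightarrow> supported T f"
  by (auto simp: supported_def)

section \<open>Evaluation on the circle and Parseval's identity\<close>

definition ev :: "'q::finite wiener \<Rightarrow> real \<Rightarrow> complex^'q^'q" where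
  "ev f \<theta> = (\<Sum>\<^sub>\<infinity>k. mscale (cis (of_int k * \<theta>)) (coeff_at f k))"

lemma abs_summable_ev: "(\<lambda>k. norm (mscale (cis (of_int k * \<theta>)) (coeff_at f k))) summable_on A"
  unfolding norm_mscale norm_cis mult_1 by (rule summable_coeff_at)

lemma has_sum_ev: "((\<lambda>k. mscale (cis (of_int k * \<theta>)) (coeff_at f k)) has_sum ev f \<theta>) UNIV"
  unfolding ev_def by (rule has_sum_infsum[OF abs_summable_summable[OF abs_summable_ev]])

lemma norm_ev_le: "norm (ev f \<theta>) \<le> norm f"
  using norm_infsum_bound[OF abs_summable_ev[of \<theta> f UNIV]]
  by (simp add: ev_def norm_wiener_def norm_mscale)

lemma bounded_linear_ev: "bounded_linear (\<lambda>f. ev f \<theta>)"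
proof (rule bounded_linear_intro[where K = 1])
  show "ev (f + g) \<theta> = ev f \<theta> + ev g \<theta>" for f g :: "'q::finite wiener"
    using has_sum_add[OF has_sum_ev[of \<theta> f] has_sum_ev[of \<theta> g]] has_sum_ev[of \<theta> "f + g"]
    by (simp add: mscale.add_right has_sum_unique)
  show "ev (r *\<^sub>R f) \<theta> = r *\<^sub>R ev f \<theta>" for r and f :: "'q::finite wiener"
    using has_sum_bounded_linear[OF bounded_linear_scaleR_right has_sum_ev[of \<theta> f], of r]
      has_sum_ev[of \<theta> "r *\<^sub>R f"]
    by (simp add: mscale.scaleR_right has_sum_unique)
qed (simp add: norm_ev_le)

lemma ev_monom_at: "ev (monom_at k A) \<theta> = mscale (cis (of_int k * \<theta>)) A"
proof -
  have "((\<lambda>j. mscale (cis (of_int j * \<theta>)) (coeff_at (monom_at k A) j)) has_sum mscale (cis (of_int k * \<theta>)) A) UNIV"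
    by (rule has_sum_finite_neutralI[of "{k}"]) (auto simp: coeff_at_monom_at mscale.zero_right)
  thus ?thesis using has_sum_ev has_sum_unique by blast
qed

lemma ev_one [simp]: "ev 1 \<theta> = mat 1"
  by (simp add: one_wiener_def ev_monom_at)

lemma ev_diff: "ev (f - g) \<theta> = ev f \<theta> - ev g \<theta>"
  by (rule linear_diff[OF bounded_linear.linear[OF bounded_linear_ev]])

lemma ev_scaleR: "ev (c *\<^sub>R f) \<theta> = c *\<^sub>R ev f \<theta>"
  by (rule linear_scale[OF bounded_linear.linear[OF bounded_linear_ev]])

lemma ev_mult: "ev (f * g) \<theta> = ev f \<theta> ** ev g \<theta>"
proof -
  note E = bounded_linear_ev and C = bounded_linear_compose
  note L = bounded_bilinear.bounded_linear_left[OF bounded_bilinear_matrix_mult]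
  note R = bounded_bilinear.bounded_linear_right[OF bounded_bilinear_matrix_mult]
  have mm: "ev (monom_at i A * monom_at j B) \<theta> = ev (monom_at i A) \<theta> ** ev (monom_at j B) \<theta>"
    for i j and A B :: "complex^'a^'a"
    by (simp add: monom_at_mult ev_monom_at mscale_mult_left mscale_mult_right cis_mult algebra_simps)
  have m: "ev (monom_at i A * g) \<theta> = ev (monom_at i A) \<theta> ** ev g \<theta>" for i A
    by (rule bounded_linear_eq_on_monoms[OF C[OF E bounded_linear_mult_right] C[OF R E] mm])
  show ?thesis
    by (rule bounded_linear_eq_on_monoms[OF C[OF E bounded_linear_mult_left] C[OF L E] m])
qed

lemma ev_star: "ev (star f) \<theta> = hermitian_conj (ev f \<theta>)"
proof -
  have m: "ev (star (monom_at k A)) \<theta> = hermitian_conj (ev (monom_at k A) \<theta>)" for k and A :: "complex^'a^'a"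
    by (simp add: star_monom_at ev_monom_at hermitian_conj_mscale cis_cnj)
  show ?thesis
    by (rule bounded_linear_eq_on_monoms[OF bounded_linear_compose[OF bounded_linear_ev bounded_linear_star]
        bounded_linear_compose[OF bounded_linear_hermitian_conj bounded_linear_ev] m])
qed

lemma continuous_on_ev: "continuous_on UNIV (ev f)"
proof (rule uniform_limit_theorem[where F = "finite_subsets_at_top (UNIV :: int set)"])
  let ?F = "finite_subsets_at_top (UNIV :: int set)"
  let ?S = "\<lambda>A. \<Sum>k\<in>A. monom_at k (coeff_at f k)"
  show "\<forall>\<^sub>F A in ?F. continuous_on UNIV (ev (?S A))"
  proof (rule always_eventually, rule allI)
    fix A
    have "ev (?S A) = (\<lambda>\<theta>. \<Sum>k\<in>A. mscale (cis (of_int k * \<theta>)) (coeff_at f k))"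
      by (simp add: linear_sum[OF bounded_linear.linear[OF bounded_linear_ev]] ev_monom_at fun_eq_iff)
    thus "continuous_on UNIV (ev (?S A))"
      by (auto intro!: continuous_intros mscale.continuous_on simp: cis_conv_exp)
  qed
  have lim: "(?S \<longlongrightarrow> f) ?F"
    using has_sum_monom_at[of f] by (simp add: has_sum_def)
  show "uniform_limit UNIV (\<lambda>A. ev (?S A)) (ev f) ?F"
  proof (rule uniform_limitI)
    fix e :: real assume "e > 0"
    from tendstoD[OF lim this] show "\<forall>\<^sub>F A in ?F. \<forall>\<theta>\<in>UNIV. dist (ev (?S A) \<theta>) (ev f \<theta>) < e"
    proof eventually_elim
      fix A assume "dist (?S A) f < e"
      thus "\<forall>\<theta>\<in>UNIV. dist (ev (?S A) \<theta>) (ev f \<theta>) < e"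
        using norm_ev_le[of "?S A - f"] unfolding dist_norm ev_diff by (meson order_le_less_trans)
    qed
  qed
qed simp

lemma set_integral_cis_mscale:
  "(LINT \<theta>:{-pi..pi}|lborel. mscale (cis (of_int k * \<theta>)) A) = (if k = 0 then (2 * pi) *\<^sub>R A else 0)"
proof (cases "k = 0")
  case True
  thus ?thesis
    by (simp add: set_lebesgue_integral_def integral_scaleR_left)
next
  case False
  define F where "F = (\<lambda>\<theta>. mscale (cis (of_int k * \<theta>) / (\<i> * of_int k)) A)"
  have "set_lebesgue_integral lborel {-pi..pi} (\<lambda>\<theta>. mscale (cis (of_int k * \<theta>)) A) = F pi - F (- pi)"
    unfolding set_lebesgue_integral_def
  proof (rule integral_FTC_atLeastAtMost)
    fix x :: real
    have "((\<lambda>\<theta>. cis (of_int k * \<theta>)) has_vector_derivative (\<i> * of_int k * cis (of_int k * x))) (at x within {-pi..pi})"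
      unfolding cis_conv_exp
      by (auto intro!: derivative_eq_intros has_vector_derivative_real_field simp: algebra_simps)
    hence "((\<lambda>\<theta>. cis (of_int k * \<theta>) / (\<i> * of_int k)) has_vector_derivative
        (\<i> * of_int k * cis (of_int k * x)) / (\<i> * of_int k)) (at x within {-pi..pi})"
      by (rule has_vector_derivative_divide)
    hence "((\<lambda>\<theta>. cis (of_int k * \<theta>) / (\<i> * of_int k)) has_vector_derivative
        cis (of_int k * x)) (at x within {-pi..pi})"
      using False by simp
    thus "(F has_vector_derivative mscale (cis (of_int k * x)) A) (at x within {-pi..pi})"
      unfolding F_def by (rule bounded_linear.has_vector_derivative[OF mscale.bounded_linear_left])
  next
    show "continuous_on {-pi..pi} (\<lambda>\<theta>. mscale (cis (of_int k * \<theta>)) A)"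
      by (auto intro!: continuous_intros mscale.continuous_on simp: cis_conv_exp)
  qed simp
  also have "cis (of_int k * pi) = cis (of_int k * (- pi))"
  proof -
    have "cis (of_int k * pi) = cis (of_int k * (- pi)) * cis (2 * pi * of_int k)"
      by (simp add: cis_mult algebra_simps)
    thus ?thesis by (simp add: cis_multiple_2pi)
  qed
  hence "F pi - F (- pi) = 0" by (simp add: F_def)
  finally show ?thesis using False by simp
qed

text \<open>Both sides are bounded linear in \<open>f\<close>, so it suffices to check monomials.\<close>

lemma integral_ev:
  "(LINT \<theta>:{-pi..pi}|lborel. mscale (cis (of_int (- k) * \<theta>)) (ev f \<theta>)) = (2 * pi) *\<^sub>R coeff_at f k"
proof -
  let ?g = "\<lambda>f \<theta>. mscale (cis (of_int (- k) * \<theta>)) (ev f \<theta>)"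
  have int: "set_integrable lborel {-pi..pi} (?g f)" for f :: "'a wiener"
    by (rule borel_integrable_atLeastAtMost')
       (auto intro!: continuous_intros mscale.continuous_on continuous_on_subset[OF continuous_on_ev]
         simp: cis_conv_exp)
  have bl: "bounded_linear (\<lambda>f :: 'a wiener. LINT \<theta>:{-pi..pi}|lborel. ?g f \<theta>)"
  proof (rule bounded_linear_intro[where K = "2 * pi"])
    fix f g :: "'a wiener" and r :: real
    show "(LINT \<theta>:{-pi..pi}|lborel. ?g (f + g) \<theta>)
        = (LINT \<theta>:{-pi..pi}|lborel. ?g f \<theta>) + (LINT \<theta>:{-pi..pi}|lborel. ?g g \<theta>)"
      using set_integral_add(2)[OF int int, of f g]
      by (simp add: linear_add[OF bounded_linear.linear[OF bounded_linear_ev]] mscale.add_right)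
    show "(LINT \<theta>:{-pi..pi}|lborel. ?g (r *\<^sub>R f) \<theta>) = r *\<^sub>R (LINT \<theta>:{-pi..pi}|lborel. ?g f \<theta>)"
      by (simp add: ev_scaleR mscale.scaleR_right)
    have "norm (LINT \<theta>:{-pi..pi}|lborel. ?g f \<theta>) \<le> (LINT \<theta>:{-pi..pi}|lborel. norm (?g f \<theta>))"
      using int by (rule set_integral_norm_bound)
    also have "\<dots> \<le> (LINT \<theta>:{-pi..pi}|lborel. norm f)"
    proof (rule set_integral_mono)
      show "set_integrable lborel {-pi..pi} (\<lambda>\<theta>. norm (?g f \<theta>))"
        using int by (rule set_integrable_norm)
      show "set_integrable lborel {-pi..pi} (\<lambda>\<theta>. norm f)"
        by (rule borel_integrable_atLeastAtMost') simp
    qed (simp add: norm_mscale norm_ev_le)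
    also have "\<dots> = norm f * (2 * pi)" by (simp add: set_lebesgue_integral_def)
    finally show "norm (LINT \<theta>:{-pi..pi}|lborel. ?g f \<theta>) \<le> norm f * (2 * pi)" .
  qed
  show ?thesis
  proof (rule bounded_linear_eq_on_monoms[OF bl
        bounded_linear_compose[OF bounded_linear_scaleR_right bounded_linear_coeff_at]])
    fix j and A :: "complex^'a^'a"
    have "?g (monom_at j A) \<theta> = mscale (cis (of_int (j - k) * \<theta>)) A" for \<theta>
      by (simp add: ev_monom_at cis_mult algebra_simps)
    thus "(LINT \<theta>:{-pi..pi}|lborel. ?g (monom_at j A) \<theta>) = (2 * pi) *\<^sub>R coeff_at (monom_at j A) k"
      using set_integral_cis_mscale[of "j - k" A] by (auto simp: coeff_at_monom_at)
  qed
qed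

lemma fourier_coeff_ev:
  assumes "\<And>\<theta>. w (cis \<theta>) = ev f \<theta>"
  shows "fourier_coeff w k = coeff_at f k"
proof -
  have "exp (- \<i> * of_int k * of_real \<theta>) = cis (of_int (- k) * \<theta>)" for \<theta>
    by (simp add: cis_conv_exp algebra_simps)
  moreover have "exp (\<i> * of_real \<theta>) = cis \<theta>" for \<theta> by (simp add: cis_conv_exp)
  ultimately show ?thesis unfolding fourier_coeff_def using integral_ev[of k f] assms by simp
qed

lemma ev_eqI:
  assumes "\<And>\<theta>. ev f \<theta> = ev g \<theta>"
  shows "f = g"
proof (rule wiener_eqI)
  fix k
  have "(2 * pi) *\<^sub>R coeff_at f k = (2 * pi) *\<^sub>R coeff_at g k"
    unfolding integral_ev[symmetric] assms ..
  thus "coeff_at f k = coeff_at g k" by simp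
qed

text \<open>The l2 inner product of the coefficient sequences (\<open>has_sum_ip\<close>), written
  as a trace of the constant term. In this form the adjoint relation \<open>ip_mult_left\<close> is
  just associativity.\<close>

definition ip :: "'q::finite wiener \<Rightarrow> 'q wiener \<Rightarrow> real" where
  "ip f g = mat 1 \<bullet> coeff_at (star f * g) 0"

lemma has_sum_ip: "((\<lambda>k. coeff_at f k \<bullet> coeff_at g k) has_sum ip f g) UNIV"
proof -
  have "((\<lambda>j. mat 1 \<bullet> (coeff_at (star f) j ** coeff_at g (0 - j))) has_sum ip f g) UNIV"
    unfolding ip_def
    by (rule has_sum_bounded_linear[OF bounded_linear_inner_right has_sum_coeff_at_mult])
  hence "((\<lambda>j. coeff_at f (- j) \<bullet> coeff_at g (- j)) has_sum ip f g) UNIV"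
    by (simp add: inner_matrix_mult_left[symmetric])
  thus ?thesis using bij_uminus[where ?'a = int] has_sum_reindex_bij_betw[of uminus UNIV UNIV
        "\<lambda>k. coeff_at f k \<bullet> coeff_at g k"] by simp
qed

lemma ip_add_right: "ip f (g + h) = ip f g + ip f h"
  by (simp add: ip_def distrib_left inner_add_right)

lemma ip_diff_right: "ip f (g - h) = ip f g - ip f h"
  by (simp add: ip_def right_diff_distrib inner_diff_right)

lemma ip_scaleR_right: "ip f (c *\<^sub>R g) = c * ip f g"
  by (simp add: ip_def)

lemma ip_commute: "ip f g = ip g f"
  using has_sum_ip[of f g] has_sum_ip[of g f] by (simp add: inner_commute has_sum_unique)

lemma ip_mult_left: "ip (u * f) g = ip f (star u * g)"
  by (simp add: ip_def star_mult mult.assoc)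

lemma ip_restr: "ip (restr S f) g = ip (restr S f) (restr S g)"
proof -
  have "(\<lambda>k. coeff_at (restr S f) k \<bullet> coeff_at g k) = (\<lambda>k. coeff_at (restr S f) k \<bullet> coeff_at (restr S g) k)"
    by auto
  from has_sum_ip[of "restr S f" g, unfolded this] has_sum_ip[of "restr S f" "restr S g"]
  show ?thesis by (rule has_sum_unique)
qed

lemma ip_nonneg: "0 \<le> ip f f"
  by (rule has_sum_nonneg[OF has_sum_ip]) simp

lemma has_sum_ip_self: "((\<lambda>k. (norm (coeff_at f k))\<^sup>2) has_sum ip f f) UNIV"
  using has_sum_ip[of f f] by (simp add: power2_norm_eq_inner)

text \<open>The norm of the type is the l1 norm, so \<open>ip\<close> is not its inner product; the
  inequality is derived from positivity of the quadratic form.\<close>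

lemma ip_Cauchy_Schwarz: "\<bar>ip f g\<bar> \<le> sqrt (ip f f) * sqrt (ip g g)"
proof -
  have quad: "0 \<le> ip f f * t\<^sup>2 - 2 * t * ip f g + ip g g" for t
  proof -
    have "0 \<le> ip (t *\<^sub>R f - g) (t *\<^sub>R f - g)" by (rule ip_nonneg)
    also have "\<dots> = ip f f * t\<^sup>2 - 2 * t * ip f g + ip g g"
      by (simp add: ip_diff_right ip_scaleR_right ip_commute[of "t *\<^sub>R f - g"] ip_commute[of g f]
          power2_eq_square algebra_simps)
    finally show ?thesis .
  qed
  have "(ip f g)\<^sup>2 \<le> ip f f * ip g g"
  proof (cases "ip f f = 0")
    case True
    have "ip f g = 0"
    proof (rule ccontr)
      assume n: "ip f g \<noteq> 0"
      \<comment> \<open>For \<open>ip f f = 0\<close> the quadratic is affine in \<open>t\<close>;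
        at this \<open>t\<close> its value is -1.\<close>
      hence "2 * ((ip g g + 1) / (2 * ip f g)) * ip f g = ip g g + 1" by simp
      thus False using quad[of "(ip g g + 1) / (2 * ip f g)"] True by simp
    qed
    thus ?thesis using True by simp
  next
    case False
    hence pos: "ip f f > 0" using ip_nonneg[of f] by simp
    define t where "t = ip f g / ip f f"
    have t: "ip f g = t * ip f f" using False by (simp add: t_def)
    have "0 \<le> ip f f * (ip f f * t\<^sup>2 - 2 * t * ip f g + ip g g)"
      using pos quad[of t] by (intro mult_nonneg_nonneg) auto
    also have "\<dots> = ip f f * ip g g - (ip f g)\<^sup>2"
      unfolding t by (simp add: power2_eq_square algebra_simps)
    finally show ?thesis by simp
  qed
  hence "sqrt ((ip f g)\<^sup>2) \<le> sqrt (ip f f * ip g g)" by (rule real_sqrt_le_mono)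
  thus ?thesis by (simp add: real_sqrt_mult)
qed

definition l2 :: "'q::finite wiener \<Rightarrow> real" where
  "l2 f = sqrt (ip f f)"

lemma l2_nonneg [simp]: "0 \<le> l2 f"
  by (simp add: l2_def ip_nonneg)

lemma l2_power2: "(l2 f)\<^sup>2 = ip f f"
  by (simp add: l2_def ip_nonneg)

lemma ip_le_l2: "ip f g \<le> l2 f * l2 g"
  using ip_Cauchy_Schwarz[of f g] by (simp add: l2_def)

lemma l2_leI:
  assumes "\<And>A. finite A \<Longrightarrow> (\<Sum>k\<in>A. (norm (coeff_at f k))\<^sup>2) \<le> C\<^sup>2" "0 \<le> C"
  shows "l2 f \<le> C"
  unfolding l2_def using has_sum_le_finite_sums[OF has_sum_ip_self assms(1)] assms(2)
  by (simp add: real_le_lsqrt)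

lemma sum_power2_le_l2:
  assumes "finite A"
  shows "(\<Sum>k\<in>A. (norm (coeff_at f k))\<^sup>2) \<le> (l2 f)\<^sup>2"
  unfolding l2_power2 by (rule finite_sum_le_has_sum[OF has_sum_ip_self assms]) auto

lemma norm_coeff_at_le_l2: "norm (coeff_at f k) \<le> l2 f"
  using sum_power2_le_l2[of "{k}" f] by (simp add: power2_le_iff_abs_le)

lemma l2_restr_le: "l2 (restr S f) \<le> l2 f"
proof (rule l2_leI)
  fix A :: "int set" assume "finite A"
  have "(\<Sum>k\<in>A. (norm (coeff_at (restr S f) k))\<^sup>2) \<le> (\<Sum>k\<in>A. (norm (coeff_at f k))\<^sup>2)"
    by (intro sum_mono) auto
  also have "\<dots> \<le> (l2 f)\<^sup>2" by (rule sum_power2_le_l2) fact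
  finally show "(\<Sum>k\<in>A. (norm (coeff_at (restr S f) k))\<^sup>2) \<le> (l2 f)\<^sup>2" .
qed simp

lemma parseval: "(LINT \<theta>:{-pi..pi}|lborel. (norm (ev f \<theta>))\<^sup>2) = 2 * pi * (l2 f)\<^sup>2"
proof -
  let ?g = "star f * f"
  have "(norm (ev f \<theta>))\<^sup>2 = mat 1 \<bullet> ev ?g \<theta>" for \<theta>
    by (simp add: ev_mult ev_star inner_matrix_mult_left[symmetric] power2_norm_eq_inner)
  hence "(LINT \<theta>:{-pi..pi}|lborel. (norm (ev f \<theta>))\<^sup>2) = (LINT \<theta>:{-pi..pi}|lborel. mat 1 \<bullet> ev ?g \<theta>)"
    by simp
  also have "\<dots> = mat 1 \<bullet> (LINT \<theta>:{-pi..pi}|lborel. ev ?g \<theta>)"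
  proof -
    have "set_integrable lborel {-pi..pi} (ev ?g)"
      by (rule borel_integrable_atLeastAtMost') (rule continuous_on_subset[OF continuous_on_ev], simp)
    hence "integrable lborel (\<lambda>\<theta>. indicator {-pi..pi} \<theta> *\<^sub>R ev ?g \<theta>)"
      by (simp add: set_integrable_def)
    from integral_inner_right[OF this, of "mat 1"] show ?thesis
      by (simp add: set_lebesgue_integral_def)
  qed
  also have "(LINT \<theta>:{-pi..pi}|lborel. ev ?g \<theta>) = (2 * pi) *\<^sub>R coeff_at ?g 0"
    using integral_ev[of 0 ?g] by simp
  also have "mat 1 \<bullet> ((2 * pi) *\<^sub>R coeff_at ?g 0) = 2 * pi * (l2 f)\<^sup>2"
    by (simp add: l2_power2 ip_def)
  finally show ?thesis .
qed

text \<open>Through Parseval's identity a pointwise bound on the circle becomes a bound in l2. This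
  is how the uniform distance of u from the anti-analytic functions turns into an operator
  norm.\<close>

lemma l2_le_of_ev_le:
  fixes f g :: "'q::finite wiener"
  assumes "\<And>\<theta>. norm (ev f \<theta>) \<le> c * norm (ev g \<theta>)" "0 \<le> c"
  shows "l2 f \<le> c * l2 g"
proof -
  have int: "set_integrable lborel {-pi..pi} (\<lambda>\<theta>. (norm (ev f \<theta>))\<^sup>2)" for f :: "'q wiener"
    by (rule borel_integrable_atLeastAtMost')
       (intro continuous_intros continuous_on_subset[OF continuous_on_ev], simp)
  have "2 * pi * (l2 f)\<^sup>2 = (LINT \<theta>:{-pi..pi}|lborel. (norm (ev f \<theta>))\<^sup>2)" by (simp add: parseval)
  also have "\<dots> \<le> (LINT \<theta>:{-pi..pi}|lborel. c\<^sup>2 * (norm (ev g \<theta>))\<^sup>2)"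
  proof (rule set_integral_mono)
    show "set_integrable lborel {-pi..pi} (\<lambda>\<theta>. c\<^sup>2 * (norm (ev g \<theta>))\<^sup>2)"
      by (rule set_integrable_mult_right) (rule int)
    show "(norm (ev f \<theta>))\<^sup>2 \<le> c\<^sup>2 * (norm (ev g \<theta>))\<^sup>2" for \<theta>
      using power_mono[OF assms(1), where n = 2] by (simp add: power_mult_distrib)
  qed (rule int)
  also have "\<dots> = 2 * pi * (c * l2 g)\<^sup>2" by (simp add: parseval power_mult_distrib)
  finally have "(l2 f)\<^sup>2 \<le> (c * l2 g)\<^sup>2" by simp
  thus ?thesis by (rule power2_le_imp_le) (simp add: assms(2))
qed

section \<open>Sums of powers\<close>

text \<open>Discrete comparison with a primitive F of f. An arbitrary subset A is allowed because
  infinite sums are reached through all finite index sets.\<close>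

lemma sum_le_telescope:
  fixes f F :: "int \<Rightarrow> real"
  assumes "n \<le> m" "A \<subseteq> {n<..m}"
    and "\<And>i. n < i \<Longrightarrow> 0 \<le> f i" and "\<And>i. n < i \<Longrightarrow> f i \<le> F i - F (i - 1)"
  shows "sum f A \<le> F m - F n"
proof -
  have "sum f A \<le> sum f {n<..m}"
    using assms by (intro sum_mono2) auto
  also have "\<dots> \<le> F m - F n"
    using \<open>n \<le> m\<close>
  proof (induction m rule: int_ge_induct)
    case (step i)
    have "{n<..i + 1} = insert (i + 1) {n<..i}" using step.hyps by auto
    thus ?case using step assms(4)[of "i + 1"] by simp
  qed simp
  finally show ?thesis .
qed

lemma powr_increment_ge:
  fixes x a :: real
  assumes "0 \<le> x" "0 < a" "a < 1"
  shows "a * (x + 1) powr (a - 1) \<le> (x + 1) powr a - x powr a"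
proof (cases "x = 0")
  case True
  thus ?thesis using assms by simp
next
  case False
  hence x: "0 < x" using assms by simp
  have "\<exists>z>x. z < x + 1 \<and> (x + 1) powr a - x powr a = (x + 1 - x) * (a * z powr (a - 1))"
    by (rule MVT2) (use x in \<open>auto intro!: derivative_eq_intros\<close>)
  then obtain z where z: "x < z" "z < x + 1" "(x + 1) powr a - x powr a = a * z powr (a - 1)"
    by auto
  have "(x + 1) powr (a - 1) \<le> z powr (a - 1)"
    by (rule powr_mono2') (use z x assms in auto)
  thus ?thesis using z(3) assms by simp
qed

lemma powr_decrement_ge:
  fixes x a :: real
  assumes "0 < x" "0 < a"
  shows "a * (x + 1) powr (- 1 - a) \<le> x powr (- a) - (x + 1) powr (- a)"
proof -
  have "\<exists>z>x. z < x + 1 \<and> (- ((x + 1) powr (- a))) - (- (x powr (- a))) = (x + 1 - x) * (a * z powr (- 1 - a))"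
    by (rule MVT2) (use assms in \<open>auto intro!: derivative_eq_intros simp: minus_diff_commute\<close>)
  then obtain z where z: "x < z" "z < x + 1" "x powr (- a) - (x + 1) powr (- a) = a * z powr (- 1 - a)"
    by auto
  have "(x + 1) powr (- 1 - a) \<le> z powr (- 1 - a)"
    by (rule powr_mono2') (use z assms in auto)
  thus ?thesis using z(3) assms by simp
qed

lemma sum_powr_le:
  assumes "0 < d" "d < 1" "0 \<le> n"
  shows "(\<Sum>s\<in>{1..n :: int}. real_of_int s powr (- d)) \<le> real_of_int n powr (1 - d) / (1 - d)"
proof -
  let ?F = "\<lambda>i. real_of_int i powr (1 - d) / (1 - d)"
  have "(\<Sum>s\<in>{1..n}. real_of_int s powr (- d)) \<le> ?F n - ?F 0"
  proof (rule sum_le_telescope)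
    fix i :: int assume "0 < i"
    thus "real_of_int i powr (- d) \<le> ?F i - ?F (i - 1)"
      using powr_increment_ge[of "real_of_int i - 1" "1 - d"] assms
      by (simp add: field_simps flip: diff_divide_distrib)
  qed (use assms in auto)
  thus ?thesis using assms by simp
qed

lemma sum_powr_tail_le:
  assumes "0 < a" "1 \<le> n" "finite A" "A \<subseteq> {n<..}"
  shows "(\<Sum>j\<in>A. real_of_int j powr (- 1 - a)) \<le> real_of_int n powr (- a) / a"
proof -
  let ?F = "\<lambda>i. - (real_of_int i powr (- a) / a)"
  define m where "m = Max (insert n A)"
  have "A \<subseteq> {n<..m}" "n \<le> m"
    using assms by (auto simp: m_def)
  hence "(\<Sum>j\<in>A. real_of_int j powr (- 1 - a)) \<le> ?F m - ?F n"
  proof (intro sum_le_telescope)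
    fix i :: int assume "n < i"
    thus "real_of_int i powr (- 1 - a) \<le> ?F i - ?F (i - 1)"
      using powr_decrement_ge[of "real_of_int i - 1" a] assms
      by (simp add: field_simps flip: diff_divide_distrib)
  qed (use assms in auto)
  also have "\<dots> \<le> real_of_int n powr (- a) / a"
    using assms by simp
  finally show ?thesis .
qed

lemma sum_powr_from_1_le:
  assumes "0 < a" "finite A" "A \<subseteq> {1..}"
  shows "(\<Sum>j\<in>A. real_of_int j powr (- 1 - a)) \<le> 1 + 1 / a"
proof -
  have "(\<Sum>j\<in>A. real_of_int j powr (- 1 - a)) \<le> (\<Sum>j\<in>insert 1 (A - {1}). real_of_int j powr (- 1 - a))"
    using assms by (intro sum_mono2) auto
  also have "\<dots> = 1 + (\<Sum>j\<in>A - {1}. real_of_int j powr (- 1 - a))"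
    using assms by (subst sum.insert) auto
  also have "\<dots> \<le> 1 + 1 / a"
    using sum_powr_tail_le[of a 1 "A - {1}"] assms by force
  finally show ?thesis .
qed

text \<open>The summand is, up to the factor \<open>d * j\<close>, the derivative of \<open>(x / (x + j)) powr d\<close>,
  which increases from 0 to 1.\<close>

lemma sum_powr_powr_le:
  fixes d j :: real
  assumes "0 < d" "d < 1" "0 < j" "finite A" "A \<subseteq> {1..}"
  shows "(\<Sum>i\<in>A. real_of_int i powr (d - 1) * (real_of_int i + j) powr (- 1 - d)) \<le> 1 / (d * j)"
proof -
  define G where "G = (\<lambda>x. (x / (x + j)) powr d)"
  let ?g = "\<lambda>x. x powr (d - 1) * (x + j) powr (- 1 - d)"
  let ?F = "\<lambda>i. G (real_of_int i) / (d * j)"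
  define m where "m = Max (insert 0 A)"
  have m: "A \<subseteq> {0<..m}" "0 \<le> m"
    using assms by (auto simp: m_def)
  have inc: "d * j * ?g (x + 1) \<le> G (x + 1) - G x" if x: "0 \<le> x" for x
  proof -
    have der: "(G has_real_derivative d * j * ?g z) (at z)" if "0 < z" for z
    proof -
      have "(G has_real_derivative (d * (z / (z + j)) powr (d - 1) * ((z + j - z) / (z + j)\<^sup>2))) (at z)"
        unfolding G_def
        using that assms
        by (auto intro!: derivative_eq_intros simp: power2_eq_square field_simps)
      also have "d * (z / (z + j)) powr (d - 1) * ((z + j - z) / (z + j)\<^sup>2) = d * j * ?g z"
      proof -
        have "(z + j) powr (d - 1) * (z + j) powr (- 1 - d) = (z + j) powr (- 2)"
          by (simp flip: powr_add)
        also have "\<dots> = inverse ((z + j)\<^sup>2)"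
          using that assms by (simp add: powr_minus powr_numeral)
        finally have "(z + j) powr (- 1 - d) = inverse ((z + j)\<^sup>2) / (z + j) powr (d - 1)"
          using that assms by (simp add: field_simps)
        thus ?thesis
          using that assms powr_divide[of z "z + j" "d - 1"] by (simp add: divide_inverse)
      qed
      finally show ?thesis .
    qed
    have "continuous_on {x..x + 1} G"
      unfolding G_def using x assms by (intro continuous_on_powr' continuous_intros) auto
    moreover have "\<And>z. x < z \<Longrightarrow> z < x + 1 \<Longrightarrow> (G has_real_derivative d * j * ?g z) (at z)"
      using x by (intro der) auto
    ultimately obtain z where z: "x < z" "z < x + 1" "G (x + 1) - G x = (x + 1 - x) * (d * j * ?g z)"
      using MVT[of x "x + 1" G] by (smt (verit) DERIV_unique real_differentiable_def)
    have "?g (x + 1) \<le> ?g z"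
      by (intro mult_mono powr_mono2') (use z x assms in auto)
    thus ?thesis using z(3) assms by simp
  qed
  have "(\<Sum>i\<in>A. ?g (real_of_int i)) \<le> ?F m - ?F 0"
  proof (rule sum_le_telescope[OF m(2,1)])
    fix i :: int assume "0 < i"
    thus "?g (real_of_int i) \<le> ?F i - ?F (i - 1)"
      using inc[of "real_of_int i - 1"] assms
      by (simp add: pos_le_divide_eq mult.commute flip: diff_divide_distrib)
  qed auto
  also have "\<dots> \<le> 1 / (d * j)"
    using m assms by (auto simp: G_def intro!: divide_right_mono powr_le1)
  finally show ?thesis .
qed

text \<open>Distributes the decay in z over two smaller quantities: one factor is kept as the bound,
  the other is left for the summation. All later trade-offs between exponents are of this
  kind.\<close>

lemma powr_neg_le_split:
  fixes x y z a b :: real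
  assumes "0 < x" "0 < y" "x \<le> z" "y \<le> z" "0 \<le> a" "0 \<le> b"
  shows "z powr (- (a + b)) \<le> x powr (- a) * y powr (- b)"
proof -
  have "z powr (- (a + b)) = z powr (- a) * z powr (- b)"
    by (simp flip: powr_add)
  also have "\<dots> \<le> x powr (- a) * y powr (- b)"
    using assms by (intro mult_mono powr_mono2') auto
  finally show ?thesis .
qed

lemma norm_coeff_at_mult_le:
  assumes "\<And>A. finite A \<Longrightarrow> (\<Sum>j\<in>A. norm (coeff_at f j) * norm (coeff_at g (k - j))) \<le> C"
  shows "norm (coeff_at (f * g) k) \<le> C"
  unfolding coeff_at_mult
  by (rule order_trans[OF norm_convolution_le])
     (rule infsum_le_finite_sums[OF summable_on_norm_convolution_row], use assms in auto)

text \<open>Cauchy-Schwarz where R has to control only those coefficients of f that meet the support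
  S of g. For f = u this is the l2 norm of one row of the Hankel matrix.\<close>

lemma norm_coeff_at_mult_le_l2:
  assumes "\<And>A. finite A \<Longrightarrow> (\<Sum>j\<in>{j\<in>A. k - j \<in> S}. (norm (coeff_at f j))\<^sup>2) \<le> R\<^sup>2" "0 \<le> R"
    and "supported S g"
  shows "norm (coeff_at (f * g) k) \<le> R * l2 g"
proof (rule norm_coeff_at_mult_le)
  fix A :: "int set" assume A: "finite A"
  let ?B = "{j\<in>A. k - j \<in> S}"
  have "(\<Sum>j\<in>A. norm (coeff_at f j) * norm (coeff_at g (k - j)))
      = (\<Sum>j\<in>?B. norm (coeff_at f j) * norm (coeff_at g (k - j)))"
    using A assms(3) by (intro sum.mono_neutral_right) (auto simp: supported_def)
  also have "\<dots> \<le> R * l2 g"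
  proof (rule power2_le_imp_le)
    have "(\<Sum>j\<in>?B. norm (coeff_at f j) * norm (coeff_at g (k - j)))\<^sup>2
        \<le> (\<Sum>j\<in>?B. (norm (coeff_at f j))\<^sup>2) * (\<Sum>j\<in>?B. (norm (coeff_at g (k - j)))\<^sup>2)"
      by (rule Cauchy_Schwarz_ineq_sum)
    also have "(\<Sum>j\<in>?B. (norm (coeff_at g (k - j)))\<^sup>2) = (\<Sum>j\<in>(\<lambda>j. k - j) ` ?B. (norm (coeff_at g j))\<^sup>2)"
      by (subst sum.reindex) (auto simp: inj_on_def)
    also have "(\<Sum>j\<in>?B. (norm (coeff_at f j))\<^sup>2) * \<dots> \<le> R\<^sup>2 * (l2 g)\<^sup>2"
      using A by (intro mult_mono assms sum_power2_le_l2) (auto intro: sum_nonneg)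
    finally show "(\<Sum>j\<in>?B. norm (coeff_at f j) * norm (coeff_at g (k - j)))\<^sup>2 \<le> (R * l2 g)\<^sup>2"
      by (simp add: power_mult_distrib)
  qed (use assms in auto)
  finally show "(\<Sum>j\<in>A. norm (coeff_at f j) * norm (coeff_at g (k - j))) \<le> R * l2 g" .
qed

section \<open>Finite Toeplitz systems with a factorized symbol\<close>

lemma sum_neutral_subset:
  assumes "finite A" "\<And>j. j \<in> A \<Longrightarrow> \<not> P j \<Longrightarrow> f j = 0"
  shows "sum f A = sum f {j \<in> A. P j}"
  using assms by (intro sum.mono_neutral_right) auto

text \<open>The situation after regularization: h and k are invertible in the Wiener algebra, with
  inverses hi and ki. The estimates below involve only Ca, Cc, \<rho>, d and \<epsilon>, which can
  be chosen independently of the regularization. The assumption \<open>weighted\<close> is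
  qualitative and used only for the existence of a solution.\<close>

locale wiener_factors =
  fixes h hi k ki :: "'q::finite wiener" and d \<epsilon> Ca Cc \<rho> :: real
  assumes inv: "h * hi = 1" "hi * h = 1" "k * ki = 1" "ki * k = 1"
    and analytic: "supported {0..} h" "supported {0..} hi" "supported {0..} k" "supported {0..} ki"
    and factorizations: "h * star h = star k * k"
    and d: "0 < d" "d < 1/2" and eps: "0 < \<epsilon>" "\<epsilon> < d" "\<epsilon> \<le> 1/4"
    and ki_le: "\<And>j. 0 \<le> j \<Longrightarrow> norm (coeff_at ki j) \<le> Ca * (real_of_int j + 1) powr (- 1 - d)"
    and hi_le: "\<And>j. 0 \<le> j \<Longrightarrow> norm (coeff_at hi j) \<le> Ca * (real_of_int j + 1) powr (- 1 - d)"
    and h_le: "\<And>j. 0 \<le> j \<Longrightarrow> norm (coeff_at h j) \<le> Cc * (real_of_int j + 1) powr (d - 1)"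
    and rho: "0 \<le> \<rho>" "\<rho> < 1"
    and contraction: "\<exists>G. supported {..0} G \<and>
      (\<forall>\<theta> (V :: complex^'q^'q). norm (ev (star h * ki - G) \<theta> ** V) \<le> \<rho> * norm V)"
    and weighted: "(\<lambda>j. \<bar>real_of_int j\<bar> * norm (coeff_at ki j)) summable_on UNIV"
begin

definition u where "u = star h * ki"
text \<open>Cb bounds the Hankel entries (\<open>u_le\<close>), A1 the Wiener norm of ki, C0 the
  inhomogeneous term p0 and C1 the solution p, the last two up to powers of n.\<close>

definition Cb where "Cb = Ca * Cc / d"
definition A1 where "A1 = Ca * (1 + 1 / d)"
definition C0 where "C0 = Cb\<^sup>2 * A1 * (1 + 1 / \<epsilon>)"
definition C1 where "C1 = C0 + Cb * (2 * C0 / (1 - \<rho>\<^sup>2))"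

lemma Ca_nonneg: "0 \<le> Ca" and Cc_nonneg: "0 \<le> Cc"
  using order_trans[OF norm_ge_zero ki_le[of 0]] order_trans[OF norm_ge_zero h_le[of 0]] by simp_all

lemma constants_nonneg: "0 \<le> Cb" "0 \<le> A1" "0 \<le> C0" "0 \<le> C1" "0 < 1 - \<rho>\<^sup>2"
proof -
  show b: "0 \<le> Cb" "0 \<le> A1" using Ca_nonneg Cc_nonneg d by (simp_all add: Cb_def A1_def)
  show c: "0 \<le> C0" using b eps by (simp add: C0_def)
  show r: "0 < 1 - \<rho>\<^sup>2" using rho by (simp add: power_less_one_iff abs_square_less_1)
  show "0 \<le> C1" using b c r by (simp add: C1_def)
qed

lemma u_eq: "u = hi * star k"
proof -
  have "hi * star k = hi * (star k * k) * ki" by (simp add: mult.assoc inv)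
  also have "\<dots> = (hi * h) * star h * ki" unfolding factorizations[symmetric] by (simp add: mult.assoc)
  finally show ?thesis by (simp add: inv u_def)
qed

lemma ki_star_u: "ki * star u = star hi"
  unfolding u_eq star_mult star_star mult.assoc[symmetric] by (simp add: inv)

lemma star_hi_u: "star hi * u = ki"
proof -
  have "star hi * u = star (h * hi) * ki" unfolding u_def star_mult by (simp add: mult.assoc)
  thus ?thesis by (simp add: inv)
qed

lemma supported_stars: "supported {..0} (star h)" "supported {..0} (star hi)"
  "supported {..0} (star k)" "supported {..0} (star ki)"
  using analytic[THEN supported_star] by (auto elim!: supported_mono)

text \<open>Coefficient i of \<open>star h * ki\<close> pairs h at l with ki at i + l. The exponents
  \<open>d - 1\<close> and \<open>- 1 - d\<close> sum to -2 and the summation gives back one power,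
  leaving 1 / i. The shift \<open>l = 1 - j\<close> matches the summation lemma, whose index starts
  at 1.\<close>

lemma u_le:
  assumes "1 \<le> i"
  shows "norm (coeff_at u i) \<le> Cb / real_of_int i"
  unfolding u_def
proof (rule norm_coeff_at_mult_le)
  fix A :: "int set" assume A: "finite A"
  let ?f = "\<lambda>l. real_of_int l powr (d - 1) * (real_of_int l + real_of_int i) powr (- 1 - d)"
  have "(\<Sum>j\<in>A. norm (coeff_at (star h) j) * norm (coeff_at ki (i - j)))
      = (\<Sum>j\<in>{j\<in>A. j \<le> 0}. norm (coeff_at (star h) j) * norm (coeff_at ki (i - j)))"
    using A supported_stars(1) by (intro sum_neutral_subset) (auto simp: supported_def)
  also have "\<dots> \<le> (\<Sum>j\<in>{j\<in>A. j \<le> 0}. Ca * Cc * ?f (1 - j))"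
  proof (rule sum_mono)
    fix j assume j: "j \<in> {j\<in>A. j \<le> 0}"
    have "norm (coeff_at (star h) j) * norm (coeff_at ki (i - j))
        \<le> (Cc * (real_of_int (- j) + 1) powr (d - 1)) * (Ca * (real_of_int (i - j) + 1) powr (- 1 - d))"
      using j assms Cc_nonneg h_le[of "- j"] ki_le[of "i - j"] by (intro mult_mono) auto
    thus "norm (coeff_at (star h) j) * norm (coeff_at ki (i - j)) \<le> Ca * Cc * ?f (1 - j)"
      by (simp add: algebra_simps)
  qed
  also have "\<dots> = Ca * Cc * (\<Sum>l\<in>(\<lambda>j. 1 - j) ` {j\<in>A. j \<le> 0}. ?f l)"
    by (subst sum.reindex) (auto simp: inj_on_def sum_distrib_left)
  also have "\<dots> \<le> Ca * Cc * (1 / (d * real_of_int i))"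
    using A d assms Ca_nonneg Cc_nonneg by (intro mult_left_mono sum_powr_powr_le) auto
  finally show "(\<Sum>j\<in>A. norm (coeff_at (star h) j) * norm (coeff_at ki (i - j))) \<le> Cb / real_of_int i"
    by (simp add: Cb_def)
qed

text \<open>The squared tail of 1 / j beyond n is of order 1 / n, so the rows of the Hankel matrix
  have l2 norm of order n^(-1/2).\<close>

lemma sum_u_power2_le:
  assumes "1 \<le> n" "finite B" "B \<subseteq> {n<..}"
  shows "(\<Sum>j\<in>B. (norm (coeff_at u j))\<^sup>2) \<le> (Cb / sqrt (real_of_int n))\<^sup>2"
proof -
  have "(\<Sum>j\<in>B. (norm (coeff_at u j))\<^sup>2) \<le> (\<Sum>j\<in>B. Cb\<^sup>2 * real_of_int j powr (- 1 - 1))"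
  proof (rule sum_mono)
    fix j assume "j \<in> B"
    hence j: "1 \<le> j" using assms by auto
    have "(norm (coeff_at u j))\<^sup>2 \<le> (Cb / real_of_int j)\<^sup>2" by (intro power_mono u_le j) simp
    also have "\<dots> = Cb\<^sup>2 * real_of_int j powr (- 1 - 1)"
      using j by (simp add: powr_minus powr_numeral power_mult_distrib power_inverse divide_inverse)
    finally show "(norm (coeff_at u j))\<^sup>2 \<le> Cb\<^sup>2 * real_of_int j powr (- 1 - 1)" .
  qed
  also have "\<dots> \<le> Cb\<^sup>2 * (real_of_int n powr (- 1) / 1)"
    unfolding sum_distrib_left[symmetric] using assms by (intro mult_left_mono sum_powr_tail_le) auto
  also have "\<dots> = (Cb / sqrt (real_of_int n))\<^sup>2"
    using assms by (simp add: powr_minus power_divide) (simp add: divide_inverse)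
  finally show ?thesis .
qed

lemma coeff_u_mult_le:
  assumes "1 \<le> n" "supported {..0} p" "n < m"
  shows "norm (coeff_at (u * p) m) \<le> Cb / sqrt (real_of_int n) * l2 p"
  by (rule norm_coeff_at_mult_le_l2[where S = "{..0}"], rule sum_u_power2_le)
     (use assms constants_nonneg in auto)

lemma coeff_star_u_mult_le:
  assumes "1 \<le> n" "supported {n + 1..} r" "i \<le> 0"
  shows "norm (coeff_at (star u * r) i) \<le> Cb / sqrt (real_of_int n) * l2 r"
proof (rule norm_coeff_at_mult_le_l2[where S = "{n + 1..}"])
  fix A :: "int set" assume A: "finite A"
  let ?B = "{j \<in> A. i - j \<in> {n + 1..}}"
  have "(\<Sum>j\<in>?B. (norm (coeff_at (star u) j))\<^sup>2) = (\<Sum>j\<in>uminus ` ?B. (norm (coeff_at u j))\<^sup>2)"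
    by (subst sum.reindex) auto
  also have "\<dots> \<le> (Cb / sqrt (real_of_int n))\<^sup>2"
    using A assms by (intro sum_u_power2_le) auto
  finally show "(\<Sum>j\<in>?B. (norm (coeff_at (star u) j))\<^sup>2) \<le> (Cb / sqrt (real_of_int n))\<^sup>2" .
qed (use assms constants_nonneg in auto)

text \<open>The easy half of Nehari's theorem: multiplication by an anti-analytic G keeps p on the
  indices up to 0, so the projection does not see G, and u may be replaced by \<open>u - G\<close>,
  whose pointwise operator norm is at most \<rho>.\<close>

lemma l2_restr_u_le:
  assumes "0 \<le> n" "supported {..0} p"
  shows "l2 (restr {n + 1..} (u * p)) \<le> \<rho> * l2 p"
proof -
  obtain G where G: "supported {..0} G" "\<And>\<theta> (V :: complex^'q^'q). norm (ev (u - G) \<theta> ** V) \<le> \<rho> * norm V"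
    using contraction unfolding u_def by blast
  have "supported {..0} (G * p)"
    by (rule supported_mult[OF G(1) assms(2)]) auto
  hence "restr {n + 1..} (u * p) = restr {n + 1..} ((u - G) * p)"
    using assms by (intro wiener_eqI) (auto simp: left_diff_distrib supported_def)
  hence "l2 (restr {n + 1..} (u * p)) \<le> l2 ((u - G) * p)"
    by (simp add: l2_restr_le)
  also have "\<dots> \<le> \<rho> * l2 p"
    by (rule l2_le_of_ev_le) (simp_all add: ev_mult G rho)
  finally show ?thesis .
qed

text \<open>This operator is the adjoint of the previous one, so pairing the image q with itself
  moves u to the other side and the same bound applies.\<close>

lemma l2_restr_star_u_le:
  assumes "0 \<le> n" "supported {n + 1..} r"
  shows "l2 (restr {..0} (star u * r)) \<le> \<rho> * l2 r"
proof -
  define q where "q = restr {..0} (star u * r)"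
  have r: "r = restr {n + 1..} r"
    using assms by (intro wiener_eqI) (auto simp: supported_def)
  have "(l2 q)\<^sup>2 = ip (restr {..0} (star u * r)) (restr {..0} (star u * r))"
    by (simp add: q_def l2_power2)
  also have "\<dots> = ip q (star u * r)"
    by (simp add: q_def flip: ip_restr)
  also have "\<dots> = ip r (u * q)" using ip_mult_left[of u q r] by (simp add: ip_commute)
  also have "\<dots> = ip r (restr {n + 1..} (u * q))" using ip_restr[of "{n + 1..}" r "u * q"] r by simp
  also have "\<dots> \<le> l2 r * l2 (restr {n + 1..} (u * q))" by (rule ip_le_l2)
  also have "\<dots> \<le> l2 r * (\<rho> * l2 q)"
    by (intro mult_left_mono l2_restr_u_le) (use assms in \<open>auto simp: q_def supported_restr\<close>)
  finally have "l2 q * l2 q \<le> (\<rho> * l2 r) * l2 q" by (simp add: power2_eq_square mult_ac)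
  thus ?thesis
    using rho by (cases "l2 q = 0") (auto simp: q_def[symmetric] less_le)
qed

text \<open>The operator \<open>H\<^sup>* H\<close> in the equation for p.\<close>

definition Phi where "Phi n p = restr {..0} (star u * restr {n + 1..} (u * p))"

lemma supported_Phi: "supported {..0} (Phi n p)"
  unfolding Phi_def by (rule supported_restr)

lemma bounded_linear_Phi: "bounded_linear (Phi n)"
  unfolding Phi_def
  by (intro bounded_linear_compose[OF bounded_linear_restr]
      bounded_linear_compose[OF bounded_linear_mult_right] bounded_linear_mult_right)

lemma l2_Phi_le:
  assumes "0 \<le> n" "supported {..0} p"
  shows "l2 (Phi n p) \<le> \<rho>\<^sup>2 * l2 p"
proof -
  have "l2 (Phi n p) \<le> \<rho> * l2 (restr {n + 1..} (u * p))"
    unfolding Phi_def by (rule l2_restr_star_u_le[OF assms(1) supported_restr])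
  also have "\<dots> \<le> \<rho> * (\<rho> * l2 p)"
    by (intro mult_left_mono l2_restr_u_le assms rho)
  finally show ?thesis by (simp add: power2_eq_square mult_ac)
qed

text \<open>The weighted summability of \<open>ki\<close> makes the Hankel operators below map square-summable
  sequences to absolutely summable ones, so that the Neumann series converges in the Wiener norm.\<close>

lemma norm_restr_ki_mult_le:
  assumes "supported {..0} p"
  shows "norm (restr {1..} (ki * p)) \<le> (\<Sum>\<^sub>\<infinity>j. \<bar>real_of_int j\<bar> * norm (coeff_at ki j)) * l2 p"
proof (rule norm_infsum_le)
  show "((\<lambda>j. restr {1..} (monom_at j (coeff_at ki j) * p)) has_sum restr {1..} (ki * p)) UNIV"
    by (rule has_sum_bounded_linear[OF bounded_linear_compose[OF bounded_linear_restr bounded_linear_mult_left]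
          has_sum_monom_at])
  show "((\<lambda>j. \<bar>real_of_int j\<bar> * norm (coeff_at ki j) * l2 p) has_sum
      (\<Sum>\<^sub>\<infinity>j. \<bar>real_of_int j\<bar> * norm (coeff_at ki j)) * l2 p) UNIV"
    by (intro has_sum_cmult_left has_sum_infsum weighted)
next
  fix j :: int
  have "norm (restr {1..} (monom_at j (coeff_at ki j) * p))
      = (\<Sum>\<^sub>\<infinity>i. norm (coeff_at (restr {1..} (monom_at j (coeff_at ki j) * p)) i))"
    by (simp add: norm_wiener_def)
  \<comment> \<open>As p lives on the indices up to 0, shifting it by j moves at most j of its
    coefficients to positive indices. This is the source of the weight j.\<close>
  also have "\<dots> = (\<Sum>\<^sub>\<infinity>i\<in>{1..j}. norm (coeff_at ki j ** coeff_at p (i - j)))"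
    using assms
    by (intro infsum_cong_neutral) (auto simp: coeff_at_monom_at_mult supported_def mmult.zero_right)
  also have "\<dots> = (\<Sum>i\<in>{1..j}. norm (coeff_at ki j ** coeff_at p (i - j)))" by simp
  also have "\<dots> \<le> (\<Sum>i\<in>{1..j}. norm (coeff_at ki j) * l2 p)"
    by (intro sum_mono order_trans[OF norm_matrix_mult_le] mult_left_mono norm_coeff_at_le_l2) auto
  also have "\<dots> \<le> \<bar>real_of_int j\<bar> * norm (coeff_at ki j) * l2 p"
    using mult_right_mono[of "real (nat j)" "\<bar>real_of_int j\<bar>" "norm (coeff_at ki j) * l2 p"]
    by (simp add: mult.assoc)
  finally show "norm (restr {1..} (monom_at j (coeff_at ki j) * p)) \<le> \<bar>real_of_int j\<bar> * norm (coeff_at ki j) * l2 p" .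
qed

text \<open>The part of \<open>ki * p\<close> on the indices up to 0 stays there under
  \<open>star h\<close>, so only the part bounded by \<open>norm_restr_ki_mult_le\<close>
  contributes. The constant K depends on the weighted sum and on the Wiener norms of u and h; it
  serves convergence only.\<close>

lemma norm_Phi_le:
  assumes "0 \<le> n"
  shows "\<exists>K\<ge>0. \<forall>p :: 'q wiener. supported {..0} p \<longrightarrow> norm (Phi n p) \<le> K * l2 p"
proof (intro exI conjI allI impI)
  let ?S = "\<Sum>\<^sub>\<infinity>j. \<bar>real_of_int j\<bar> * norm (coeff_at ki j)"
  show "0 \<le> norm u * (norm h * ?S)" by (intro mult_nonneg_nonneg infsum_nonneg) auto
  fix p :: "'q wiener" assume p: "supported {..0} p"
  have "supported {..0} (star h * restr {..0} (ki * p))"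
    by (rule supported_mult[OF supported_stars(1) supported_restr]) auto
  hence "restr {n + 1..} (u * p) = restr {n + 1..} (star h * restr {1..} (ki * p))"
  proof (intro wiener_eqI)
    have split: "ki * p = restr {..0} (ki * p) + restr {1..} (ki * p)"
      by (rule wiener_eqI) auto
    have "u * p = star h * restr {..0} (ki * p) + star h * restr {1..} (ki * p)"
      unfolding u_def mult.assoc distrib_left[symmetric] split[symmetric] ..
    moreover assume "supported {..0} (star h * restr {..0} (ki * p))"
    ultimately show "coeff_at (restr {n + 1..} (u * p)) j
        = coeff_at (restr {n + 1..} (star h * restr {1..} (ki * p))) j" for j
      using assms by (auto simp: supported_def)
  qed
  hence "norm (Phi n p) \<le> norm (star u * restr {n + 1..} (star h * restr {1..} (ki * p)))"
    by (simp add: Phi_def norm_restr_le)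
  also have "\<dots> \<le> norm (star u) * norm (restr {n + 1..} (star h * restr {1..} (ki * p)))"
    by (rule norm_mult_ineq)
  also have "\<dots> \<le> norm u * (norm h * (?S * l2 p))"
  proof (intro mult_mono)
    have "norm (restr {n + 1..} (star h * restr {1..} (ki * p))) \<le> norm (star h * restr {1..} (ki * p))"
      by (rule norm_restr_le)
    also have "\<dots> \<le> norm (star h) * norm (restr {1..} (ki * p))" by (rule norm_mult_ineq)
    also have "\<dots> \<le> norm h * (?S * l2 p)"
      by (intro mult_mono norm_restr_ki_mult_le p) auto
    finally show "norm (restr {n + 1..} (star h * restr {1..} (ki * p))) \<le> norm h * (?S * l2 p)" .
  qed auto
  finally show "norm (Phi n p) \<le> norm u * (norm h * ?S) * l2 p" by (simp add: mult.assoc)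
qed

text \<open>The Neumann series. Its terms decay geometrically in l2 by the contraction, and one
  further application of \<open>Phi\<close> converts this into decay in the Wiener norm.\<close>

lemma ex_solution:
  assumes "0 \<le> n" "supported {..0} q"
  shows "\<exists>p. supported {..0} p \<and> p = q + Phi n p"
proof -
  define x where "x j = (Phi n ^^ j) q" for j
  have x0: "x 0 = q" and xS: "x (Suc j) = Phi n (x j)" for j by (simp_all add: x_def)
  have sup: "supported {..0} (x j)" for j
    by (cases j) (simp_all add: x0 xS assms supported_Phi)
  have l2x: "l2 (x j) \<le> (\<rho>\<^sup>2) ^ j * l2 q" for j
  proof (induction j)
    case (Suc j)
    have "l2 (x (Suc j)) \<le> \<rho>\<^sup>2 * l2 (x j)" unfolding xS by (rule l2_Phi_le[OF assms(1) sup])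
    also have "\<dots> \<le> \<rho>\<^sup>2 * ((\<rho>\<^sup>2) ^ j * l2 q)" by (intro mult_left_mono Suc.IH) auto
    finally show ?case by (simp add: mult_ac)
  qed (simp add: x0)
  obtain K where K: "K \<ge> 0" "\<And>p :: 'q wiener. supported {..0} p \<Longrightarrow> norm (Phi n p) \<le> K * l2 p"
    using norm_Phi_le[OF assms(1)] by blast
  have "norm (x (Suc j)) \<le> K * l2 q * (\<rho>\<^sup>2) ^ j" for j
    using K(2)[OF sup[of j]] mult_left_mono[OF l2x[of j] K(1)] by (simp add: xS mult_ac)
  moreover have "summable (\<lambda>j. K * l2 q * (\<rho>\<^sup>2) ^ j)"
    using constants_nonneg(5) rho by (intro summable_mult summable_geometric) auto
  ultimately have "summable (\<lambda>j. x (Suc j))"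
    by - (rule summable_comparison_test'[where N = 0], assumption, blast)
  hence s: "summable x" by (rule summable_Suc_iff[THEN iffD1])
  define p where "p = suminf x"
  have "Phi n p = (\<Sum>j. Phi n (x j))"
    unfolding p_def by (rule bounded_linear.suminf[OF bounded_linear_Phi s])
  also have "\<dots> = p - q"
    unfolding p_def using suminf_split_head[OF s] by (simp add: xS x0)
  finally have "p = q + Phi n p" by simp
  moreover have "supported {..0} p"
    unfolding supported_def
  proof (intro allI impI)
    fix i :: int assume "i \<notin> {..0}"
    hence "coeff_at (x j) i = 0" for j using sup[of j] by (auto simp: supported_def)
    thus "coeff_at p i = 0"
      unfolding p_def using bounded_linear.suminf[OF bounded_linear_coeff_at s, of i] by simp
  qed
  ultimately show ?thesis by blast
qed

text \<open>Pairing the equation with p itself gives a bound free of the constant from the Neumann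
  series.\<close>

lemma l2_solution_le:
  assumes "0 \<le> n" "supported {..0} p" "p = q + Phi n p"
  shows "l2 p \<le> l2 q / (1 - \<rho>\<^sup>2)"
proof (cases "l2 p = 0")
  case False
  hence pos: "0 < l2 p" by (simp add: less_le)
  have "(l2 p)\<^sup>2 = ip p (q + Phi n p)" using assms(3) by (simp add: l2_power2)
  also have "\<dots> = ip p q + ip p (Phi n p)" by (rule ip_add_right)
  also have "\<dots> \<le> l2 p * l2 q + l2 p * (\<rho>\<^sup>2 * l2 p)"
    by (intro add_mono order_trans[OF ip_le_l2] mult_left_mono l2_Phi_le assms) auto
  finally have "l2 p * l2 p \<le> l2 p * (l2 q + \<rho>\<^sup>2 * l2 p)"
    by (simp add: power2_eq_square algebra_simps)
  hence "l2 p \<le> l2 q + \<rho>\<^sup>2 * l2 p" using pos by (simp only: mult_le_cancel_left_pos)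
  thus ?thesis using constants_nonneg(5) by (simp add: field_simps)
qed (use constants_nonneg in simp)

end

section \<open>Uniform estimates for p, r and the resulting correction terms\<close>

context wiener_factors begin

text \<open>\<open>F t\<close> is the vector kX for the semi-infinite system with right-hand side
  z^t: \<open>ki * F t\<close> is column t of its inverse, see \<open>coeff_ki_F\<close>. Then
  \<open>p0\<close> is the inhomogeneous term in the equation for p.\<close>

definition F :: "int \<Rightarrow> 'q wiener" where "F t = restr {1..} (star ki * monom_at t (mat 1))"
definition p0 :: "int \<Rightarrow> int \<Rightarrow> 'q wiener" where
  "p0 n t = restr {..0} (star u * restr {n + 1..} (u * F t))"

lemma norm_ki_le: "norm ki \<le> A1"
  unfolding norm_wiener_def
proof (rule infsum_le_finite_sums[OF summable_coeff_at])
  fix A :: "int set" assume A: "finite A"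
  have "(\<Sum>j\<in>A. norm (coeff_at ki j)) = (\<Sum>j\<in>{j\<in>A. 0 \<le> j}. norm (coeff_at ki j))"
    using A analytic(4) by (intro sum_neutral_subset) (auto simp: supported_def)
  also have "\<dots> \<le> (\<Sum>j\<in>{j\<in>A. 0 \<le> j}. Ca * real_of_int (j + 1) powr (- 1 - d))"
    using ki_le by (intro sum_mono) auto
  also have "\<dots> = Ca * (\<Sum>j\<in>(\<lambda>j. j + 1) ` {j\<in>A. 0 \<le> j}. real_of_int j powr (- 1 - d))"
    by (subst sum.reindex) (auto simp: sum_distrib_left)
  also have "\<dots> \<le> Ca * (1 + 1 / d)"
    using A d Ca_nonneg by (intro mult_left_mono sum_powr_from_1_le) auto
  finally show "(\<Sum>j\<in>A. norm (coeff_at ki j)) \<le> A1" by (simp add: A1_def)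
qed

lemma coeff_F: "coeff_at (F t) j = (if 1 \<le> j then hermitian_conj (coeff_at ki (t - j)) else 0)"
  by (simp add: F_def coeff_at_mult_monom_at)

lemma supported_F: "supported {1..t} (F t)"
  using analytic(4) by (auto simp: supported_def coeff_F)

lemma norm_F_le: "norm (F t) \<le> A1"
  unfolding norm_wiener_def
proof (rule infsum_le_finite_sums[OF summable_coeff_at])
  fix A :: "int set" assume A: "finite A"
  have "(\<Sum>j\<in>A. norm (coeff_at (F t) j)) \<le> (\<Sum>j\<in>A. norm (coeff_at ki (t - j)))"
    by (intro sum_mono) (simp add: coeff_F)
  also have "\<dots> = (\<Sum>j\<in>(\<lambda>j. t - j) ` A. norm (coeff_at ki j))"
    by (subst sum.reindex) (auto simp: inj_on_def)
  also have "\<dots> \<le> A1"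
    using sum_norm_coeff_at_le[of "(\<lambda>j. t - j) ` A" ki] norm_ki_le A by simp
  finally show "(\<Sum>j\<in>A. norm (coeff_at (F t) j)) \<le> A1" .
qed

text \<open>\<open>F t\<close> is supported in \<open>{1..t}\<close> and has bounded l1 norm, so
  only coefficients of u of index at least m - t enter.\<close>

lemma coeff_u_F_le:
  assumes "t < m"
  shows "norm (coeff_at (u * F t) m) \<le> Cb * A1 / real_of_int (m - t)"
proof (rule norm_coeff_at_mult_le)
  fix A :: "int set" assume A: "finite A"
  have "(\<Sum>j\<in>A. norm (coeff_at u j) * norm (coeff_at (F t) (m - j)))
      \<le> (\<Sum>j\<in>A. Cb / real_of_int (m - t) * norm (coeff_at (F t) (m - j)))"
  proof (rule sum_mono)
    fix j
    show "norm (coeff_at u j) * norm (coeff_at (F t) (m - j))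
        \<le> Cb / real_of_int (m - t) * norm (coeff_at (F t) (m - j))"
    proof (cases "m - j \<in> {1..t}")
      case True
      hence "norm (coeff_at u j) \<le> Cb / real_of_int j" using assms by (intro u_le) auto
      also have "\<dots> \<le> Cb / real_of_int (m - t)"
        using True assms constants_nonneg by (intro divide_left_mono) auto
      finally show ?thesis by (intro mult_right_mono) auto
    qed (use supported_F[of t] in \<open>simp add: supported_def\<close>)
  qed
  also have "\<dots> = Cb / real_of_int (m - t) * (\<Sum>j\<in>(\<lambda>j. m - j) ` A. norm (coeff_at (F t) j))"
    by (subst sum.reindex) (auto simp: inj_on_def sum_distrib_left)
  also have "\<dots> \<le> Cb / real_of_int (m - t) * A1"
    using sum_norm_coeff_at_le[of "(\<lambda>j. m - j) ` A" "F t"] norm_F_le[of t] A assms constants_nonneg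
    by (intro mult_left_mono) auto
  finally show "(\<Sum>j\<in>A. norm (coeff_at u j) * norm (coeff_at (F t) (m - j))) \<le> Cb * A1 / real_of_int (m - t)"
    by simp
qed

text \<open>With l the distance of the intermediate index beyond n, the two Hankel factors are at
  most 1 / (l + n - i) and 1 / l up to constants. Summing their product over l would give a
  logarithm; moving the power \<epsilon> from the first factor to l makes the sum converge,
  uniformly in t up to n.\<close>

lemma p0_le:
  assumes "1 \<le> n" "t \<le> n" "i \<le> 0"
  shows "norm (coeff_at (p0 n t) i) \<le> C0 * real_of_int (n - i + 1) powr (- (1 - \<epsilon>))"
proof -
  let ?b = "restr {n + 1..} (u * F t)"
  let ?c = "Cb\<^sup>2 * A1 * real_of_int (n - i + 1) powr (- (1 - \<epsilon>))"
  have "norm (coeff_at (star u * ?b) i) \<le> C0 * real_of_int (n - i + 1) powr (- (1 - \<epsilon>))"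
  proof (rule norm_coeff_at_mult_le)
    fix A :: "int set" assume A: "finite A"
    let ?B = "{j \<in> A. n + 1 \<le> i - j}"
    have "(\<Sum>j\<in>A. norm (coeff_at (star u) j) * norm (coeff_at ?b (i - j)))
        = (\<Sum>j\<in>?B. norm (coeff_at (star u) j) * norm (coeff_at ?b (i - j)))"
      using A by (intro sum_neutral_subset) auto
    also have "\<dots> \<le> (\<Sum>j\<in>?B. ?c * real_of_int (i - j - n) powr (- 1 - \<epsilon>))"
    proof (rule sum_mono)
      fix j assume j: "j \<in> ?B"
      define l where "l = real_of_int (i - j - n)"
      have l: "1 \<le> l" using j by (simp add: l_def)
      have "norm (coeff_at (star u) j) \<le> Cb / real_of_int (- j)"
        using u_le[of "- j"] j assms by simp
      also have "\<dots> = Cb * real_of_int (- j) powr (- ((1 - \<epsilon>) + \<epsilon>))"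
        using j assms by (simp add: powr_minus divide_inverse)
      also have "\<dots> \<le> Cb * (real_of_int (n - i + 1) powr (- (1 - \<epsilon>)) * l powr (- \<epsilon>))"
        using j assms eps d constants_nonneg
        by (intro mult_left_mono powr_neg_le_split) (auto simp: l_def)
      finally have 1: "norm (coeff_at (star u) j) \<le> Cb * (real_of_int (n - i + 1) powr (- (1 - \<epsilon>)) * l powr (- \<epsilon>))" .
      have "norm (coeff_at ?b (i - j)) \<le> Cb * A1 / real_of_int (i - j - t)"
        using coeff_u_F_le[of t "i - j"] j assms by simp
      also have "\<dots> \<le> Cb * A1 / l"
        using j assms constants_nonneg l unfolding l_def
        by (intro divide_left_mono mult_pos_pos) auto
      also have "\<dots> = Cb * A1 * l powr (- 1)"
        using l by (simp add: powr_minus divide_inverse)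
      finally have 2: "norm (coeff_at ?b (i - j)) \<le> Cb * A1 * l powr (- 1)" .
      have "norm (coeff_at (star u) j) * norm (coeff_at ?b (i - j))
          \<le> (Cb * (real_of_int (n - i + 1) powr (- (1 - \<epsilon>)) * l powr (- \<epsilon>))) * (Cb * A1 * l powr (- 1))"
        using 1 2 constants_nonneg by (intro mult_mono) auto
      also have "\<dots> = ?c * (l powr (- \<epsilon>) * l powr (- 1))"
        by (simp add: power2_eq_square)
      also have "l powr (- \<epsilon>) * l powr (- 1) = l powr (- \<epsilon> + - 1)"
        by (rule powr_add[symmetric])
      also have "- \<epsilon> + - 1 = - 1 - \<epsilon>" by simp
      finally show "norm (coeff_at (star u) j) * norm (coeff_at ?b (i - j))
          \<le> ?c * real_of_int (i - j - n) powr (- 1 - \<epsilon>)" by (simp only: l_def)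
    qed
    also have "\<dots> = ?c * (\<Sum>l\<in>(\<lambda>j. i - j - n) ` ?B. real_of_int l powr (- 1 - \<epsilon>))"
      by (subst sum.reindex) (auto simp: inj_on_def sum_distrib_left)
    also have "\<dots> \<le> ?c * (1 + 1 / \<epsilon>)"
      using A eps constants_nonneg by (intro mult_left_mono sum_powr_from_1_le) auto
    finally show "(\<Sum>j\<in>A. norm (coeff_at (star u) j) * norm (coeff_at ?b (i - j)))
        \<le> C0 * real_of_int (n - i + 1) powr (- (1 - \<epsilon>))" by (simp add: C0_def mult_ac)
  qed
  thus ?thesis using assms by (simp add: p0_def)
qed

lemma l2_p0_le:
  assumes "1 \<le> n" "t \<le> n"
  shows "l2 (p0 n t) \<le> 2 * C0 * real_of_int n powr (\<epsilon> - 1/2)"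
proof (rule l2_leI)
  fix A :: "int set" assume A: "finite A"
  let ?a = "1 - 2 * \<epsilon>"
  have "(\<Sum>i\<in>A. (norm (coeff_at (p0 n t) i))\<^sup>2) = (\<Sum>i\<in>{i\<in>A. i \<le> 0}. (norm (coeff_at (p0 n t) i))\<^sup>2)"
    using A by (intro sum_neutral_subset) (auto simp: p0_def)
  also have "\<dots> \<le> (\<Sum>i\<in>{i\<in>A. i \<le> 0}. C0\<^sup>2 * real_of_int (n - i + 1) powr (- 1 - ?a))"
  proof (rule sum_mono)
    fix i assume "i \<in> {i\<in>A. i \<le> 0}"
    hence "(norm (coeff_at (p0 n t) i))\<^sup>2 \<le> (C0 * real_of_int (n - i + 1) powr (- (1 - \<epsilon>)))\<^sup>2"
      using assms by (intro power_mono p0_le) auto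
    also have "\<dots> = C0\<^sup>2 * real_of_int (n - i + 1) powr (- 1 - ?a)"
      by (simp add: power2_eq_square flip: powr_add)
    finally show "(norm (coeff_at (p0 n t) i))\<^sup>2 \<le> C0\<^sup>2 * real_of_int (n - i + 1) powr (- 1 - ?a)" .
  qed
  also have "\<dots> = C0\<^sup>2 * (\<Sum>j\<in>(\<lambda>i. n - i + 1) ` {i\<in>A. i \<le> 0}. real_of_int j powr (- 1 - ?a))"
    by (subst sum.reindex) (auto simp: inj_on_def sum_distrib_left)
  also have "\<dots> \<le> C0\<^sup>2 * (real_of_int n powr (- ?a) / ?a)"
    using A eps assms by (intro mult_left_mono sum_powr_tail_le) auto
  \<comment> \<open>From \<epsilon> at most 1/4 one has \<open>?a\<close> at least 1/2. The factor 4
    rather than 2 is taken for the sake of its square root.\<close>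
  also have "\<dots> \<le> C0\<^sup>2 * (4 * real_of_int n powr (- ?a))"
    using eps assms by (intro mult_left_mono) (auto simp: field_simps)
  also have "\<dots> = (2 * C0 * real_of_int n powr (\<epsilon> - 1/2))\<^sup>2"
    by (simp add: power2_eq_square flip: powr_add)
  finally show "(\<Sum>i\<in>A. (norm (coeff_at (p0 n t) i))\<^sup>2) \<le> (2 * C0 * real_of_int n powr (\<epsilon> - 1/2))\<^sup>2" .
qed (use constants_nonneg in simp)

text \<open>From l2 to pointwise bounds: n^(-1/2) from a row of the Hankel matrix and n^(\<epsilon>
  - 1/2) from the l2 norm of p combine to n^(\<epsilon> - 1), which is also the size of p0.\<close>

lemma solution_bounds:
  assumes n: "1 \<le> n" "t \<le> n" and p: "supported {..0} p" "p = p0 n t + Phi n p"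
  shows "norm (coeff_at p i) \<le> C1 * real_of_int n powr (\<epsilon> - 1)"
    and "n < m \<Longrightarrow> norm (coeff_at (u * p) m) \<le> C1 * real_of_int n powr (\<epsilon> - 1)"
proof -
  let ?n = "real_of_int n"
  have l2p: "l2 p \<le> 2 * C0 / (1 - \<rho>\<^sup>2) * ?n powr (\<epsilon> - 1/2)"
  proof -
    have "l2 p \<le> l2 (p0 n t) / (1 - \<rho>\<^sup>2)" by (rule l2_solution_le[OF _ p]) (use n in simp)
    also have "\<dots> \<le> 2 * C0 * ?n powr (\<epsilon> - 1/2) / (1 - \<rho>\<^sup>2)"
      using constants_nonneg by (intro divide_right_mono l2_p0_le n) auto
    finally show ?thesis by simp
  qed
  have sq: "Cb / sqrt ?n = Cb * ?n powr (- (1/2))"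
    using n by (simp add: powr_minus_divide powr_half_sqrt)
  have row: "Cb / sqrt ?n * l2 p \<le> Cb * (2 * C0 / (1 - \<rho>\<^sup>2)) * ?n powr (\<epsilon> - 1)"
  proof -
    have "Cb / sqrt ?n * l2 p \<le> Cb * ?n powr (- (1/2)) * (2 * C0 / (1 - \<rho>\<^sup>2) * ?n powr (\<epsilon> - 1/2))"
      unfolding sq using constants_nonneg by (intro mult_left_mono l2p) auto
    also have "\<dots> = Cb * (2 * C0 / (1 - \<rho>\<^sup>2)) * (?n powr (- (1/2)) * ?n powr (\<epsilon> - 1/2))" by simp
    also have "?n powr (- (1/2)) * ?n powr (\<epsilon> - 1/2) = ?n powr (\<epsilon> - 1)"
      by (simp flip: powr_add)
    finally show ?thesis .
  qed
  {
    assume "n < m"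
    hence "norm (coeff_at (u * p) m) \<le> Cb / sqrt ?n * l2 p"
      using n by (intro coeff_u_mult_le p) auto
    also have "\<dots> \<le> Cb * (2 * C0 / (1 - \<rho>\<^sup>2)) * ?n powr (\<epsilon> - 1)" by (rule row)
    also have "\<dots> \<le> C1 * ?n powr (\<epsilon> - 1)"
      using constants_nonneg by (intro mult_right_mono) (auto simp: C1_def)
    finally show "norm (coeff_at (u * p) m) \<le> C1 * ?n powr (\<epsilon> - 1)" .
  }
  show "norm (coeff_at p i) \<le> C1 * ?n powr (\<epsilon> - 1)"
  proof (cases "i \<le> 0")
    case True
    have 1: "norm (coeff_at (p0 n t) i) \<le> C0 * ?n powr (\<epsilon> - 1)"
    proof -
      have "norm (coeff_at (p0 n t) i) \<le> C0 * real_of_int (n - i + 1) powr (- (1 - \<epsilon>))"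
        by (rule p0_le[OF n True])
      also have "\<dots> \<le> C0 * ?n powr (- (1 - \<epsilon>))"
        using n True eps constants_nonneg by (intro mult_left_mono powr_mono2') auto
      finally show ?thesis by simp
    qed
    have "norm (coeff_at (Phi n p) i) \<le> Cb / sqrt ?n * l2 (restr {n + 1..} (u * p))"
      unfolding Phi_def using True n coeff_star_u_mult_le[OF n(1) supported_restr True] by simp
    also have "\<dots> \<le> Cb / sqrt ?n * l2 p"
    proof (intro mult_left_mono)
      have "l2 (restr {n + 1..} (u * p)) \<le> \<rho> * l2 p" using n by (intro l2_restr_u_le p) auto
      also have "\<dots> \<le> 1 * l2 p" using rho by (intro mult_right_mono) auto
      finally show "l2 (restr {n + 1..} (u * p)) \<le> l2 p" by simp
    qed (use n constants_nonneg in auto)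
    also have "\<dots> \<le> Cb * (2 * C0 / (1 - \<rho>\<^sup>2)) * ?n powr (\<epsilon> - 1)" by (rule row)
    finally have 2: "norm (coeff_at (Phi n p) i) \<le> Cb * (2 * C0 / (1 - \<rho>\<^sup>2)) * ?n powr (\<epsilon> - 1)" .
    have "norm (coeff_at p i) \<le> norm (coeff_at (p0 n t) i) + norm (coeff_at (Phi n p) i)"
      by (subst p(2)) (simp add: norm_triangle_ineq)
    also have "\<dots> \<le> C0 * ?n powr (\<epsilon> - 1) + Cb * (2 * C0 / (1 - \<rho>\<^sup>2)) * ?n powr (\<epsilon> - 1)"
      using 1 2 by (rule add_mono)
    also have "\<dots> = C1 * ?n powr (\<epsilon> - 1)" by (simp add: C1_def distrib_right)
    finally show ?thesis .
  next
    case False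
    thus ?thesis using p(1) constants_nonneg by (simp add: supported_def)
  qed
qed

lemma sum_tail_le:
  assumes "1 \<le> s" "finite A" "A \<subseteq> {s..}"
  shows "(\<Sum>j\<in>A. real_of_int (j + 1) powr (- 1 - d)) \<le> real_of_int s powr (- d) / d"
proof -
  have "(\<Sum>j\<in>A. real_of_int (j + 1) powr (- 1 - d)) = (\<Sum>j\<in>(\<lambda>j. j + 1) ` A. real_of_int j powr (- 1 - d))"
    by (subst sum.reindex) auto
  also have "\<dots> \<le> real_of_int s powr (- d) / d"
    using assms d by (intro sum_powr_tail_le) auto
  finally show ?thesis .
qed

text \<open>To reach s from the indices up to 0, ki must contribute a coefficient of index at least
  s, and the l1 tail of ki from s on is of order s^(-d).\<close>

lemma coeff_ki_mult_le:
  assumes "1 \<le> s" "supported {..0} p" "\<And>i. norm (coeff_at p i) \<le> B"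
  shows "norm (coeff_at (ki * p) s) \<le> Ca * B / d * real_of_int s powr (- d)"
proof (rule norm_coeff_at_mult_le)
  have B: "0 \<le> B" using order_trans[OF norm_ge_zero assms(3)] .
  fix A :: "int set" assume A: "finite A"
  have "(\<Sum>j\<in>A. norm (coeff_at ki j) * norm (coeff_at p (s - j)))
      = (\<Sum>j\<in>{j\<in>A. s \<le> j}. norm (coeff_at ki j) * norm (coeff_at p (s - j)))"
    using A assms(2) by (intro sum_neutral_subset) (auto simp: supported_def)
  also have "\<dots> \<le> (\<Sum>j\<in>{j\<in>A. s \<le> j}. (Ca * real_of_int (j + 1) powr (- 1 - d)) * B)"
  proof (intro sum_mono mult_mono assms(3))
    fix j assume "j \<in> {j\<in>A. s \<le> j}"
    thus "norm (coeff_at ki j) \<le> Ca * real_of_int (j + 1) powr (- 1 - d)"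
      using ki_le[of j] assms(1) by simp
  qed (use Ca_nonneg in auto)
  also have "\<dots> = Ca * B * (\<Sum>j\<in>{j\<in>A. s \<le> j}. real_of_int (j + 1) powr (- 1 - d))"
    by (simp add: sum_distrib_left mult_ac)
  also have "\<dots> \<le> Ca * B * (real_of_int s powr (- d) / d)"
    using A assms(1) Ca_nonneg B by (intro mult_left_mono sum_tail_le) auto
  finally show "(\<Sum>j\<in>A. norm (coeff_at ki j) * norm (coeff_at p (s - j))) \<le> Ca * B / d * real_of_int s powr (- d)"
    by simp
qed

text \<open>The mirror image of the previous estimate, with the distance to n + 1 in place of the
  distance to 0.\<close>

lemma coeff_star_hi_mult_le:
  assumes "s \<le> n" "supported {n + 1..} r" "\<And>i. norm (coeff_at r i) \<le> B"
  shows "norm (coeff_at (star hi * r) s) \<le> Ca * B / d * real_of_int (n + 1 - s) powr (- d)"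
proof (rule norm_coeff_at_mult_le)
  have B: "0 \<le> B" using order_trans[OF norm_ge_zero assms(3)] .
  fix A :: "int set" assume A: "finite A"
  let ?B = "{j \<in> A. n + 1 \<le> s - j}"
  have "(\<Sum>j\<in>A. norm (coeff_at (star hi) j) * norm (coeff_at r (s - j)))
      = (\<Sum>j\<in>?B. norm (coeff_at (star hi) j) * norm (coeff_at r (s - j)))"
    using A assms(2) by (intro sum_neutral_subset) (auto simp: supported_def)
  also have "\<dots> \<le> (\<Sum>j\<in>?B. (Ca * real_of_int (- j + 1) powr (- 1 - d)) * B)"
  proof (intro sum_mono mult_mono assms(3))
    fix j assume "j \<in> ?B"
    thus "norm (coeff_at (star hi) j) \<le> Ca * real_of_int (- j + 1) powr (- 1 - d)"
      using hi_le[of "- j"] assms(1) by simp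
  qed (use Ca_nonneg in auto)
  also have "\<dots> = Ca * B * (\<Sum>j\<in>uminus ` ?B. real_of_int (j + 1) powr (- 1 - d))"
    by (subst sum.reindex) (auto simp: sum_distrib_left mult_ac)
  also have "\<dots> \<le> Ca * B * (real_of_int (n + 1 - s) powr (- d) / d)"
    using A assms(1) Ca_nonneg B by (intro mult_left_mono sum_tail_le) auto
  finally show "(\<Sum>j\<in>A. norm (coeff_at (star hi) j) * norm (coeff_at r (s - j)))
      \<le> Ca * B / d * real_of_int (n + 1 - s) powr (- d)" by simp
qed

text \<open>This term determines the rate: it does not become small for t near n. The exponent 1 + d
  of hi is split into 1 + \<epsilon>/2 for n - s + 1, summable over s, and d - \<epsilon>/2 for l.
  The exponent 1 of the Hankel entry is split into d - \<epsilon> for n - t + 1 and 1 - d +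
  \<epsilon> for l. The exponents of l add up to 1 + \<epsilon>/2, which is just summable.\<close>

lemma coeff_star_hi_b_le:
  assumes "s \<le> n" "t \<le> n"
  shows "norm (coeff_at (star hi * restr {n + 1..} (u * F t)) s)
    \<le> Ca * Cb * A1 * (1 + 2 / \<epsilon>) * real_of_int (n - t + 1) powr (\<epsilon> - d)
        * real_of_int (n - s + 1) powr (- 1 - \<epsilon> / 2)"
proof (rule norm_coeff_at_mult_le)
  fix A :: "int set" assume A: "finite A"
  let ?b = "restr {n + 1..} (u * F t)"
  let ?B = "{j \<in> A. n + 1 \<le> s - j}"
  let ?c = "Ca * Cb * A1 * real_of_int (n - t + 1) powr (\<epsilon> - d) * real_of_int (n - s + 1) powr (- 1 - \<epsilon> / 2)"
  have "(\<Sum>j\<in>A. norm (coeff_at (star hi) j) * norm (coeff_at ?b (s - j)))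
      = (\<Sum>j\<in>?B. norm (coeff_at (star hi) j) * norm (coeff_at ?b (s - j)))"
    using A by (intro sum_neutral_subset) auto
  also have "\<dots> \<le> (\<Sum>j\<in>?B. ?c * real_of_int (s - j - n) powr (- 1 - \<epsilon> / 2))"
  proof (rule sum_mono)
    fix j assume j: "j \<in> ?B"
    define l where "l = real_of_int (s - j - n)"
    have l: "1 \<le> l" using j by (simp add: l_def)
    have "norm (coeff_at (star hi) j) \<le> Ca * real_of_int (- j + 1) powr (- ((1 + \<epsilon> / 2) + (d - \<epsilon> / 2)))"
      using hi_le[of "- j"] j assms by (simp add: algebra_simps)
    also have "\<dots> \<le> Ca * (real_of_int (n - s + 1) powr (- (1 + \<epsilon> / 2)) * l powr (- (d - \<epsilon> / 2)))"
      using j assms Ca_nonneg eps d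
      by (intro mult_left_mono powr_neg_le_split) (auto simp: l_def)
    finally have 1: "norm (coeff_at (star hi) j)
        \<le> Ca * (real_of_int (n - s + 1) powr (- (1 + \<epsilon> / 2)) * l powr (- (d - \<epsilon> / 2)))" .
    have "norm (coeff_at ?b (s - j)) \<le> Cb * A1 / real_of_int (s - j - t)"
      using coeff_u_F_le[of t "s - j"] j assms by simp
    also have "\<dots> = Cb * A1 * real_of_int (s - j - t) powr (- ((d - \<epsilon>) + (1 - d + \<epsilon>)))"
      using j assms by (simp add: powr_minus divide_inverse)
    also have "\<dots> \<le> Cb * A1 * (real_of_int (n - t + 1) powr (- (d - \<epsilon>)) * l powr (- (1 - d + \<epsilon>)))"
      using j assms eps d constants_nonneg
      by (intro mult_left_mono powr_neg_le_split) (auto simp: l_def)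
    finally have 2: "norm (coeff_at ?b (s - j))
        \<le> Cb * A1 * (real_of_int (n - t + 1) powr (- (d - \<epsilon>)) * l powr (- (1 - d + \<epsilon>)))" .
    have "norm (coeff_at (star hi) j) * norm (coeff_at ?b (s - j))
        \<le> (Ca * (real_of_int (n - s + 1) powr (- (1 + \<epsilon> / 2)) * l powr (- (d - \<epsilon> / 2))))
          * (Cb * A1 * (real_of_int (n - t + 1) powr (- (d - \<epsilon>)) * l powr (- (1 - d + \<epsilon>))))"
      using 1 2 constants_nonneg Ca_nonneg by (intro mult_mono) auto
    also have "\<dots> = ?c * (l powr (- (d - \<epsilon> / 2)) * l powr (- (1 - d + \<epsilon>)))"
      by (simp add: algebra_simps)
    also have "l powr (- (d - \<epsilon> / 2)) * l powr (- (1 - d + \<epsilon>)) = l powr (- 1 - \<epsilon> / 2)"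
      by (simp add: algebra_simps flip: powr_add)
    finally show "norm (coeff_at (star hi) j) * norm (coeff_at ?b (s - j))
        \<le> ?c * real_of_int (s - j - n) powr (- 1 - \<epsilon> / 2)" by (simp only: l_def)
  qed
  also have "\<dots> = ?c * (\<Sum>l\<in>(\<lambda>j. s - j - n) ` ?B. real_of_int l powr (- 1 - \<epsilon> / 2))"
    by (subst sum.reindex) (auto simp: inj_on_def sum_distrib_left)
  also have "\<dots> \<le> ?c * (1 + 1 / (\<epsilon> / 2))"
    using A eps constants_nonneg Ca_nonneg by (intro mult_left_mono sum_powr_from_1_le) auto
  finally show "(\<Sum>j\<in>A. norm (coeff_at (star hi) j) * norm (coeff_at ?b (s - j)))
      \<le> Ca * Cb * A1 * (1 + 2 / \<epsilon>) * real_of_int (n - t + 1) powr (\<epsilon> - d)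
        * real_of_int (n - s + 1) powr (- 1 - \<epsilon> / 2)" by (simp add: mult_ac)
qed

end

section \<open>Inverses of finite block matrices\<close>

lemma block_left_right_inverse_eq:
  fixes A B B' :: "nat \<Rightarrow> nat \<Rightarrow> complex^'q^'q"
  assumes left: "\<And>s t. s \<in> {1..n} \<Longrightarrow> t \<in> {1..n} \<Longrightarrow> (\<Sum>u=1..n. B' s u ** A u t) = (if s = t then mat 1 else 0)"
    and right: "\<And>s t. s \<in> {1..n} \<Longrightarrow> t \<in> {1..n} \<Longrightarrow> (\<Sum>u=1..n. A s u ** B u t) = (if s = t then mat 1 else 0)"
    and st: "s \<in> {1..n}" "t \<in> {1..n}"
  shows "B' s t = B s t"
proof -
  have "B' s t = (\<Sum>u=1..n. B' s u ** (if u = t then mat 1 else 0))"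
    using st by (simp add: if_distrib[of "(**) _"] mmult.zero_right cong: if_cong)
  also have "\<dots> = (\<Sum>u=1..n. B' s u ** (\<Sum>v=1..n. A u v ** B v t))"
    using st right by (intro sum.cong) auto
  also have "\<dots> = (\<Sum>u=1..n. \<Sum>v=1..n. B' s u ** A u v ** B v t)"
    by (simp add: mmult.sum_right matrix_mul_assoc)
  also have "\<dots> = (\<Sum>v=1..n. \<Sum>u=1..n. B' s u ** A u v ** B v t)"
    by (rule sum.swap)
  also have "\<dots> = (\<Sum>v=1..n. (\<Sum>u=1..n. B' s u ** A u v) ** B v t)"
    by (simp add: mmult.sum_left)
  also have "\<dots> = (\<Sum>v=1..n. (if s = v then mat 1 else 0) ** B v t)"
    using st left by (intro sum.cong) auto
  also have "\<dots> = B s t"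
    using st by (simp add: if_distrib[of "\<lambda>x. x ** _"] mmult.zero_left cong: if_cong)
  finally show ?thesis .
qed

lemma is_block_inverse_unique:
  assumes "is_block_inverse n A B" "is_block_inverse n A B'" "s \<in> {1..n}" "t \<in> {1..n}"
  shows "B s t = B' s t"
  using assms by (intro block_left_right_inverse_eq[of n B A B']) (auto simp: is_block_inverse_def)

lemma block_inverse_eq:
  assumes "is_block_inverse n A B" "s \<in> {1..n}" "t \<in> {1..n}"
  shows "block_inverse n A s t = B s t"
  unfolding block_inverse_def
  by (rule is_block_inverse_unique[OF someI[of "is_block_inverse n A", OF assms(1)] assms])

text \<open>The construction by columns yields only a right inverse. For a Hermitian matrix its
  conjugate transpose is a left inverse, hence equal to it.\<close>

lemma is_block_inverse_hermitian:
  assumes herm: "\<And>s t. A s t = hermitian_conj (A t s)"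
    and right: "\<And>s t. s \<in> {1..n} \<Longrightarrow> t \<in> {1..n} \<Longrightarrow> (\<Sum>u=1..n. A s u ** B u t) = (if s = t then mat 1 else 0)"
  shows "is_block_inverse n A B"
proof -
  define B' where "B' s t = hermitian_conj (B t s)" for s t
  have left: "(\<Sum>u=1..n. B' s u ** A u t) = (if s = t then mat 1 else 0)"
    if "s \<in> {1..n}" "t \<in> {1..n}" for s t
  proof -
    have "(\<Sum>u=1..n. B' s u ** A u t) = hermitian_conj (\<Sum>u=1..n. A t u ** B u s)"
      unfolding hermitian_conj_sum hermitian_conj_mult B'_def by (subst herm) simp
    thus ?thesis using right[OF that(2,1)] by auto
  qed
  have "B' s t = B s t" if "s \<in> {1..n}" "t \<in> {1..n}" for s t
    by (rule block_left_right_inverse_eq[OF left right that])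
  hence "(\<Sum>u=1..n. B s u ** A u t) = (if s = t then mat 1 else 0)"
    if "s \<in> {1..n}" "t \<in> {1..n}" for s t
    using left[OF that] that by (metis (mono_tags, lifting) sum.cong)
  thus ?thesis using right by (simp add: is_block_inverse_def)
qed

lemma sum_int_nat: "(\<Sum>s\<in>{1..int n}. f s) = (\<Sum>s=1..n. f (int s))"
proof -
  have "{1..int n} = int ` {1..n}" by (simp add: image_int_atLeastAtMost)
  thus ?thesis by (simp add: sum.reindex)
qed

section \<open>The inverse of the regularized finite Toeplitz matrix\<close>

context wiener_factors begin

text \<open>The first summand comes from the two terms with p, each of size n^(\<epsilon> - 1) times
  a sum of order n^(1 - d). The second is the constant of \<open>coeff_star_hi_b_le\<close> times
  the sum over s.\<close>

definition CK where
  "CK = 2 * (Ca * C1 / d / (1 - d)) + Ca * Cb * A1 * (1 + 2 / \<epsilon>) * (1 + 2 / \<epsilon>)"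

lemma column:
  assumes t: "1 \<le> t" "t \<le> n"
  shows "\<exists>X. supported {1..n} X \<and>
    (\<forall>s\<in>{1..n}. coeff_at (h * star h * X) s = (if s = t then mat 1 else 0)) \<and>
    (\<Sum>s\<in>{1..n}. norm (coeff_at X s - coeff_at (ki * F t) s)) \<le> CK * real_of_int (n - t + 1) powr (\<epsilon> - d)"
proof -
  have n: "1 \<le> n" using t by simp
  obtain p where p: "supported {..0} p" "p = p0 n t + Phi n p"
    using ex_solution[of n "p0 n t"] n by (auto simp: p0_def supported_restr)
  \<comment> \<open>This choice cancels the coefficients of \<open>u * (F t + p) + r\<close> beyond
    n. The equation for p then says that \<open>F t + p + star u * r\<close> has no coefficients of
    index up to 0.\<close>
  define r where "r = - restr {n + 1..} (u * F t) - restr {n + 1..} (u * p)"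
  define X where "X = ki * (F t + p) + star hi * r"
  have r_sup: "supported {n + 1..} r" by (simp add: r_def supported_def)
  have p_eq: "p = - restr {..0} (star u * r)"
  proof -
    have "restr {..0} (star u * r) = - (p0 n t + Phi n p)"
      by (rule wiener_eqI) (simp add: r_def p0_def Phi_def right_diff_distrib)
    thus ?thesis using p(2) by simp
  qed
  \<comment> \<open>X has two representations: as an analytic multiple of a series starting at 1,
    and below as an anti-analytic multiple of a series ending at n. Together they give its
    support.\<close>
  have "X = ki * (F t + p + star u * r)"
    by (simp add: X_def distrib_left ki_star_u mult.assoc[symmetric])
  moreover have "supported {1..} (F t + p + star u * r)"
  proof -
    have "coeff_at p i = - coeff_at (star u * r) i" if "i \<le> 0" for i
      by (subst p_eq) (use that in simp)
    thus ?thesis by (auto simp: supported_def coeff_F)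
  qed
  ultimately have X1: "supported {1..} X"
    using supported_mult[OF analytic(4), of "{1..}" _ "{1..}"] by auto
  have "X = star hi * (u * (F t + p) + r)"
    by (simp add: X_def distrib_left star_hi_u mult.assoc[symmetric])
  moreover have "supported {..n} (u * (F t + p) + r)"
    by (simp add: r_def supported_def distrib_left)
  ultimately have "supported {..n} X"
    using supported_mult[OF supported_stars(2), of "{..n}" _ "{..n}"] by auto
  with X1 have X_sup: "supported {1..n} X" by (auto simp: supported_def)

  \<comment> \<open>Using \<open>star k * k\<close> for one part of X and \<open>h * star h\<close>
    for the other, the corrections become \<open>star k * p\<close> and \<open>h * r\<close>,
    supported outside \<open>{1..n}\<close>; what remains there is z^t.\<close>
  have "h * star h * X = star k * (k * ki) * (F t + p) + h * star (hi * h) * r"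
    unfolding X_def distrib_left
    by (simp add: factorizations star_mult mult.assoc distrib_left flip: factorizations)
       (simp add: factorizations mult.assoc[symmetric])
  also have "\<dots> = star k * F t + star k * p + h * r" by (simp add: inv distrib_left)
  also have "star k * F t = monom_at t (mat 1) - star k * restr {..0} (star ki * monom_at t (mat 1))"
  proof -
    have "F t = star ki * monom_at t (mat 1) - restr {..0} (star ki * monom_at t (mat 1))"
      by (rule wiener_eqI) (simp add: F_def)
    hence "star k * F t = star (ki * k) * monom_at t (mat 1) - star k * restr {..0} (star ki * monom_at t (mat 1))"
      by (simp add: right_diff_distrib star_mult mult.assoc)
    thus ?thesis by (simp add: inv)
  qed
  finally have hX: "h * star h * X = monom_at t (mat 1) - star k * restr {..0} (star ki * monom_at t (mat 1))
      + star k * p + h * r" .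
  have "supported {..0} (star k * restr {..0} (star ki * monom_at t (mat 1)))"
    by (rule supported_mult[OF supported_stars(3) supported_restr]) auto
  moreover have "supported {..0} (star k * p)"
    by (rule supported_mult[OF supported_stars(3) p(1)]) auto
  moreover have "supported {n + 1..} (h * r)"
    by (rule supported_mult[OF analytic(1) r_sup]) auto
  ultimately have eq: "coeff_at (h * star h * X) s = (if s = t then mat 1 else 0)" if "s \<in> {1..n}" for s
    using that unfolding hX by (auto simp: supported_def coeff_at_monom_at)

  let ?N = "real_of_int n"
  define B where "B = C1 * ?N powr (\<epsilon> - 1)"
  have p_le: "norm (coeff_at p i) \<le> B" for i
    unfolding B_def by (rule solution_bounds(1)[OF n t(2) p])
  have up_le: "norm (coeff_at (restr {n + 1..} (u * p)) i) \<le> B" for i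
    using solution_bounds(2)[OF n t(2) p, of i] constants_nonneg by (auto simp: B_def)
  define W where "W s = real_of_int (n - s + 1)" for s
  have diff: "norm (coeff_at X s - coeff_at (ki * F t) s)
      \<le> Ca * B / d * real_of_int s powr (- d) + Ca * B / d * W s powr (- d)
        + Ca * Cb * A1 * (1 + 2 / \<epsilon>) * W t powr (\<epsilon> - d) * W s powr (- 1 - \<epsilon> / 2)"
    if s: "s \<in> {1..n}" for s
  proof -
    have "coeff_at X s - coeff_at (ki * F t) s = coeff_at (ki * p) s
        - coeff_at (star hi * restr {n + 1..} (u * p)) s - coeff_at (star hi * restr {n + 1..} (u * F t)) s"
      by (simp add: X_def r_def distrib_left right_diff_distrib)
    hence "norm (coeff_at X s - coeff_at (ki * F t) s) \<le> norm (coeff_at (ki * p) s)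
        + norm (coeff_at (star hi * restr {n + 1..} (u * p)) s)
        + norm (coeff_at (star hi * restr {n + 1..} (u * F t)) s)"
      by (metis (no_types, lifting) norm_triangle_le_diff norm_triangle_ineq4 add_mono order_refl)
    also have "\<dots> \<le> Ca * B / d * real_of_int s powr (- d) + Ca * B / d * W s powr (- d)
        + Ca * Cb * A1 * (1 + 2 / \<epsilon>) * W t powr (\<epsilon> - d) * W s powr (- 1 - \<epsilon> / 2)"
      using coeff_ki_mult_le[OF _ p(1) p_le, of s] s t
        coeff_star_hi_mult_le[OF _ supported_restr up_le, of s] coeff_star_hi_b_le[of s n t]
      by (intro add_mono) (auto simp: W_def algebra_simps)
    finally show ?thesis .
  qed
  have rev: "(\<Sum>s\<in>{1..n}. g (n - s + 1)) = (\<Sum>s\<in>{1..n}. g s)" for g :: "int \<Rightarrow> real"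
    by (rule sum.reindex_bij_witness[of _ "\<lambda>s. n - s + 1" "\<lambda>s. n - s + 1"]) auto
  have s1: "(\<Sum>s\<in>{1..n}. real_of_int s powr (- d)) \<le> ?N powr (1 - d) / (1 - d)"
    using d n by (intro sum_powr_le) auto
  have s2: "(\<Sum>s\<in>{1..n}. W s powr (- d)) \<le> ?N powr (1 - d) / (1 - d)"
    using s1 rev[of "\<lambda>s. real_of_int s powr (- d)"] by (simp add: W_def)
  have s3: "(\<Sum>s\<in>{1..n}. W s powr (- 1 - \<epsilon> / 2)) \<le> 1 + 2 / \<epsilon>"
    using sum_powr_from_1_le[of "\<epsilon> / 2" "{1..n}"] eps rev[of "\<lambda>s. real_of_int s powr (- 1 - \<epsilon> / 2)"]
    by (simp add: W_def)
  have "(\<Sum>s\<in>{1..n}. norm (coeff_at X s - coeff_at (ki * F t) s))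
      \<le> (\<Sum>s\<in>{1..n}. Ca * B / d * real_of_int s powr (- d) + Ca * B / d * W s powr (- d)
        + Ca * Cb * A1 * (1 + 2 / \<epsilon>) * W t powr (\<epsilon> - d) * W s powr (- 1 - \<epsilon> / 2))"
    by (intro sum_mono diff)
  also have "\<dots> = Ca * B / d * (\<Sum>s\<in>{1..n}. real_of_int s powr (- d)) + Ca * B / d * (\<Sum>s\<in>{1..n}. W s powr (- d))
        + Ca * Cb * A1 * (1 + 2 / \<epsilon>) * W t powr (\<epsilon> - d) * (\<Sum>s\<in>{1..n}. W s powr (- 1 - \<epsilon> / 2))"
    by (simp add: sum.distrib sum_distrib_left)
  also have "\<dots> \<le> Ca * B / d * (?N powr (1 - d) / (1 - d)) + Ca * B / d * (?N powr (1 - d) / (1 - d))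
        + Ca * Cb * A1 * (1 + 2 / \<epsilon>) * W t powr (\<epsilon> - d) * (1 + 2 / \<epsilon>)"
    using Ca_nonneg constants_nonneg d eps
    by (intro add_mono mult_left_mono s1 s2 s3) (auto simp: B_def intro!: mult_nonneg_nonneg)
  also have "\<dots> = 2 * (Ca * C1 / d / (1 - d)) * (?N powr (\<epsilon> - 1) * ?N powr (1 - d))
        + Ca * Cb * A1 * (1 + 2 / \<epsilon>) * (1 + 2 / \<epsilon>) * W t powr (\<epsilon> - d)"
    by (simp add: B_def)
  also have "?N powr (\<epsilon> - 1) * ?N powr (1 - d) = ?N powr (\<epsilon> - d)"
    by (simp flip: powr_add)
  \<comment> \<open>The exponent is negative and n - t + 1 is at most n, so n may be replaced by n -
    t + 1.\<close>
  also have "2 * (Ca * C1 / d / (1 - d)) * ?N powr (\<epsilon> - d)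
        + Ca * Cb * A1 * (1 + 2 / \<epsilon>) * (1 + 2 / \<epsilon>) * W t powr (\<epsilon> - d) \<le> CK * W t powr (\<epsilon> - d)"
    unfolding CK_def distrib_right using Ca_nonneg constants_nonneg d eps t
    by (intro add_mono mult_left_mono powr_mono2') (auto simp: W_def)
  finally have "(\<Sum>s\<in>{1..n}. norm (coeff_at X s - coeff_at (ki * F t) s)) \<le> CK * W t powr (\<epsilon> - d)" .
  thus ?thesis using X_sup eq by (auto simp: W_def)
qed

text \<open>Identifies the leading term with the lower-times-upper triangular product that defines
  the semi-infinite inverse.\<close>

lemma coeff_ki_F:
  "coeff_at (ki * F (int t)) (int s)
    = (\<Sum>l=1..min s t. coeff_at ki (int (s - l)) ** hermitian_conj (coeff_at ki (int (t - l))))"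
proof -
  let ?f = "\<lambda>j. coeff_at ki j ** coeff_at (F (int t)) (int s - j)"
  have "(?f has_sum sum ?f ((\<lambda>l. int s - int l) ` {1..min s t})) UNIV"
  proof (rule has_sum_finite_neutralI)
    fix j assume j: "j \<in> UNIV - (\<lambda>l. int s - int l) ` {1..min s t}"
    show "?f j = 0"
    proof (cases "0 \<le> j \<and> int s - j \<in> {1..int t}")
      case True
      hence "j = int s - int (nat (int s - j))" "nat (int s - j) \<in> {1..min s t}" by auto
      hence "j \<in> (\<lambda>l. int s - int l) ` {1..min s t}" by blast
      thus ?thesis using j by simp
    next
      case False
      hence "coeff_at ki j = 0 \<or> coeff_at (F (int t)) (int s - j) = 0"
        using analytic(4) supported_F[of "int t"] unfolding supported_def by (metis atLeast_iff)
      thus ?thesis by (auto simp: mmult.zero_left mmult.zero_right)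
    qed
  qed auto
  hence "coeff_at (ki * F (int t)) (int s) = sum ?f ((\<lambda>l. int s - int l) ` {1..min s t})"
    using has_sum_coeff_at_mult has_sum_unique by blast
  also have "\<dots> = (\<Sum>l=1..min s t. ?f (int s - int l))"
    by (subst sum.reindex) (auto simp: inj_on_def)
  also have "\<dots> = (\<Sum>l=1..min s t. coeff_at ki (int (s - l)) ** hermitian_conj (coeff_at ki (int (t - l))))"
    by (intro sum.cong) (auto simp: coeff_F of_nat_diff)
  finally show ?thesis .
qed

text \<open>The error is summed over the rows of a fixed column, which is the norm suited to a
  right-hand side that is summable over t.\<close>

lemma ex_block_inverse:
  "\<exists>B. is_block_inverse n (\<lambda>s t. coeff_at (h * star h) (int s - int t)) B \<and>
    (\<forall>t\<in>{1..n}. (\<Sum>s=1..n. norm (B s t -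
        (\<Sum>l=1..min s t. coeff_at ki (int (s - l)) ** hermitian_conj (coeff_at ki (int (t - l))))))
      \<le> CK * real (n - t + 1) powr (\<epsilon> - d))"
proof -
  have "\<forall>t\<in>{1..n}. \<exists>X. supported {1..int n} X \<and>
    (\<forall>s\<in>{1..int n}. coeff_at (h * star h * X) s = (if s = int t then mat 1 else 0)) \<and>
    (\<Sum>s\<in>{1..int n}. norm (coeff_at X s - coeff_at (ki * F (int t)) s))
        \<le> CK * real_of_int (int n - int t + 1) powr (\<epsilon> - d)"
    by (intro ballI column) auto
  from bchoice[OF this] obtain X where X: "\<And>t. t \<in> {1..n} \<Longrightarrow> supported {1..int n} (X t)"
    "\<And>s t. t \<in> {1..n} \<Longrightarrow> s \<in> {1..int n} \<Longrightarrow> coeff_at (h * star h * X t) s = (if s = int t then mat 1 else 0)"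
    "\<And>t. t \<in> {1..n} \<Longrightarrow> (\<Sum>s\<in>{1..int n}. norm (coeff_at (X t) s - coeff_at (ki * F (int t)) s))
        \<le> CK * real_of_int (int n - int t + 1) powr (\<epsilon> - d)"
    by blast
  define B where "B s t = coeff_at (X t) (int s)" for s t
  let ?A = "\<lambda>s t. coeff_at (h * star h) (int s - int t)"
  have "is_block_inverse n ?A B"
  proof (rule is_block_inverse_hermitian)
    fix s t :: nat
    have "coeff_at (star (h * star h)) (int s - int t) = hermitian_conj (?A t s)"
      unfolding coeff_at_star by simp
    thus "?A s t = hermitian_conj (?A t s)" by (simp add: star_mult)
  next
    fix s t assume st: "s \<in> {1..n}" "t \<in> {1..n}"
    let ?f = "\<lambda>j. coeff_at (h * star h) j ** coeff_at (X t) (int s - j)"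
    have "(?f has_sum sum ?f ((\<lambda>u. int s - int u) ` {1..n})) UNIV"
    proof (rule has_sum_finite_neutralI)
      fix j assume j: "j \<in> UNIV - (\<lambda>u. int s - int u) ` {1..n}"
      have "int s - j \<notin> {1..int n}"
      proof
        assume "int s - j \<in> {1..int n}"
        hence "j = int s - int (nat (int s - j))" "nat (int s - j) \<in> {1..n}" by auto
        thus False using j by blast
      qed
      thus "?f j = 0" using X(1)[OF st(2)] by (simp add: supported_def mmult.zero_right)
    qed auto
    hence "coeff_at (h * star h * X t) (int s) = sum ?f ((\<lambda>u. int s - int u) ` {1..n})"
      using has_sum_coeff_at_mult has_sum_unique by blast
    also have "\<dots> = (\<Sum>u=1..n. ?f (int s - int u))"
      by (subst sum.reindex) (auto simp: inj_on_def)
    finally show "(\<Sum>u=1..n. ?A s u ** B u t) = (if s = t then mat 1 else 0)"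
      using X(2)[OF st(2), of "int s"] st by (simp add: B_def)
  qed
  moreover have "(\<Sum>s=1..n. norm (B s t -
        (\<Sum>l=1..min s t. coeff_at ki (int (s - l)) ** hermitian_conj (coeff_at ki (int (t - l))))))
      \<le> CK * real (n - t + 1) powr (\<epsilon> - d)" if "t \<in> {1..n}" for t
    using X(3)[OF that] that unfolding sum_int_nat coeff_ki_F B_def by (simp add: of_nat_diff algebra_simps)
  ultimately show ?thesis by blast
qed

end

section \<open>Power series of rational functions\<close>

text \<open>Extension by zero to negative indices. It has the expected coefficients only for
  absolutely summable f, as \<open>Wiener\<close> inverts \<open>coeff_at\<close> only
  there.\<close>

definition wiener_of :: "(nat \<Rightarrow> complex^'q^'q) \<Rightarrow> 'q::finite wiener" where
  "wiener_of f = Wiener (\<lambda>k. if 0 \<le> k then f (nat k) else 0)"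

lemma coeff_at_wiener_of:
  fixes f :: "nat \<Rightarrow> complex^'q::finite^'q"
  assumes "summable (\<lambda>n. norm (f n))"
  shows "coeff_at (wiener_of f) k = (if 0 \<le> k then f (nat k) else 0)"
proof -
  have "(\<Sum>k\<in>A. norm (if 0 \<le> k then f (nat k) else 0)) \<le> (\<Sum>n. norm (f n))" if A: "finite A" for A :: "int set"
  proof -
    have "(\<Sum>k\<in>A. norm (if 0 \<le> k then f (nat k) else 0)) = (\<Sum>k\<in>{k\<in>A. 0 \<le> k}. norm (f (nat k)))"
      by (subst sum_neutral_subset[OF A, of "\<lambda>k. 0 \<le> k"]) auto
    also have "\<dots> = (\<Sum>n\<in>nat ` {k\<in>A. 0 \<le> k}. norm (f n))"
      by (subst sum.reindex) (auto simp: inj_on_def)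
    also have "\<dots> \<le> (\<Sum>n. norm (f n))"
      using A assms by (intro sum_le_suminf) auto
    finally show ?thesis .
  qed
  from coeff_at_Wiener(1)[OF this] show ?thesis by (simp add: wiener_of_def)
qed

lemma supported_wiener_of:
  fixes f :: "nat \<Rightarrow> complex^'q::finite^'q"
  shows "summable (\<lambda>n. norm (f n)) \<Longrightarrow> supported {0..} (wiener_of f)"
  by (simp add: supported_def coeff_at_wiener_of)

lemma ev_wiener_of:
  fixes f :: "nat \<Rightarrow> complex^'q::finite^'q"
  assumes "summable (\<lambda>n. norm (f n))" "(\<lambda>n. mscale (cis \<theta> ^ n) (f n)) sums S"
  shows "ev (wiener_of f) \<theta> = S"
proof -
  let ?g = "\<lambda>k. mscale (cis (of_int k * \<theta>)) (coeff_at (wiener_of f) k)"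
  have "(?g has_sum ev (wiener_of f) \<theta>) (range int)"
  proof (rule has_sum_cong_neutral[THEN iffD1, OF _ _ _ has_sum_ev])
    fix k assume "k \<in> UNIV - range int"
    hence "k < 0" by (metis DiffD2 nat_0_le not_le rangeI)
    thus "?g k = 0" using assms(1) by (simp add: coeff_at_wiener_of mscale.zero_right)
  qed auto
  hence "((?g \<circ> int) has_sum ev (wiener_of f) \<theta>) UNIV"
    by (subst (asm) has_sum_reindex) auto
  moreover have "?g \<circ> int = (\<lambda>n. mscale (cis \<theta> ^ n) (f n))"
    using assms(1) by (auto simp: fun_eq_iff coeff_at_wiener_of Complex.DeMoivre)
  ultimately have "(\<lambda>n. mscale (cis \<theta> ^ n) (f n)) sums ev (wiener_of f) \<theta>"
    using has_sum_imp_sums by simp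
  thus ?thesis using assms(2) sums_unique2 by blast
qed

lemma coeff_at_wiener_of_mult:
  fixes f g :: "nat \<Rightarrow> complex^'q::finite^'q"
  assumes "summable (\<lambda>n. norm (f n))" "summable (\<lambda>n. norm (g n))"
  shows "coeff_at (wiener_of f * wiener_of g) (int k) = (\<Sum>i\<le>k. f i ** g (k - i))"
proof -
  let ?h = "\<lambda>j. coeff_at (wiener_of f) j ** coeff_at (wiener_of g) (int k - j)"
  have "(?h has_sum sum ?h (int ` {..k})) UNIV"
  proof (rule has_sum_finite_neutralI)
    fix j assume j: "j \<in> UNIV - int ` {..k}"
    hence "j < 0 \<or> int k < j"
      by (metis DiffD2 atMost_iff image_eqI int_nat_eq nat_le_iff not_le)
    thus "?h j = 0" using assms by (auto simp: coeff_at_wiener_of mmult.zero_left mmult.zero_right)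
  qed auto
  hence "coeff_at (wiener_of f * wiener_of g) (int k) = sum ?h (int ` {..k})"
    using has_sum_coeff_at_mult has_sum_unique by blast
  also have "\<dots> = (\<Sum>i\<le>k. ?h (int i))" by (subst sum.reindex) auto
  also have "\<dots> = (\<Sum>i\<le>k. f i ** g (k - i))"
    using assms by (intro sum.cong) (auto simp: coeff_at_wiener_of nat_diff_distrib)
  finally show ?thesis .
qed

text \<open>For i + l = k one has k + 1 at most (i + 1)(l + 1), so polynomial decay of f survives
  convolution with g at the cost of a polynomial weight on g. The weight of degree 2 covers both
  exponents in use, 1 - d and 1 + d.\<close>

lemma norm_coeff_wiener_of_mult_le:
  fixes f g :: "nat \<Rightarrow> complex^'q::finite^'q"
  assumes f: "\<And>i. norm (f i) \<le> C * (real i + 1) powr (- \<sigma>)" "summable (\<lambda>n. norm (f n))"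
    and g: "summable (\<lambda>n. (real n + 1)\<^sup>2 * norm (g n))"
    and \<sigma>: "0 \<le> \<sigma>" "\<sigma> \<le> 2"
  shows "norm (coeff_at (wiener_of f * wiener_of g) (int k))
    \<le> C * (\<Sum>n. (real n + 1)\<^sup>2 * norm (g n)) * (real k + 1) powr (- \<sigma>)"
proof -
  have C: "0 \<le> C" using order_trans[OF norm_ge_zero f(1)[of 0]] by simp
  have g': "summable (\<lambda>n. norm (g n))"
    by (rule summable_comparison_test'[OF g, of 0]) (auto intro!: mult_le_cancel_right1[THEN iffD2])
  have "norm (coeff_at (wiener_of f * wiener_of g) (int k)) \<le> (\<Sum>i\<le>k. norm (f i ** g (k - i)))"
    unfolding coeff_at_wiener_of_mult[OF f(2) g'] by (rule norm_sum)
  also have "\<dots> \<le> (\<Sum>i\<le>k. C * (real k + 1) powr (- \<sigma>) * ((real (k - i) + 1)\<^sup>2 * norm (g (k - i))))"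
  proof (rule sum_mono)
    fix i assume "i \<in> {..k}"
    hence i: "i \<le> k" by simp
    define l where "l = k - i"
    have "(real i + 1) powr (- \<sigma>) \<le> (real k + 1) powr (- \<sigma>) * (real l + 1) powr \<sigma>"
    proof -
      have "k = i + l" using i by (simp add: l_def)
      hence "real k + 1 \<le> (real i + 1) * (real l + 1)" by (simp add: algebra_simps)
      hence "(real k + 1) powr \<sigma> \<le> ((real i + 1) * (real l + 1)) powr \<sigma>"
        using \<sigma> by (intro powr_mono2) auto
      also have "\<dots> = (real i + 1) powr \<sigma> * (real l + 1) powr \<sigma>" by (rule powr_mult)
      finally show ?thesis by (simp add: powr_minus field_simps)
    qed
    also have "(real l + 1) powr \<sigma> \<le> (real l + 1) powr 2"
      using \<sigma> by (intro powr_mono) auto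
    finally have p: "(real i + 1) powr (- \<sigma>) \<le> (real k + 1) powr (- \<sigma>) * (real l + 1)\<^sup>2"
      by (simp add: powr_numeral mult_left_mono)
    have "norm (f i ** g l) \<le> norm (f i) * norm (g l)" by (rule norm_matrix_mult_le)
    also have "\<dots> \<le> (C * ((real k + 1) powr (- \<sigma>) * (real l + 1)\<^sup>2)) * norm (g l)"
      by (rule mult_right_mono[OF order_trans[OF f(1) mult_left_mono[OF p C]] norm_ge_zero])
    finally show "norm (f i ** g (k - i))
        \<le> C * (real k + 1) powr (- \<sigma>) * ((real (k - i) + 1)\<^sup>2 * norm (g (k - i)))"
      by (simp add: l_def mult.assoc)
  qed
  also have "\<dots> = C * (real k + 1) powr (- \<sigma>) * (\<Sum>l\<le>k. (real l + 1)\<^sup>2 * norm (g l))"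
    unfolding sum_distrib_left[symmetric]
    by (intro arg_cong[of _ _ "\<lambda>x. _ * x"] sum.reindex_bij_witness[of _ "\<lambda>i. k - i" "\<lambda>i. k - i"]) auto
  also have "\<dots> \<le> C * (real k + 1) powr (- \<sigma>) * (\<Sum>n. (real n + 1)\<^sup>2 * norm (g n))"
    using C g by (intro mult_left_mono sum_le_suminf) auto
  finally show ?thesis by (simp add: mult_ac)
qed

text \<open>The weight 1 + |j| is submultiplicative, so the weighted product is dominated by the
  convolution of the weighted factors.\<close>

lemma weighted_summable_mult:
  assumes "(\<lambda>j. (1 + \<bar>real_of_int j\<bar>) * norm (coeff_at f j)) summable_on UNIV"
    and "(\<lambda>j. (1 + \<bar>real_of_int j\<bar>) * norm (coeff_at g j)) summable_on UNIV"
  shows "(\<lambda>j. \<bar>real_of_int j\<bar> * norm (coeff_at (f * g) j)) summable_on UNIV"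
proof -
  define f' where "f' = Wiener (\<lambda>j. (1 + \<bar>real_of_int j\<bar>) *\<^sub>R coeff_at f j)"
  define g' where "g' = Wiener (\<lambda>j. (1 + \<bar>real_of_int j\<bar>) *\<^sub>R coeff_at g j)"
  have f': "coeff_at f' j = (1 + \<bar>real_of_int j\<bar>) *\<^sub>R coeff_at f j" for j
    unfolding f'_def using assms(1) by (subst Wiener_inverse) auto
  have g': "coeff_at g' j = (1 + \<bar>real_of_int j\<bar>) *\<^sub>R coeff_at g j" for j
    unfolding g'_def using assms(2) by (subst Wiener_inverse) auto
  show ?thesis
  proof (rule summable_on_comparison_test[OF summable_on_convolution_norms[of f' g']])
    fix k :: int
    have "\<bar>real_of_int k\<bar> * norm (coeff_at (f * g) k)
        \<le> \<bar>real_of_int k\<bar> * (\<Sum>\<^sub>\<infinity>j. norm (coeff_at f j) * norm (coeff_at g (k - j)))"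
      unfolding coeff_at_mult by (intro mult_left_mono norm_convolution_le) auto
    also have "\<dots> = (\<Sum>\<^sub>\<infinity>j. \<bar>real_of_int k\<bar> * (norm (coeff_at f j) * norm (coeff_at g (k - j))))"
      by (rule infsum_cmult_right[symmetric]) (rule summable_on_norm_convolution_row)
    also have "\<dots> \<le> (\<Sum>\<^sub>\<infinity>j. norm (coeff_at f' j) * norm (coeff_at g' (k - j)))"
    proof (rule infsum_mono[OF _ summable_on_norm_convolution_row])
      show "(\<lambda>j. \<bar>real_of_int k\<bar> * (norm (coeff_at f j) * norm (coeff_at g (k - j)))) summable_on UNIV"
        by (intro summable_on_cmult_right summable_on_norm_convolution_row)
      fix j :: int
      have "\<bar>real_of_int k\<bar> \<le> (1 + \<bar>real_of_int j\<bar>) * (1 + \<bar>real_of_int (k - j)\<bar>)"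
      proof -
        have "\<bar>real_of_int k\<bar> \<le> \<bar>real_of_int j\<bar> + \<bar>real_of_int (k - j)\<bar>" by simp
        moreover have "0 \<le> \<bar>real_of_int j\<bar> * \<bar>real_of_int (k - j)\<bar>" by simp
        ultimately show ?thesis by (simp only: distrib_left distrib_right mult_1 mult_1_right)
      qed
      hence "\<bar>real_of_int k\<bar> * (norm (coeff_at f j) * norm (coeff_at g (k - j)))
          \<le> ((1 + \<bar>real_of_int j\<bar>) * (1 + \<bar>real_of_int (k - j)\<bar>)) * (norm (coeff_at f j) * norm (coeff_at g (k - j)))"
        by (rule mult_right_mono) auto
      thus "\<bar>real_of_int k\<bar> * (norm (coeff_at f j) * norm (coeff_at g (k - j)))
          \<le> norm (coeff_at f' j) * norm (coeff_at g' (k - j))"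
        by (simp add: f' g' mult_ac)
    qed
    finally show "\<bar>real_of_int k\<bar> * norm (coeff_at (f * g) k)
        \<le> (\<Sum>\<^sub>\<infinity>j. norm (coeff_at f' j) * norm (coeff_at g' (k - j)))" .
  qed auto
qed

lemma weighted_summable_wiener_of:
  fixes f :: "nat \<Rightarrow> complex^'q::finite^'q"
  assumes "summable (\<lambda>n. (real n + 1) * norm (f n))"
  shows "(\<lambda>j. (1 + \<bar>real_of_int j\<bar>) * norm (coeff_at (wiener_of f) j)) summable_on UNIV"
proof -
  let ?g = "\<lambda>j. (1 + \<bar>real_of_int j\<bar>) * norm (coeff_at (wiener_of f) j)"
  have f: "summable (\<lambda>n. norm (f n))"
    by (rule summable_comparison_test'[OF assms, of 0]) (auto intro!: mult_le_cancel_right1[THEN iffD2])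
  have "(\<lambda>n. (real n + 1) * norm (f n)) summable_on UNIV"
    using assms by (subst summable_on_UNIV_nonneg_real_iff) auto
  hence "(?g \<circ> int) summable_on UNIV"
    using f by (simp add: o_def coeff_at_wiener_of add.commute)
  hence "?g summable_on range int"
    by (subst summable_on_reindex) auto
  moreover have "?g j = 0" if "j \<notin> range int" for j
  proof -
    have "j < 0" using that by (metis nat_0_le not_le rangeI)
    thus ?thesis using f by (simp add: coeff_at_wiener_of)
  qed
  ultimately show ?thesis
    by (subst summable_on_cong_neutral[where T = "range int" and g = ?g]) auto
qed

section \<open>Power series of matrix functions holomorphic beyond the closed disk\<close>

lemma ball_supset_of_open:
  assumes "open S" "cball (0 :: complex) 1 \<subseteq> S"
  shows "\<exists>R>1. ball 0 R \<subseteq> S"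
proof -
  obtain e where e: "e > 0" "(\<Union>x\<in>cball 0 1. ball x e) \<subseteq> S"
    using compact_subset_open_imp_ball_epsilon_subset[OF compact_cball assms] by blast
  have "z \<in> S" if "norm z < 1 + e" for z
  proof (cases "norm z \<le> 1")
    case False
    \<comment> \<open>Outside the closed disk, z is compared with its radial projection to the
      circle.\<close>
    have "dist (z / norm z) z = norm z - 1"
    proof -
      define w where "w = z / norm z"
      have "z = of_real (norm z) * w" using False by (auto simp: w_def)
      hence "w - z = w - of_real (norm z) * w" by (rule arg_cong)
      also have "\<dots> = of_real (1 - norm z) * w" by (simp add: algebra_simps)
      finally have "z / norm z - z = of_real (1 - norm z) * (z / norm z)" by (simp only: w_def)
      hence "dist (z / norm z) z = \<bar>1 - norm z\<bar> * norm (z / norm z)"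
        by (simp only: dist_norm norm_mult norm_of_real)
      thus ?thesis using False by (auto simp: norm_divide)
    qed
    hence "z \<in> ball (z / norm z) e" using that by simp
    moreover have "z / norm z \<in> cball 0 1" by (simp add: norm_divide)
    ultimately show ?thesis using e(2) by blast
  qed (use assms(2) in auto)
  thus ?thesis using e(1) by (intro exI[of _ "1 + e"]) auto
qed

text \<open>With x = y^2 and y = t^2, two factors t^n absorb the two factors n + 1, and y^n remains
  as a convergent majorant.\<close>

lemma summable_power2_geometric:
  assumes "0 < x" "x < (1::real)"
  shows "summable (\<lambda>n. (real n + 1)\<^sup>2 * x ^ n)"
proof -
  define y where "y = sqrt x"
  have y: "0 < y" "y < 1" "x = y * y" using assms by (simp_all add: y_def)
  define t where "t = sqrt y"
  have t: "0 < t" "t < 1" "y = t * t" using y by (simp_all add: t_def)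
  have "(\<lambda>n. (real n * t ^ n + t ^ n) * (real n * t ^ n + t ^ n)) \<longlonglongrightarrow> (0 + 0) * (0 + 0)"
    using t by (intro tendsto_intros powser_times_n_limit_0 LIMSEQ_realpow_zero) auto
  moreover have "(real n * t ^ n + t ^ n) * (real n * t ^ n + t ^ n) = (real n + 1)\<^sup>2 * y ^ n" for n
    unfolding t(3) by (simp add: power_mult_distrib power2_eq_square algebra_simps)
  ultimately have "(\<lambda>n. (real n + 1)\<^sup>2 * y ^ n) \<longlonglongrightarrow> 0" by simp
  hence "Bseq (\<lambda>n. (real n + 1)\<^sup>2 * y ^ n)" by (intro convergent_imp_Bseq convergentI)
  then obtain K where K: "\<And>n. norm ((real n + 1)\<^sup>2 * y ^ n) \<le> K" by (auto simp: Bseq_def)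
  show ?thesis
  proof (rule summable_comparison_test'[of "\<lambda>n. K * y ^ n" 0])
    show "summable (\<lambda>n. K * y ^ n)" using y by (intro summable_mult summable_geometric) auto
    fix n
    have "norm ((real n + 1)\<^sup>2 * x ^ n) = norm ((real n + 1)\<^sup>2 * y ^ n) * y ^ n"
      using y by (simp add: power_mult_distrib)
    also have "\<dots> \<le> K * y ^ n" using y by (intro mult_right_mono K) auto
    finally show "norm ((real n + 1)\<^sup>2 * x ^ n) \<le> K * y ^ n" .
  qed
qed

lemma ex_power_series_cdisk:
  assumes "f holomorphic_on ball 0 R" "R > 1"
  shows "\<exists>c :: nat \<Rightarrow> complex. summable (\<lambda>n. (real n + 1)\<^sup>2 * norm (c n)) \<and>
    (\<forall>z. norm z \<le> 1 \<longrightarrow> (\<lambda>n. z ^ n * c n) sums f z)"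
proof (intro exI conjI allI impI)
  define c where "c n = (deriv ^^ n) f 0 / fact n" for n
  have sums: "(\<lambda>n. c n * z ^ n) sums f z" if "norm z < R" for z
    using holomorphic_power_series[OF assms(1), of z] that by (simp add: c_def)
  show "(\<lambda>n. z ^ n * c n) sums f z" if "norm z \<le> 1" for z
    using sums[of z] that assms(2) by (simp add: mult.commute)
  define r where "r = (1 + R) / 2"
  have r: "1 < r" "r < R" using assms(2) by (auto simp: r_def)
  have "summable (\<lambda>n. c n * of_real r ^ n)"
    using sums[of "of_real r"] r by (auto simp: sums_iff)
  hence "(\<lambda>n. c n * of_real r ^ n) \<longlonglongrightarrow> 0" by (rule summable_LIMSEQ_zero)
  hence "Bseq (\<lambda>n. c n * of_real r ^ n)" by (intro convergent_imp_Bseq convergentI)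
  then obtain K where K: "\<And>n. norm (c n * of_real r ^ n) \<le> K" by (auto simp: Bseq_def)
  have "summable (\<lambda>n. K * ((real n + 1)\<^sup>2 * (1 / r) ^ n))"
    using r by (intro summable_mult summable_power2_geometric) auto
  thus "summable (\<lambda>n. (real n + 1)\<^sup>2 * norm (c n))"
  proof (rule summable_comparison_test'[of _ 0])
    fix n
    have "norm (c n) \<le> K * (1 / r) ^ n"
      using K[of n] r by (simp add: norm_mult norm_power field_simps)
    hence "(real n + 1)\<^sup>2 * norm (c n) \<le> (real n + 1)\<^sup>2 * (K * (1 / r) ^ n)"
      by (rule mult_left_mono) simp
    thus "norm ((real n + 1)\<^sup>2 * norm (c n)) \<le> K * ((real n + 1)\<^sup>2 * (1 / r) ^ n)"
      by (simp add: mult_ac)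
  qed
qed

lemma ex_matrix_power_series_cdisk:
  fixes f :: "complex \<Rightarrow> complex^'q^'q"
  assumes "\<And>i j. (\<lambda>z. f z $ i $ j) holomorphic_on ball 0 R" "R > 1"
  shows "\<exists>c. summable (\<lambda>n. (real n + 1)\<^sup>2 * norm (c n)) \<and>
    (\<forall>z. norm z \<le> 1 \<longrightarrow> (\<lambda>n. mscale (z ^ n) (c n)) sums f z)"
proof -
  define Q where "Q i j c \<longleftrightarrow> summable (\<lambda>n. (real n + 1)\<^sup>2 * norm (c n)) \<and>
      (\<forall>z. norm z \<le> 1 \<longrightarrow> (\<lambda>n. z ^ n * c n) sums (f z $ i $ j))" for i j and c :: "nat \<Rightarrow> complex"
  have "\<exists>c. Q i j c" for i j
    unfolding Q_def by (rule ex_power_series_cdisk[OF assms])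
  then obtain c where "\<And>i j. Q i j (c i j)" by metis
  hence c: "\<And>i j. summable (\<lambda>n. (real n + 1)\<^sup>2 * norm (c i j n :: complex))"
    "\<And>i j z. norm z \<le> 1 \<Longrightarrow> (\<lambda>n. z ^ n * c i j n) sums (f z $ i $ j)"
    unfolding Q_def by blast+
  define G where "G n = (\<chi> i j. c i j n)" for n
  have norm_G: "norm (G n) \<le> (\<Sum>i\<in>UNIV. \<Sum>j\<in>UNIV. norm (c i j n))" for n
  proof -
    have "norm (G n) \<le> (\<Sum>i\<in>UNIV. norm (G n $ i))" unfolding norm_vec_def by (rule L2_set_le_sum) simp
    also have "\<dots> \<le> (\<Sum>i\<in>UNIV. \<Sum>j\<in>UNIV. norm (G n $ i $ j))"
      unfolding norm_vec_def by (intro sum_mono L2_set_le_sum) simp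
    finally show ?thesis by (simp add: G_def)
  qed
  have "summable (\<lambda>n. (real n + 1)\<^sup>2 * norm (G n))"
  proof (rule summable_comparison_test'[of "\<lambda>n. \<Sum>i\<in>UNIV. \<Sum>j\<in>UNIV. (real n + 1)\<^sup>2 * norm (c i j n)" 0])
    show "summable (\<lambda>n. \<Sum>i\<in>UNIV. \<Sum>j\<in>UNIV. (real n + 1)\<^sup>2 * norm (c i j n))"
      by (intro summable_sum c)
    fix n
    show "norm ((real n + 1)\<^sup>2 * norm (G n)) \<le> (\<Sum>i\<in>UNIV. \<Sum>j\<in>UNIV. (real n + 1)\<^sup>2 * norm (c i j n))"
      using mult_left_mono[OF norm_G[of n], of "(real n + 1)\<^sup>2"] by (simp add: sum_distrib_left)
  qed
  moreover have "(\<lambda>n. mscale (z ^ n) (G n)) sums f z" if "norm z \<le> 1" for z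
    unfolding sums_def
  proof (intro vec_tendstoI)
    fix i j
    show "(\<lambda>n. (\<Sum>n<n. mscale (z ^ n) (G n)) $ i $ j) \<longlonglongrightarrow> f z $ i $ j"
      using c(2)[OF that, of i j] by (simp add: sums_def mscale_def G_def)
  qed
  ultimately show ?thesis by blast
qed

lemma matrix_inv_inverse:
  fixes A :: "complex^'q^'q"
  assumes "det A \<noteq> 0"
  shows "A ** matrix_inv A = mat 1" and "matrix_inv A ** A = mat 1"
proof -
  have "invertible A" using assms by (simp add: invertible_det_nz)
  then obtain B where "A ** B = mat 1 \<and> B ** A = mat 1" unfolding invertible_def by blast
  hence "A ** matrix_inv A = mat 1 \<and> matrix_inv A ** A = mat 1"
    unfolding matrix_inv_def by (rule someI)
  thus "A ** matrix_inv A = mat 1" "matrix_inv A ** A = mat 1" by auto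
qed

text \<open>Cramer's rule makes the entries of the inverse quotients of determinants, hence
  holomorphic wherever the entries are and the determinant does not vanish.\<close>

lemma matrix_inv_component:
  fixes A :: "complex^'q^'q"
  assumes "det A \<noteq> 0"
  shows "matrix_inv A $ k $ j = det (\<chi> i l. if l = k then axis j 1 $ i else A $ i $ l) / det A"
proof -
  let ?x = "matrix_inv A *v axis j 1"
  have "A *v ?x = axis j 1"
    using assms by (simp add: matrix_vector_mul_assoc matrix_inv_inverse)
  hence "?x = (\<chi> k. det (\<chi> i l. if l = k then axis j 1 $ i else A $ i $ l) / det A)"
    using cramer[OF assms] by blast
  moreover have "?x $ k = matrix_inv A $ k $ j"
    by (simp add: matrix_vector_mult_def axis_def if_distrib[of "(*) _"] cong: if_cong)
  ultimately show ?thesis by simp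
qed

lemma holomorphic_on_det:
  fixes f :: "complex \<Rightarrow> complex^'q^'q"
  assumes "\<And>i j. (\<lambda>z. f z $ i $ j) holomorphic_on S"
  shows "(\<lambda>z. det (f z)) holomorphic_on S"
  unfolding det_def by (intro holomorphic_intros assms)

text \<open>Finitely many open sets, one for each entry, are intersected and the zeros of the
  determinant removed. The result is still open and contains the closed disk, so one radius R > 1
  serves all entries of g and of its inverse.\<close>

lemma rational_invertible_cdisk_holomorphic:
  fixes g :: "complex \<Rightarrow> complex^'q^'q"
  assumes "rational_invertible_cdisk g"
  shows "\<exists>R>1. (\<forall>i j. (\<lambda>z. g z $ i $ j) holomorphic_on ball 0 R) \<and>
    (\<forall>i j. (\<lambda>z. matrix_inv (g z) $ i $ j) holomorphic_on ball 0 R)"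
proof -
  have "\<exists>S. open S \<and> cball 0 1 \<subseteq> S \<and> (\<lambda>z. g z $ i $ j) holomorphic_on S" for i j
  proof -
    obtain p r :: "complex poly" where pr: "\<And>z. poly r z \<noteq> 0 \<Longrightarrow> g z $ i $ j = poly p z / poly r z"
      "\<And>z. norm z \<le> 1 \<Longrightarrow> poly r z \<noteq> 0"
      using assms unfolding rational_invertible_cdisk_def rational_no_poles_cdisk_def by blast
    have "open {z. poly r z \<noteq> 0}"
      by (intro open_Collect_neq continuous_intros)
    moreover have "(\<lambda>z. poly p z / poly r z) holomorphic_on {z. poly r z \<noteq> 0}"
      by (intro holomorphic_intros) auto
    hence "(\<lambda>z. g z $ i $ j) holomorphic_on {z. poly r z \<noteq> 0}"
      by (rule holomorphic_transform) (auto simp: pr(1))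
    ultimately show ?thesis using pr(2) by (intro exI[of _ "{z. poly r z \<noteq> 0}"]) auto
  qed
  then obtain S where S: "\<And>i j. open (S i j)" "\<And>i j. cball 0 1 \<subseteq> S i j"
    "\<And>i j. (\<lambda>z. g z $ i $ j) holomorphic_on S i j" by metis
  define U where "U = (\<Inter>i. \<Inter>j. S i j)"
  have U: "open U" "cball 0 1 \<subseteq> U"
    unfolding U_def by (intro open_INT ballI S finite INT_greatest)+
  have hol: "\<And>i j. (\<lambda>z. g z $ i $ j) holomorphic_on U"
    by (rule holomorphic_on_subset[OF S(3)]) (auto simp: U_def)
  have det: "(\<lambda>z. det (g z)) holomorphic_on U" by (rule holomorphic_on_det[OF hol])
  define V where "V = {z\<in>U. det (g z) \<noteq> 0}"
  have "V = U \<inter> (\<lambda>z. det (g z)) -` (- {0})" by (auto simp: V_def)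
  hence "open V"
    using continuous_open_preimage[OF holomorphic_on_imp_continuous_on[OF det] U(1), of "- {0}"]
    by (simp add: open_Compl)
  moreover have "cball 0 1 \<subseteq> V"
    using U assms by (auto simp: V_def rational_invertible_cdisk_def)
  ultimately obtain R where R: "R > 1" "ball 0 R \<subseteq> V" using ball_supset_of_open by blast
  have "(\<lambda>z. matrix_inv (g z) $ i $ j) holomorphic_on V" for i j
  proof (rule holomorphic_transform)
    show "(\<lambda>z. det (\<chi> k l. if l = i then axis j 1 $ k else g z $ k $ l) / det (g z)) holomorphic_on V"
    proof (intro holomorphic_on_divide holomorphic_on_det)
      show "(\<lambda>z. (\<chi> k l. if l = i then axis j 1 $ k else g z $ k $ l) $ k $ l) holomorphic_on V" for k l
        by (cases "l = i") (auto intro: holomorphic_on_subset[OF hol] simp: V_def)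
      show "(\<lambda>z. g z $ i $ j) holomorphic_on V" for i j
        by (rule holomorphic_on_subset[OF hol]) (auto simp: V_def)
    qed (auto simp: V_def)
    show "det (\<chi> k l. if l = i then axis j 1 $ k else g z $ k $ l) / det (g z) = matrix_inv (g z) $ i $ j"
      if "z \<in> V" for z
      using that by (simp add: V_def matrix_inv_component)
  qed
  moreover have "(\<lambda>z. g z $ i $ j) holomorphic_on ball 0 R" for i j
    by (rule holomorphic_on_subset[OF hol]) (use R in \<open>auto simp: V_def\<close>)
  ultimately show ?thesis using R by (intro exI[of _ R]) (auto intro: holomorphic_on_subset)
qed

lemma rational_invertible_cdisk_power_series:
  fixes g :: "complex \<Rightarrow> complex^'q^'q"
  assumes "rational_invertible_cdisk g"
  shows "\<exists>c. summable (\<lambda>n. (real n + 1)\<^sup>2 * norm (c n)) \<and>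
      (\<forall>z. norm z \<le> 1 \<longrightarrow> (\<lambda>n. mscale (z ^ n) (c n)) sums g z)"
    and "\<exists>c. summable (\<lambda>n. (real n + 1)\<^sup>2 * norm (c n)) \<and>
      (\<forall>z. norm z \<le> 1 \<longrightarrow> (\<lambda>n. mscale (z ^ n) (c n)) sums matrix_inv (g z))"
proof -
  obtain R where R: "R > 1" "\<And>i j. (\<lambda>z. g z $ i $ j) holomorphic_on ball 0 R"
    "\<And>i j. (\<lambda>z. matrix_inv (g z) $ i $ j) holomorphic_on ball 0 R"
    using rational_invertible_cdisk_holomorphic[OF assms] by blast
  show "\<exists>c. summable (\<lambda>n. (real n + 1)\<^sup>2 * norm (c n)) \<and>
      (\<forall>z. norm z \<le> 1 \<longrightarrow> (\<lambda>n. mscale (z ^ n) (c n)) sums g z)"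
    by (rule ex_matrix_power_series_cdisk[OF R(2,1)])
  show "\<exists>c. summable (\<lambda>n. (real n + 1)\<^sup>2 * norm (c n)) \<and>
      (\<forall>z. norm z \<le> 1 \<longrightarrow> (\<lambda>n. mscale (z ^ n) (c n)) sums matrix_inv (g z))"
    by (rule ex_matrix_power_series_cdisk[OF R(3,1)])
qed

section \<open>Fractional powers\<close>

lemma gbinomial_Suc_ratio: "(a gchoose Suc n) = (a gchoose n) * (a - real n) / (real n + 1)"
  using gbinomial_mult_1[of a n] by (simp add: field_simps)

lemma one_minus_le_powr:
  fixes a x :: real
  assumes "0 \<le> x" "0 \<le> a"
  shows "1 - a * x \<le> (1 + x) powr (- a)"
proof -
  have "1 - a * x \<le> 1 - a * ln (1 + x)"
    using assms ln_add_one_self_le_self[of x] by (simp add: mult_left_mono)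
  also have "\<dots> \<le> exp (- (a * ln (1 + x)))" using exp_ge_add_one_self[of "- (a * ln (1 + x))"] by simp
  finally show ?thesis using assms by (simp add: powr_def)
qed

text \<open>The ratio of consecutive coefficients is at most 1 - b/(n + 1), hence at most ((n +
  2)/(n + 1))^(-b), which is exactly the ratio of the claimed bounds.\<close>

lemma abs_gbinomial_step:
  fixes a b :: real
  assumes "\<bar>a gchoose n\<bar> \<le> C * (real n + 1) powr (- b)" "\<bar>a - real n\<bar> \<le> real n + 1 - b" "0 \<le> b"
  shows "\<bar>a gchoose Suc n\<bar> \<le> C * (real (Suc n) + 1) powr (- b)"
proof -
  have C: "0 \<le> C * (real n + 1) powr (- b)" using order_trans[OF abs_ge_zero assms(1)] .
  have "\<bar>a - real n\<bar> / (real n + 1) \<le> (real n + 1 - b) / (real n + 1)"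
    using assms(2) by (intro divide_right_mono) auto
  also have "\<dots> = 1 - b * (1 / (real n + 1))" by (simp add: diff_divide_distrib)
  also have "\<dots> \<le> (1 + 1 / (real n + 1)) powr (- b)" by (rule one_minus_le_powr) (use assms in auto)
  finally have r: "\<bar>a - real n\<bar> / (real n + 1) \<le> (1 + 1 / (real n + 1)) powr (- b)" .
  have "\<bar>a gchoose Suc n\<bar> = \<bar>a gchoose n\<bar> * (\<bar>a - real n\<bar> / (real n + 1))"
    unfolding gbinomial_Suc_ratio by (simp add: abs_mult)
  also have "\<dots> \<le> (C * (real n + 1) powr (- b)) * (1 + 1 / (real n + 1)) powr (- b)"
    using C by (intro mult_mono assms(1) r) auto
  also have "\<dots> = C * ((real n + 1) * (1 + 1 / (real n + 1))) powr (- b)"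
    by (simp add: powr_mult)
  also have "(real n + 1) * (1 + 1 / (real n + 1)) = real (Suc n) + 1" by (simp add: field_simps)
  finally show ?thesis .
qed

lemma abs_gbinomial_neg_le:
  fixes d :: real
  assumes "0 < d" "d < 1"
  shows "\<bar>- d gchoose n\<bar> \<le> (real n + 1) powr (- (1 - d))"
proof (induction n)
  case (Suc n)
  thus ?case using abs_gbinomial_step[of "- d" n 1 "1 - d"] assms by simp
qed simp

text \<open>The step with b = 1 + d requires n - d = |d - n| and so is valid only from n = 1 on. The
  factor 4 is a bound for 2^(1 + d), which settles the coefficient of index 1.\<close>

lemma abs_gbinomial_pos_le:
  fixes d :: real
  assumes "0 < d" "d < 1"
  shows "\<bar>d gchoose n\<bar> \<le> 4 * (real n + 1) powr (- (1 + d))"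
proof (induction n)
  case (Suc n)
  show ?case
  proof (cases "n = 0")
    case True
    have "(2 :: real) powr (1 + d) \<le> 2 powr 2" using assms by (intro powr_mono) auto
    hence "(2 :: real) powr (1 + d) * 2 powr (- (1 + d)) \<le> 4 * 2 powr (- (1 + d))"
      by (intro mult_right_mono) auto
    also have "(2 :: real) powr (1 + d) * 2 powr (- (1 + d)) = 1" by (simp flip: powr_add)
    finally have "1 \<le> 4 * (2 :: real) powr (- (1 + d))" .
    thus ?thesis using True assms by simp
  next
    case False
    thus ?thesis using abs_gbinomial_step[of d n 4 "1 + d"] Suc.IH assms by simp
  qed
qed simp

text \<open>The Taylor coefficients of (1 - rz)^a times the identity matrix.\<close>

definition bseq :: "real \<Rightarrow> real \<Rightarrow> nat \<Rightarrow> complex^'q^'q" where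
  "bseq a r n = mscale (of_real ((- r) ^ n * (a gchoose n))) (mat 1)"

lemma norm_bseq_le:
  assumes "\<bar>a gchoose n\<bar> \<le> B" "0 \<le> r"
  shows "norm (bseq a r n :: complex^'q^'q) \<le> B * norm (mat 1 :: complex^'q^'q) * r ^ n"
proof -
  have "norm (bseq a r n :: complex^'q^'q) = \<bar>a gchoose n\<bar> * norm (mat 1 :: complex^'q^'q) * r ^ n"
    using assms(2) by (simp add: bseq_def norm_mscale norm_mult norm_power)
  also have "\<dots> \<le> B * norm (mat 1 :: complex^'q^'q) * r ^ n"
    using assms by (intro mult_right_mono) auto
  finally show ?thesis .
qed

lemma summable_bseq:
  assumes "\<And>n. \<bar>a gchoose n\<bar> \<le> B" "0 < r" "r < 1"
  shows "summable (\<lambda>n. (real n + 1) * norm (bseq a r n :: complex^'q^'q))"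
    and "summable (\<lambda>n. norm (bseq a r n :: complex^'q^'q))"
proof -
  let ?K = "B * norm (mat 1 :: complex^'q^'q)"
  have s: "summable (\<lambda>n. ?K * ((real n + 1)\<^sup>2 * r ^ n))"
    by (intro summable_mult summable_power2_geometric assms)
  have B: "0 \<le> ?K" using order_trans[OF abs_ge_zero assms(1)] by simp
  show "summable (\<lambda>n. (real n + 1) * norm (bseq a r n :: complex^'q^'q))"
  proof (rule summable_comparison_test'[OF s, of 0])
    fix n
    have "(real n + 1) * norm (bseq a r n :: complex^'q^'q) \<le> (real n + 1)\<^sup>2 * (?K * r ^ n)"
      using assms(2) B by (intro mult_mono norm_bseq_le assms) (auto simp: power2_eq_square)
    thus "norm ((real n + 1) * norm (bseq a r n :: complex^'q^'q)) \<le> ?K * ((real n + 1)\<^sup>2 * r ^ n)"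
      by (simp add: mult_ac)
  qed
  thus "summable (\<lambda>n. norm (bseq a r n :: complex^'q^'q))"
    by (rule summable_comparison_test'[of _ 0]) (auto intro!: mult_le_cancel_right1[THEN iffD2])
qed

text \<open>The hypothesis covers both applications: r < 1 on the circle, and r = 1 inside the
  disk.\<close>

lemma sums_bseq:
  assumes "norm (of_real r * z) < 1"
  shows "(\<lambda>n. mscale (z ^ n) (bseq a r n)) sums mscale ((1 - of_real r * z) powr of_real a) (mat 1 :: complex^'q^'q)"
proof -
  have "(\<lambda>n. (of_real a gchoose n) * (- of_real r * z) ^ n) sums (1 + - of_real r * z) powr of_real a"
    using assms by (intro gen_binomial_complex) simp
  moreover have "(of_real a gchoose n) * (- of_real r * z) ^ n = z ^ n * of_real ((- r) ^ n * (a gchoose n))" for n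
  proof -
    have "(of_real a gchoose n) = (of_real (a gchoose n) :: complex)"
      using pochhammer_of_real[of "- a" n, where ?'a = complex] by (simp add: gbinomial_pochhammer)
    moreover have "(- of_real r * z) ^ n = z ^ n * of_real ((- r) ^ n)"
      by (simp only: power_mult_distrib of_real_power of_real_minus mult.commute)
    ultimately show ?thesis by simp
  qed
  ultimately have "(\<lambda>n. z ^ n * of_real ((- r) ^ n * (a gchoose n))) sums (1 - of_real r * z) powr of_real a"
    by simp
  from bounded_linear.sums[OF mscale.bounded_linear_left[of "mat 1"] this]
  show ?thesis by (simp add: bseq_def)
qed

text \<open>Here z is 1 - r\<zeta>. The moduli of the two powers cancel and v has argument 2d arg z,
  while arg z is less than \<pi>/2 in modulus because z lies in the right half-plane.\<close>

lemma powr_phase: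
  fixes z :: complex
  assumes "0 < Re z" "0 < d" "d < 1/2"
  defines "v \<equiv> cnj (z powr of_real (- d)) * z powr of_real d"
  shows "norm v = 1" and "cos (pi * d) \<le> Re v"
proof -
  have z: "z \<noteq> 0" using assms(1) by auto
  have "v = exp (of_real d * (Ln z - cnj (Ln z)))"
    using z by (simp add: v_def powr_def exp_cnj algebra_simps flip: exp_add)
  also have "of_real d * (Ln z - cnj (Ln z)) = \<i> * of_real (2 * d * Im (Ln z))"
    by (simp add: complex_eq_iff)
  finally have v: "v = cis (2 * d * Im (Ln z))" by (simp add: cis_conv_exp)
  show "norm v = 1" by (simp add: v)
  have "\<bar>Im (Ln z)\<bar> < pi / 2" using Re_Ln_pos_lt[OF z] assms(1) by simp
  hence "2 * d * \<bar>Im (Ln z)\<bar> \<le> 2 * d * (pi / 2)" using assms by (intro mult_left_mono) auto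
  moreover have "pi * d \<le> pi" using assms by simp
  ultimately have "cos (pi * d) \<le> cos (2 * d * \<bar>Im (Ln z)\<bar>)"
    using assms by (intro cos_monotone_0_pi_le) (auto simp: mult_ac)
  also have "\<dots> = cos \<bar>2 * d * Im (Ln z)\<bar>" using assms by (simp add: abs_mult)
  finally show "cos (pi * d) \<le> Re v" by (simp add: v cos_abs_real)
qed

text \<open>With \<open>\<eta> = A\<^sup>* B\<^sup>-\<^sup>1 V\<close>, which has the norm of \<open>V\<close>, the matrix on the left
  is \<open>(v - c A\<^sup>* A) \<eta>\<close>; the real part of \<open>v\<close> being bounded below makes this a strict contraction
  for small \<open>c\<close>.\<close>

lemma norm_phase_correction_le:
  fixes A Ai B Bi V :: "complex^'q^'q"
  assumes AB: "A ** hermitian_conj A = hermitian_conj B ** B"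
    and inv: "Ai ** A = mat 1" "B ** Bi = mat 1"
    and v: "norm v = 1" "\<delta> \<le> Re v" and \<delta>: "0 \<le> \<delta>"
    and M: "norm A \<le> M" "0 < M" and L: "norm Ai \<le> L" "0 < L"
  shows "(norm ((mscale v (hermitian_conj A ** Bi) - (\<delta> / M\<^sup>2) *\<^sub>R (hermitian_conj A ** hermitian_conj B)) ** V))\<^sup>2
    \<le> (1 - \<delta>\<^sup>2 / (M * L)\<^sup>2) * (norm V)\<^sup>2"
proof -
  \<comment> \<open>The minimizer of c^2 M^2 - 2c\<delta>, with minimum -\<delta>^2 / M^2.\<close>
  define c where "c = \<delta> / M\<^sup>2"
  define y where "y = Bi ** V"
  define \<eta> where "\<eta> = hermitian_conj A ** y"
  let ?A' = "hermitian_conj A"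
  have By: "B ** y = V" by (simp add: y_def matrix_mul_assoc inv)
  \<comment> \<open>The two factorizations of the symbol enter here: they turn the anti-analytic
    correction, applied to V, into a multiple of the positive matrix A^H A applied to
    \<eta>.\<close>
  have "hermitian_conj B ** V = (hermitian_conj B ** B) ** y"
    by (simp add: By flip: matrix_mul_assoc)
  also have "\<dots> = A ** \<eta>" by (simp add: \<eta>_def AB[symmetric] flip: matrix_mul_assoc)
  finally have BV: "hermitian_conj B ** V = A ** \<eta>" .
  have eq: "(mscale v (?A' ** Bi) - c *\<^sub>R (?A' ** hermitian_conj B)) ** V
      = mscale v \<eta> - c *\<^sub>R (?A' ** (A ** \<eta>))"
    by (simp add: mmult.diff_left mscale_mult_left mmult.scaleR_left \<eta>_def y_def BV[unfolded \<eta>_def y_def]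
        flip: matrix_mul_assoc)
  have "\<eta> \<bullet> \<eta> = y \<bullet> ((A ** ?A') ** y)"
    by (simp add: \<eta>_def inner_matrix_mult_left flip: matrix_mul_assoc)
  also have "\<dots> = V \<bullet> V"
    unfolding AB By[symmetric] by (simp add: inner_matrix_mult_left flip: matrix_mul_assoc)
  finally have n\<eta>: "(norm \<eta>)\<^sup>2 = (norm V)\<^sup>2" by (simp add: power2_norm_eq_inner)
  have "mscale v \<eta> \<bullet> (?A' ** (A ** \<eta>)) = (A ** mscale v \<eta>) \<bullet> (A ** \<eta>)"
    by (simp add: inner_matrix_mult_left)
  also have "\<dots> = Re v * (norm (A ** \<eta>))\<^sup>2"
  proof -
    have "mscale v X \<bullet> X = Re v * (norm X)\<^sup>2" for X :: "complex^'q^'q"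
      unfolding norm_matrix_power2
      by (simp add: mscale_def inner_vec_def inner_complex_def sum_distrib_left cmod_power2)
        (simp add: power2_eq_square algebra_simps)
    thus ?thesis by (simp add: mscale_mult_right)
  qed
  finally have ip: "mscale v \<eta> \<bullet> (?A' ** (A ** \<eta>)) = Re v * (norm (A ** \<eta>))\<^sup>2" .
  have "norm (?A' ** (A ** \<eta>)) \<le> M * norm (A ** \<eta>)"
    by (rule order_trans[OF norm_matrix_mult_le]) (simp add: M mult_right_mono)
  hence AA: "(norm (?A' ** (A ** \<eta>)))\<^sup>2 \<le> M\<^sup>2 * (norm (A ** \<eta>))\<^sup>2"
    using power_mono[of _ _ 2] by (fastforce simp: power_mult_distrib)
  \<comment> \<open>Invertibility of A bounds A\<eta> from below, which makes the gain a fixed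
    proportion of the norm of \<eta>.\<close>
  have "norm \<eta> = norm (Ai ** (A ** \<eta>))" by (simp add: matrix_mul_assoc inv)
  also have "\<dots> \<le> L * norm (A ** \<eta>)"
    by (rule order_trans[OF norm_matrix_mult_le]) (simp add: L mult_right_mono)
  finally have "(norm \<eta>)\<^sup>2 \<le> L\<^sup>2 * (norm (A ** \<eta>))\<^sup>2"
    using power_mono[of "norm \<eta>" _ 2] by (fastforce simp: power_mult_distrib)
  hence low: "(norm \<eta>)\<^sup>2 / L\<^sup>2 \<le> (norm (A ** \<eta>))\<^sup>2" using L by (simp add: field_simps)
  have "(norm (mscale v \<eta> - c *\<^sub>R (?A' ** (A ** \<eta>))))\<^sup>2
      = (norm \<eta>)\<^sup>2 - 2 * c * (Re v * (norm (A ** \<eta>))\<^sup>2) + c\<^sup>2 * (norm (?A' ** (A ** \<eta>)))\<^sup>2"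
  proof -
    have "(norm (X - c *\<^sub>R Y))\<^sup>2 = (norm X)\<^sup>2 - 2 * c * (X \<bullet> Y) + c\<^sup>2 * (norm Y)\<^sup>2"
      for X Y :: "complex^'q^'q"
      unfolding power2_norm_eq_inner
      by (simp add: inner_diff_left inner_diff_right inner_commute power2_eq_square algebra_simps)
    thus ?thesis by (simp only: ip) (simp add: norm_mscale v)
  qed
  also have "\<dots> \<le> (norm \<eta>)\<^sup>2 - 2 * c * (\<delta> * (norm (A ** \<eta>))\<^sup>2) + c\<^sup>2 * (M\<^sup>2 * (norm (A ** \<eta>))\<^sup>2)"
    using AA v \<delta> M by (intro add_mono diff_mono mult_left_mono mult_right_mono) (auto simp: c_def)
  also have "\<dots> = (norm \<eta>)\<^sup>2 - \<delta>\<^sup>2 / M\<^sup>2 * (norm (A ** \<eta>))\<^sup>2"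
    using M by (simp add: c_def field_simps power2_eq_square)
  also have "\<dots> \<le> (norm \<eta>)\<^sup>2 - \<delta>\<^sup>2 / M\<^sup>2 * ((norm \<eta>)\<^sup>2 / L\<^sup>2)"
    by (intro diff_mono mult_left_mono low) auto
  also have "\<dots> = (1 - \<delta>\<^sup>2 / (M * L)\<^sup>2) * (norm V)\<^sup>2"
    by (simp add: n\<eta> power_mult_distrib algebra_simps)
  finally have "(norm (mscale v \<eta> - c *\<^sub>R (?A' ** (A ** \<eta>))))\<^sup>2 \<le> (1 - \<delta>\<^sup>2 / (M * L)\<^sup>2) * (norm V)\<^sup>2" .
  thus ?thesis unfolding eq[symmetric] by (simp only: c_def)
qed

definition weighted_norm :: "(nat \<Rightarrow> complex^'q^'q) \<Rightarrow> real" where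
  "weighted_norm c = (\<Sum>n. (real n + 1)\<^sup>2 * norm (c n))"

definition power_series_on_cdisk :: "(nat \<Rightarrow> complex^'q^'q) \<Rightarrow> (complex \<Rightarrow> complex^'q^'q) \<Rightarrow> bool" where
  "power_series_on_cdisk c f \<longleftrightarrow> summable (\<lambda>n. (real n + 1)\<^sup>2 * norm (c n)) \<and>
     (\<forall>z. norm z \<le> 1 \<longrightarrow> (\<lambda>n. mscale (z ^ n) (c n)) sums f z)"

lemma power_series_summable:
  assumes "power_series_on_cdisk c f"
  shows "summable (\<lambda>n. norm (c n))" "summable (\<lambda>n. (real n + 1) * norm (c n))"
proof -
  have s: "summable (\<lambda>n. (real n + 1)\<^sup>2 * norm (c n))"
    using assms by (simp add: power_series_on_cdisk_def)
  show "summable (\<lambda>n. (real n + 1) * norm (c n))"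
    by (rule summable_comparison_test'[OF s, of 0])
       (auto simp: power2_eq_square intro!: mult_right_mono mult_le_cancel_right1[THEN iffD2])
  thus "summable (\<lambda>n. norm (c n))"
    by (rule summable_comparison_test'[of _ 0]) (auto intro!: mult_le_cancel_right1[THEN iffD2])
qed

lemma weighted_norm_nonneg: "power_series_on_cdisk c f \<Longrightarrow> 0 \<le> weighted_norm c"
  by (simp add: weighted_norm_def power_series_on_cdisk_def suminf_nonneg)

lemma power_series_ev:
  fixes c :: "nat \<Rightarrow> complex^'q^'q"
  assumes "power_series_on_cdisk c f"
  shows "ev (wiener_of c) \<theta> = f (cis \<theta>)"
proof (rule ev_wiener_of)
  show "summable (\<lambda>n. norm (c n))" by (rule power_series_summable(1)[OF assms])
  show "(\<lambda>n. mscale (cis \<theta> ^ n) (c n)) sums f (cis \<theta>)"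
    using assms by (simp add: power_series_on_cdisk_def)
qed

text \<open>The Fourier series of (1 - rz)^a f(z), where c are the coefficients of f. With a = -d it
  gives h and k, with a = d and the inverse of f it gives hi and ki.\<close>

definition frac_factor :: "real \<Rightarrow> real \<Rightarrow> (nat \<Rightarrow> complex^'q^'q) \<Rightarrow> 'q::finite wiener" where
  "frac_factor a r c = wiener_of (bseq a r) * wiener_of c"

context
  fixes a B r :: real
  assumes bdd: "\<And>n. \<bar>a gchoose n\<bar> \<le> B" and r: "0 < r" "r < 1"
begin

lemma ev_frac_factor:
  fixes c :: "nat \<Rightarrow> complex^'q^'q"
  assumes "power_series_on_cdisk c f"
  shows "ev (frac_factor a r c) \<theta> = mscale ((1 - of_real r * cis \<theta>) powr of_real a) (f (cis \<theta>))"
proof -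
  have "ev (wiener_of (bseq a r) :: 'q wiener) \<theta> = mscale ((1 - of_real r * cis \<theta>) powr of_real a) (mat 1)"
    using r by (intro ev_wiener_of summable_bseq(2)[OF bdd r] sums_bseq) (simp add: norm_mult)
  thus ?thesis by (simp add: frac_factor_def ev_mult power_series_ev[OF assms] mscale_mult_left)
qed

lemma supported_frac_factor:
  assumes "power_series_on_cdisk c f"
  shows "supported {0..} (frac_factor a r c)"
  unfolding frac_factor_def
  by (rule supported_mult[OF supported_wiener_of[OF summable_bseq(2)[OF bdd r]]
        supported_wiener_of[OF power_series_summable(1)[OF assms]]]) auto

text \<open>The powers of r are simply bounded by 1, so the estimate is uniform in r and survives
  the limit.\<close>

lemma norm_coeff_frac_factor_le:
  fixes c :: "nat \<Rightarrow> complex^'q^'q"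
  assumes c: "power_series_on_cdisk c f" and b: "\<And>n. \<bar>a gchoose n\<bar> \<le> C * (real n + 1) powr (- \<sigma>)"
    and \<sigma>: "0 \<le> \<sigma>" "\<sigma> \<le> 2" and "0 \<le> j"
  shows "norm (coeff_at (frac_factor a r c) j) \<le> C * norm (mat 1 :: complex^'q^'q) * weighted_norm c * (real_of_int j + 1) powr (- \<sigma>)"
proof -
  have "norm (bseq a r i :: complex^'q^'q) \<le> C * norm (mat 1 :: complex^'q^'q) * (real i + 1) powr (- \<sigma>)" for i
  proof -
    have "norm (bseq a r i :: complex^'q^'q)
        \<le> C * (real i + 1) powr (- \<sigma>) * norm (mat 1 :: complex^'q^'q) * r ^ i"
      by (rule norm_bseq_le[OF b]) (use r in simp)
    also have "\<dots> \<le> C * (real i + 1) powr (- \<sigma>) * norm (mat 1 :: complex^'q^'q) * 1"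
      using r order_trans[OF abs_ge_zero b[of i]] by (intro mult_left_mono power_le_one) auto
    finally show ?thesis by (simp add: mult_ac)
  qed
  from norm_coeff_wiener_of_mult_le[OF this summable_bseq(2)[OF bdd r] _ \<sigma>, of c "nat j"] c \<open>0 \<le> j\<close>
  show ?thesis by (simp add: frac_factor_def weighted_norm_def power_series_on_cdisk_def)
qed

lemma weighted_summable_frac_factor:
  assumes "power_series_on_cdisk c f"
  shows "(\<lambda>j. \<bar>real_of_int j\<bar> * norm (coeff_at (frac_factor a r c) j)) summable_on UNIV"
  unfolding frac_factor_def
  by (intro weighted_summable_mult weighted_summable_wiener_of summable_bseq(1)[OF bdd r] power_series_summable(2)[OF assms])

end

locale toeplitz_symbol =
  fixes d :: real and g gs :: "complex \<Rightarrow> complex^'q::finite^'q" and G Gi Gs Gsi :: "nat \<Rightarrow> complex^'q^'q"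
  assumes d: "0 < d" "d < 1/2"
    and ps: "power_series_on_cdisk G g" "power_series_on_cdisk Gi (\<lambda>z. matrix_inv (g z))"
      "power_series_on_cdisk Gs gs" "power_series_on_cdisk Gsi (\<lambda>z. matrix_inv (gs z))"
    and det: "\<And>z. norm z \<le> 1 \<Longrightarrow> det (g z) \<noteq> 0" "\<And>z. norm z \<le> 1 \<Longrightarrow> det (gs z) \<noteq> 0"
    and factorizations: "\<And>\<zeta>. norm \<zeta> = 1 \<Longrightarrow> g \<zeta> ** hermitian_conj (g \<zeta>) = hermitian_conj (gs \<zeta>) ** gs \<zeta>"
begin

text \<open>None of these constants involves r. M and L bound g and its inverse on the circle; being
  at least 1 they keep the radicand of RHO nonnegative. \<delta> is the lower bound from
  \<open>powr_phase\<close>, and RHO^2 is the factor in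
  \<open>norm_phase_correction_le\<close>.\<close>

definition "CA = 4 * norm (mat 1 :: complex^'q^'q) * (weighted_norm Gi + weighted_norm Gsi)"
definition "CC = norm (mat 1 :: complex^'q^'q) * weighted_norm G"
definition "M = 1 + norm (wiener_of G)"
definition "L = 1 + norm (wiener_of Gi)"
definition "\<delta> = cos (pi * d)"
definition "RHO = sqrt (1 - \<delta>\<^sup>2 / (M * L)\<^sup>2)"

lemma gbinomial_bdd:
  "\<bar>d gchoose n\<bar> \<le> 4 * (real n + 1) powr (- (1 + d))" "\<bar>- d gchoose n\<bar> \<le> 1 * (real n + 1) powr (- (1 - d))"
  "\<bar>d gchoose n\<bar> \<le> 4" "\<bar>- d gchoose n\<bar> \<le> 4"
proof -
  show 1: "\<bar>d gchoose n\<bar> \<le> 4 * (real n + 1) powr (- (1 + d))"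
    using abs_gbinomial_pos_le[of d n] d by simp
  show 2: "\<bar>- d gchoose n\<bar> \<le> 1 * (real n + 1) powr (- (1 - d))"
    using abs_gbinomial_neg_le[of d n] d by simp
  have "(real n + 1) powr (- (1 + d)) \<le> 1" "(real n + 1) powr (- (1 - d)) \<le> 1"
    using d powr_mono[of "- (1 + d)" 0 "real n + 1"] powr_mono[of "- (1 - d)" 0 "real n + 1"] by simp_all
  thus "\<bar>d gchoose n\<bar> \<le> 4" "\<bar>- d gchoose n\<bar> \<le> 4" using 1 2 by linarith+
qed

lemma delta_RHO: "0 < \<delta>" "\<delta> \<le> 1" "1 \<le> M" "1 \<le> L" "0 \<le> RHO" "RHO < 1" "RHO\<^sup>2 = 1 - \<delta>\<^sup>2 / (M * L)\<^sup>2"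
proof -
  have "0 < pi * d" "pi * d < pi * (1/2)" using d by (auto intro!: mult_strict_left_mono)
  thus \<delta>: "0 < \<delta>" "\<delta> \<le> 1" unfolding \<delta>_def by (auto intro!: cos_gt_zero)
  show M1: "1 \<le> M" "1 \<le> L" by (simp_all add: M_def L_def)
  have "1 * 1 \<le> M * L" using M1 by (intro mult_mono) auto
  hence "\<delta>\<^sup>2 \<le> (M * L)\<^sup>2" using \<delta> by (intro power_mono) auto
  moreover have "0 < (M * L)\<^sup>2" using M1 by simp
  ultimately have q: "0 < \<delta>\<^sup>2 / (M * L)\<^sup>2" "\<delta>\<^sup>2 / (M * L)\<^sup>2 \<le> 1" using \<delta> by simp_all
  show "0 \<le> RHO" "RHO < 1" "RHO\<^sup>2 = 1 - \<delta>\<^sup>2 / (M * L)\<^sup>2" using q by (simp_all add: RHO_def)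
qed

context
  fixes r :: real
  assumes r: "0 < r" "r < 1"
begin

lemma one_minus_r_cis: "1 - of_real r * cis \<theta> \<noteq> 0" "0 < Re (1 - of_real r * cis \<theta>)"
proof -
  have "r * cos \<theta> \<le> r * 1" using r by (intro mult_left_mono) auto
  hence "0 < 1 - r * cos \<theta>" using r by linarith
  thus pos: "0 < Re (1 - of_real r * cis \<theta>)" by simp
  show "1 - of_real r * cis \<theta> \<noteq> 0"
  proof
    assume "1 - of_real r * cis \<theta> = 0"
    thus False using pos by (simp only:) simp
  qed
qed

lemma frac_factor_inverse:
  assumes "power_series_on_cdisk c f" "power_series_on_cdisk ci (\<lambda>z. matrix_inv (f z))"
    and "\<And>z. norm z \<le> 1 \<Longrightarrow> det (f z) \<noteq> 0"
  shows "frac_factor (- d) r c * frac_factor d r ci = 1" "frac_factor d r ci * frac_factor (- d) r c = 1"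
  using r one_minus_r_cis assms(3)
  by (auto intro!: ev_eqI simp: ev_mult ev_frac_factor[OF gbinomial_bdd(3) r assms(2)]
      ev_frac_factor[OF gbinomial_bdd(4) r assms(1)] mscale_mult_left mscale_mult_right matrix_inv_inverse
      simp flip: powr_add)

text \<open>The approximant is a multiple of g^H gs^H, a product of adjoints of analytic functions.
  It is built from the rational factors alone and so is the same for every r.\<close>

lemma contraction:
  "\<exists>P. supported {..0} P \<and> (\<forall>\<theta> (V :: complex^'q^'q).
      norm (ev (star (frac_factor (- d) r G) * frac_factor d r Gsi - P) \<theta> ** V) \<le> RHO * norm V)"
proof (intro exI conjI allI)
  let ?P = "(\<delta> / M\<^sup>2) *\<^sub>R (star (wiener_of G) * star (wiener_of Gs))"
  have s: "supported {..0} (star (wiener_of G))" "supported {..0} (star (wiener_of Gs))"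
    using supported_star[OF supported_wiener_of[OF power_series_summable(1)[OF ps(1)]]]
      supported_star[OF supported_wiener_of[OF power_series_summable(1)[OF ps(3)]]] by simp_all
  show "supported {..0} ?P"
    using supported_mult[OF s, of "{..0}"] by (simp add: supported_def)
  fix \<theta> and V :: "complex^'q^'q"
  let ?z = "1 - of_real r * cis \<theta>"
  let ?v = "cnj (?z powr of_real (- d)) * ?z powr of_real d"
  let ?A = "g (cis \<theta>)" and ?B = "gs (cis \<theta>)"
  have "ev (star (frac_factor (- d) r G) * frac_factor d r Gsi - ?P) \<theta>
      = mscale ?v (hermitian_conj ?A ** matrix_inv ?B) - (\<delta> / M\<^sup>2) *\<^sub>R (hermitian_conj ?A ** hermitian_conj ?B)"
    by (simp add: ev_diff ev_scaleR ev_mult ev_star ev_frac_factor[OF gbinomial_bdd(3) r ps(4)]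
        ev_frac_factor[OF gbinomial_bdd(4) r ps(1)] power_series_ev[OF ps(1)] power_series_ev[OF ps(3)]
        mscale_mult_left mscale_mult_right hermitian_conj_mscale mult.commute)
  moreover have "(norm ((mscale ?v (hermitian_conj ?A ** matrix_inv ?B)
        - (\<delta> / M\<^sup>2) *\<^sub>R (hermitian_conj ?A ** hermitian_conj ?B)) ** V))\<^sup>2
      \<le> (1 - \<delta>\<^sup>2 / (M * L)\<^sup>2) * (norm V)\<^sup>2"
  proof (rule norm_phase_correction_le)
    show "?A ** hermitian_conj ?A = hermitian_conj ?B ** ?B" by (rule factorizations) simp
    show "matrix_inv ?A ** ?A = mat 1" "?B ** matrix_inv ?B = mat 1"
      using det by (simp_all add: matrix_inv_inverse)
    show "norm ?v = 1" "\<delta> \<le> Re ?v"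
      using powr_phase[OF one_minus_r_cis(2) d] by (simp_all add: \<delta>_def)
    show "norm ?A \<le> M" using norm_ev_le[of "wiener_of G" \<theta>] by (simp add: M_def power_series_ev[OF ps(1)])
    show "norm (matrix_inv ?A) \<le> L"
      using norm_ev_le[of "wiener_of Gi" \<theta>] by (simp add: L_def power_series_ev[OF ps(2)])
  qed (use delta_RHO in auto)
  ultimately have "(norm (ev (star (frac_factor (- d) r G) * frac_factor d r Gsi - ?P) \<theta> ** V))\<^sup>2 \<le> (RHO * norm V)\<^sup>2"
    by (simp only: power_mult_distrib delta_RHO(7))
  thus "norm (ev (star (frac_factor (- d) r G) * frac_factor d r Gsi - ?P) \<theta> ** V) \<le> RHO * norm V"
    by (rule power2_le_imp_le) (use delta_RHO in auto)
qed

lemma wiener_factors: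
  assumes "0 < \<epsilon>" "\<epsilon> < d" "\<epsilon> \<le> 1/4"
  shows "wiener_factors (frac_factor (- d) r G) (frac_factor d r Gi) (frac_factor (- d) r Gs) (frac_factor d r Gsi)
    d \<epsilon> CA CC RHO"
proof
  note bp = gbinomial_bdd(3) and bn = gbinomial_bdd(4)
  have weighted_norm: "0 \<le> weighted_norm Gi" "0 \<le> weighted_norm Gsi" using weighted_norm_nonneg ps by blast+
  show "frac_factor (- d) r G * frac_factor d r Gi = 1"
    by (rule frac_factor_inverse(1)[OF ps(1,2) det(1)])
  show "frac_factor d r Gi * frac_factor (- d) r G = 1"
    by (rule frac_factor_inverse(2)[OF ps(1,2) det(1)])
  show "frac_factor (- d) r Gs * frac_factor d r Gsi = 1"
    by (rule frac_factor_inverse(1)[OF ps(3,4) det(2)])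
  show "frac_factor d r Gsi * frac_factor (- d) r Gs = 1"
    by (rule frac_factor_inverse(2)[OF ps(3,4) det(2)])
  show "supported {0..} (frac_factor (- d) r G)" "supported {0..} (frac_factor (- d) r Gs)"
    by (rule supported_frac_factor[OF bn r ps(1)] supported_frac_factor[OF bn r ps(3)])+
  show "supported {0..} (frac_factor d r Gi)" "supported {0..} (frac_factor d r Gsi)"
    by (rule supported_frac_factor[OF bp r ps(2)] supported_frac_factor[OF bp r ps(4)])+
  show "frac_factor (- d) r G * star (frac_factor (- d) r G) = star (frac_factor (- d) r Gs) * frac_factor (- d) r Gs"
    by (rule ev_eqI) (simp add: ev_mult ev_star ev_frac_factor[OF bn r ps(1)] ev_frac_factor[OF bn r ps(3)]
        hermitian_conj_mscale mscale_mult_left mscale_mult_right factorizations mult.commute)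
  show "norm (coeff_at (frac_factor d r Gsi) j) \<le> CA * (real_of_int j + 1) powr (- 1 - d)" if "0 \<le> j" for j
  proof -
    have "norm (coeff_at (frac_factor d r Gsi) j)
        \<le> 4 * norm (mat 1 :: complex^'q^'q) * weighted_norm Gsi * (real_of_int j + 1) powr (- (1 + d))"
      using d that by (intro norm_coeff_frac_factor_le[OF bp r ps(4) gbinomial_bdd(1)]) auto
    also have "\<dots> \<le> CA * (real_of_int j + 1) powr (- (1 + d))"
      unfolding CA_def using weighted_norm by (intro mult_right_mono mult_left_mono) auto
    finally show ?thesis by simp
  qed
  show "norm (coeff_at (frac_factor d r Gi) j) \<le> CA * (real_of_int j + 1) powr (- 1 - d)" if "0 \<le> j" for j
  proof -
    have "norm (coeff_at (frac_factor d r Gi) j)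
        \<le> 4 * norm (mat 1 :: complex^'q^'q) * weighted_norm Gi * (real_of_int j + 1) powr (- (1 + d))"
      using d that by (intro norm_coeff_frac_factor_le[OF bp r ps(2) gbinomial_bdd(1)]) auto
    also have "\<dots> \<le> CA * (real_of_int j + 1) powr (- (1 + d))"
      unfolding CA_def using weighted_norm by (intro mult_right_mono mult_left_mono) auto
    finally show ?thesis by simp
  qed
  show "norm (coeff_at (frac_factor (- d) r G) j) \<le> CC * (real_of_int j + 1) powr (d - 1)" if "0 \<le> j" for j
    using norm_coeff_frac_factor_le[OF bn r ps(1) gbinomial_bdd(2), of j] d that by (simp add: CC_def)
qed (use assms d delta_RHO contraction weighted_summable_frac_factor[OF gbinomial_bdd(3) r ps(4)] in auto)

lemma ev_frac_factor_G:
  "ev (frac_factor (- d) r G * star (frac_factor (- d) r G)) \<theta>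
    = norm (1 - of_real r * cis \<theta>) powr (- 2 * d) *\<^sub>R (g (cis \<theta>) ** hermitian_conj (g (cis \<theta>)))"
proof -
  let ?z = "1 - of_real r * cis \<theta>"
  have "?z powr of_real (- d) * cnj (?z powr of_real (- d)) = of_real ((norm (?z powr of_real (- d)))\<^sup>2)"
    by (rule complex_norm_square[symmetric])
  also have "(norm (?z powr of_real (- d)))\<^sup>2 = norm ?z powr (- 2 * d)"
    using one_minus_r_cis(1)[of \<theta>]
    by (subst norm_powr_real_powr') (simp_all add: power2_eq_square flip: powr_add)
  finally show ?thesis
    by (simp add: ev_mult ev_star ev_frac_factor[OF gbinomial_bdd(4) r ps(1)] hermitian_conj_mscale
        mscale_mult_left mscale_mult_right mscale_of_real mult.commute)
qed

end

end

section \<open>Passage to the boundary\<close>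

text \<open>The identity B_i - B_j = B_i (A_j - A_i) B_j shows that bounded inverses of a convergent
  sequence form a Cauchy sequence. In particular the limit matrix is invertible.\<close>

lemma block_inverse_limit:
  fixes A B :: "nat \<Rightarrow> nat \<Rightarrow> nat \<Rightarrow> complex^'q^'q" and A' :: "nat \<Rightarrow> nat \<Rightarrow> complex^'q^'q"
  assumes lim: "\<And>s t. s \<in> {1..n} \<Longrightarrow> t \<in> {1..n} \<Longrightarrow> (\<lambda>m. A m s t) \<longlonglongrightarrow> A' s t"
    and inv: "\<And>m. is_block_inverse n (A m) (B m)"
    and bdd: "\<And>m s t. s \<in> {1..n} \<Longrightarrow> t \<in> {1..n} \<Longrightarrow> norm (B m s t) \<le> C" "0 \<le> C"
  shows "\<exists>B'. is_block_inverse n A' B' \<and> (\<forall>s\<in>{1..n}. \<forall>t\<in>{1..n}. (\<lambda>m. B m s t) \<longlonglongrightarrow> B' s t)"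
proof -
  define a where "a m = C\<^sup>2 * (\<Sum>u=1..n. \<Sum>v=1..n. norm (A m u v - A' u v))" for m
  have diff: "norm (B i s t - B j s t) \<le> a i + a j" if st: "s \<in> {1..n}" "t \<in> {1..n}" for i j s t
  proof -
    have 1: "(\<Sum>u=1..n. \<Sum>v=1..n. B i s u ** A j u v ** B j v t) = B i s t"
    proof -
      have "(\<Sum>u=1..n. \<Sum>v=1..n. B i s u ** A j u v ** B j v t) = (\<Sum>u=1..n. B i s u ** (\<Sum>v=1..n. A j u v ** B j v t))"
        by (simp add: mmult.sum_right matrix_mul_assoc)
      also have "\<dots> = (\<Sum>u=1..n. B i s u ** (if u = t then mat 1 else 0))"
        using st inv[of j] by (intro sum.cong) (auto simp: is_block_inverse_def)
      finally show ?thesis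
        using st by (simp add: if_distrib[of "(**) _"] mmult.zero_right cong: if_cong)
    qed
    have 2: "(\<Sum>u=1..n. \<Sum>v=1..n. B i s u ** A i u v ** B j v t) = B j s t"
    proof -
      have "(\<Sum>u=1..n. \<Sum>v=1..n. B i s u ** A i u v ** B j v t) = (\<Sum>v=1..n. (\<Sum>u=1..n. B i s u ** A i u v) ** B j v t)"
        unfolding mmult.sum_left by (rule sum.swap)
      also have "\<dots> = (\<Sum>v=1..n. (if s = v then mat 1 else 0) ** B j v t)"
        using st inv[of i] by (intro sum.cong) (auto simp: is_block_inverse_def)
      finally show ?thesis
        using st by (simp add: if_distrib[of "\<lambda>x. x ** _"] mmult.zero_left cong: if_cong)
    qed
    have "B i s t - B j s t = (\<Sum>u=1..n. \<Sum>v=1..n. B i s u ** (A j u v - A i u v) ** B j v t)"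
      unfolding mmult.diff_left mmult.diff_right sum_subtractf 1 2 ..
    hence "norm (B i s t - B j s t) = norm (\<Sum>u=1..n. \<Sum>v=1..n. B i s u ** (A j u v - A i u v) ** B j v t)"
      by (rule arg_cong)
    also have "\<dots> \<le> (\<Sum>u=1..n. \<Sum>v=1..n. norm (B i s u ** (A j u v - A i u v) ** B j v t))"
      by (intro order_trans[OF norm_sum] sum_mono norm_sum)
    also have "\<dots> \<le> (\<Sum>u=1..n. \<Sum>v=1..n. C * (norm (A j u v - A' u v) + norm (A i u v - A' u v)) * C)"
    proof (intro sum_mono)
      fix u v assume uv: "u \<in> {1..n}" "v \<in> {1..n}"
      have "norm (B i s u ** (A j u v - A i u v) ** B j v t)
          \<le> norm (B i s u) * norm (A j u v - A i u v) * norm (B j v t)"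
        by (intro order_trans[OF norm_matrix_mult_le] mult_right_mono norm_matrix_mult_le) auto
      also have "\<dots> \<le> C * (norm (A j u v - A' u v) + norm (A i u v - A' u v)) * C"
      proof (intro mult_mono bdd st uv)
        show "norm (A j u v - A i u v) \<le> norm (A j u v - A' u v) + norm (A i u v - A' u v)"
          using norm_triangle_ineq4[of "A j u v - A' u v" "A i u v - A' u v"] by simp
      qed (use bdd(2) in auto)
      finally show "norm (B i s u ** (A j u v - A i u v) ** B j v t)
          \<le> C * (norm (A j u v - A' u v) + norm (A i u v - A' u v)) * C" .
    qed
    also have "\<dots> = a i + a j"
      by (simp add: a_def sum_distrib_left sum.distrib power2_eq_square algebra_simps)
    finally show ?thesis .
  qed
  have "a \<longlonglongrightarrow> C\<^sup>2 * (\<Sum>u=1..n. \<Sum>v=1..n. norm (A' u v - A' u v))"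
    unfolding a_def by (intro tendsto_intros lim) auto
  hence a0: "a \<longlonglongrightarrow> 0" by simp
  have "\<exists>l. (\<lambda>m. B m s t) \<longlonglongrightarrow> l" if st: "s \<in> {1..n}" "t \<in> {1..n}" for s t
  proof -
    have "Cauchy (\<lambda>m. B m s t)"
    proof (rule CauchyI)
      fix e :: real assume e: "0 < e"
      from LIMSEQ_D[OF a0, of "e / 2"] e obtain N where N: "\<And>m. m \<ge> N \<Longrightarrow> norm (a m) < e / 2" by auto
      show "\<exists>N. \<forall>i\<ge>N. \<forall>j\<ge>N. norm (B i s t - B j s t) < e"
      proof (intro exI allI impI)
        fix i j assume "N \<le> i" "N \<le> j"
        thus "norm (B i s t - B j s t) < e" using diff[OF st, of i j] N[of i] N[of j] by simp
      qed
    qed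
    thus ?thesis using Cauchy_convergent_iff convergent_def by blast
  qed
  then obtain B' where B': "\<And>s t. s \<in> {1..n} \<Longrightarrow> t \<in> {1..n} \<Longrightarrow> (\<lambda>m. B m s t) \<longlonglongrightarrow> B' s t" by metis
  have "is_block_inverse n A' B'"
    unfolding is_block_inverse_def
  proof (intro ballI conjI)
    fix s t assume st: "s \<in> {1..n}" "t \<in> {1..n}"
    have "(\<lambda>m. \<Sum>u=1..n. A m s u ** B m u t) \<longlonglongrightarrow> (\<Sum>u=1..n. A' s u ** B' u t)"
      using st by (intro tendsto_sum mmult.tendsto lim B') auto
    moreover have "(\<lambda>m. \<Sum>u=1..n. A m s u ** B m u t) = (\<lambda>m. if s = t then mat 1 else 0)"
      using inv st by (auto simp: fun_eq_iff is_block_inverse_def)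
    ultimately have "(\<lambda>m. if s = t then mat 1 else 0) \<longlonglongrightarrow> (\<Sum>u=1..n. A' s u ** B' u t)" by simp
    from LIMSEQ_unique[OF this tendsto_const] show "(\<Sum>u=1..n. A' s u ** B' u t) = (if s = t then mat 1 else 0)" .
    have "(\<lambda>m. \<Sum>u=1..n. B m s u ** A m u t) \<longlonglongrightarrow> (\<Sum>u=1..n. B' s u ** A' u t)"
      using st by (intro tendsto_sum mmult.tendsto lim B') auto
    moreover have "(\<lambda>m. \<Sum>u=1..n. B m s u ** A m u t) = (\<lambda>m. if s = t then mat 1 else 0)"
      using inv st by (auto simp: fun_eq_iff is_block_inverse_def)
    ultimately have "(\<lambda>m. if s = t then mat 1 else 0) \<longlonglongrightarrow> (\<Sum>u=1..n. B' s u ** A' u t)" by simp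
    from LIMSEQ_unique[OF this tendsto_const] show "(\<Sum>u=1..n. B' s u ** A' u t) = (if s = t then mat 1 else 0)" .
  qed
  thus ?thesis using B' by blast
qed

text \<open>The modulus is 2 sin(|\<theta>|/2), and the Taylor remainder x^3/6 gives sin x at least
  x/3 on [0, 2]. The constant 3 is not sharp, but only integrability of the majorant is at
  stake.\<close>

lemma norm_1_minus_cis_ge:
  assumes "\<bar>\<theta>\<bar> \<le> pi"
  shows "\<bar>\<theta>\<bar> / 3 \<le> norm (1 - cis \<theta>)"
proof -
  define x where "x = \<bar>\<theta>\<bar> / 2"
  have x: "0 \<le> x" "x \<le> 2" using assms pi_less_4 by (auto simp: x_def)
  have "\<bar>sin x - (\<Sum>m<3. sin_coeff m * x ^ m)\<bar> \<le> inverse (fact 3) * \<bar>x\<bar> ^ 3"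
    by (rule Maclaurin_sin_bound)
  hence "\<bar>sin x - x\<bar> * 6 \<le> x * (x * x)"
    using x by (simp add: sin_coeff_def fact_numeral numeral_eq_Suc)
  moreover have "(x - sin x) * 6 \<le> \<bar>sin x - x\<bar> * 6" by (intro mult_right_mono) auto
  moreover have "x * (x * x) \<le> x * (2 * 2)" using x by (intro mult_left_mono mult_mono) auto
  ultimately have "(x - sin x) * 6 \<le> x * (2 * 2)" by (meson order_trans)
  hence sin: "x / 3 \<le> sin x" by simp
  have "(norm (1 - cis \<theta>))\<^sup>2 = 2 - 2 * cos \<bar>\<theta>\<bar>"
    unfolding cmod_power2 cos_abs_real by (simp add: power2_eq_square algebra_simps)
  also have "\<bar>\<theta>\<bar> = 2 * x" by (simp add: x_def)
  also have "2 - 2 * cos (2 * x) = (2 * sin x)\<^sup>2" by (simp add: cos_double_sin power_mult_distrib)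
  finally have "(norm (1 - cis \<theta>))\<^sup>2 = (2 * sin x)\<^sup>2" .
  moreover have "0 \<le> 2 * sin x" using sin x by linarith
  ultimately have "norm (1 - cis \<theta>) = 2 * sin x" by (rule power2_eq_imp_eq[OF _ norm_ge_zero])
  thus ?thesis using sin by (simp add: x_def)
qed

text \<open>With a = -2d this is the dominating function below; here d < 1/2 is essential.\<close>

lemma set_integrable_abs_powr:
  fixes a c :: real
  assumes "- 1 < a" "0 \<le> c"
  shows "set_integrable lborel {-c..c} (\<lambda>x. \<bar>x\<bar> powr a)"
proof -
  have "(\<lambda>x. x powr a) integrable_on {0..c}" using assms by (rule integrable_on_powr_from_0)
  hence 1: "(\<lambda>x. \<bar>x\<bar> powr a) integrable_on {0..c}"
    by (rule integrable_eq) auto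
  hence "(\<lambda>x. \<bar>x\<bar> powr a) integrable_on {-c..0}"
    using Henstock_Kurzweil_Integration.integrable_reflect_real[where f = "\<lambda>x. \<bar>x\<bar> powr a" and a = 0 and b = c] by simp
  hence "(\<lambda>x. \<bar>x\<bar> powr a) integrable_on {-c..c}"
    using 1 assms(2) by (intro Henstock_Kurzweil_Integration.integrable_combine[of "-c" 0 c]) auto
  hence "(\<lambda>x. \<bar>x\<bar> powr a) absolutely_integrable_on {-c..c}"
    by (intro nonnegative_absolutely_integrable_1) auto
  thus ?thesis
    unfolding set_integrable_def by (subst (asm) integrable_completion) auto
qed

text \<open>Replacing \<open>1 - z\<close> by \<open>1 - r * z\<close> with \<open>r < 1\<close> makes all Fourier series absolutely convergent;
  the estimates are uniform in \<open>r\<close>.\<close>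

definition reg_radius :: "nat \<Rightarrow> real" where "reg_radius m = 1 - 1 / (real m + 2)"

lemma reg_radius: "0 < reg_radius m" "reg_radius m < 1"
  by (simp_all add: reg_radius_def field_simps)

lemma reg_radius_tendsto: "reg_radius \<longlonglongrightarrow> 1"
proof -
  have "(\<lambda>m. 1 / (real (m + 2))) \<longlonglongrightarrow> 0" using LIMSEQ_ignore_initial_segment[OF lim_1_over_n] .
  hence "(\<lambda>m. 1 - 1 / (real (m + 2))) \<longlonglongrightarrow> 1 - 0" by (intro tendsto_intros)
  thus ?thesis by (simp add: reg_radius_def[abs_def] add.commute)
qed

context toeplitz_symbol begin

text \<open>Dominated convergence. Since |1 - \<zeta>| is at most 2|1 - r\<zeta>|, the regularized
  symbols share one integrable majorant, a multiple of |\<theta>|^(-2d).\<close>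

lemma fourier_coeff_limit:
  assumes w: "\<And>\<zeta>. norm \<zeta> = 1 \<Longrightarrow> \<zeta> \<noteq> 1 \<Longrightarrow>
    w \<zeta> = (norm (1 - \<zeta>) powr (- 2 * d)) *\<^sub>R (g \<zeta> ** hermitian_conj (g \<zeta>))"
  shows "(\<lambda>m. coeff_at (frac_factor (- d) (reg_radius m) G * star (frac_factor (- d) (reg_radius m) G)) k)
    \<longlonglongrightarrow> fourier_coeff w k"
proof -
  define P where "P \<theta> = ev (wiener_of G * star (wiener_of G)) \<theta>" for \<theta>
  have P: "P \<theta> = g (cis \<theta>) ** hermitian_conj (g (cis \<theta>))" for \<theta>
    by (simp add: P_def ev_mult ev_star power_series_ev[OF ps(1)])
  have P_cont: "continuous_on UNIV P" unfolding P_def by (rule continuous_on_ev)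
  define K where "K = norm (wiener_of G * star (wiener_of G))"
  have P_le: "norm (P \<theta>) \<le> K" for \<theta> unfolding P_def K_def by (rule norm_ev_le)
  define f where "f r \<theta> = mscale (exp (- \<i> * of_int k * of_real \<theta>)) (norm (1 - of_real r * cis \<theta>) powr (- 2 * d) *\<^sub>R P \<theta>)" for r \<theta>
  define wr where "wr r \<zeta> = norm (1 - of_real r * \<zeta>) powr (- 2 * d) *\<^sub>R (g \<zeta> ** hermitian_conj (g \<zeta>))" for r and \<zeta> :: complex
  have coeff: "coeff_at (frac_factor (- d) (reg_radius m) G * star (frac_factor (- d) (reg_radius m) G)) k
      = (1 / (2 * pi)) *\<^sub>R (LINT \<theta>:{-pi..pi}|lborel. f (reg_radius m) \<theta>)" for m
  proof -
    have "fourier_coeff (wr (reg_radius m)) k = coeff_at (frac_factor (- d) (reg_radius m) G * star (frac_factor (- d) (reg_radius m) G)) k"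
      by (rule fourier_coeff_ev) (simp add: ev_frac_factor_G[OF reg_radius] wr_def)
    thus ?thesis by (simp add: fourier_coeff_def f_def wr_def P cis_conv_exp)
  qed
  have meas: "f r \<in> borel_measurable borel" for r
  proof -
    have [measurable]: "P \<in> borel_measurable borel"
      using P_cont by (rule borel_measurable_continuous_onI)
    have [measurable]: "(\<lambda>\<theta>. norm (1 - of_real r * cis \<theta>)) \<in> borel_measurable borel"
      by (intro borel_measurable_continuous_onI continuous_intros)
    have e: "continuous_on UNIV (\<lambda>\<theta>. exp (- \<i> * of_int k * complex_of_real \<theta>))"
      by (intro continuous_intros)
    have "f r = (\<lambda>\<theta>. (norm (1 - of_real r * cis \<theta>) powr (- 2 * d)) *\<^sub>R mscale (exp (- \<i> * of_int k * of_real \<theta>)) (P \<theta>))"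
      by (simp add: f_def mscale.scaleR_right fun_eq_iff)
    moreover have "(\<lambda>\<theta>. mscale (exp (- \<i> * of_int k * of_real \<theta>)) (P \<theta>)) \<in> borel_measurable borel"
      by (rule borel_measurable_continuous_onI[OF mscale.continuous_on[OF e P_cont]])
    ultimately show ?thesis by simp
  qed
  let ?F = "\<lambda>\<theta>. indicator {-pi..pi} \<theta> *\<^sub>R mscale (exp (- \<i> * of_int k * of_real \<theta>)) (w (exp (\<i> * of_real \<theta>)))"
  have F_eq: "?F \<theta> = indicator {-pi..pi} \<theta> *\<^sub>R f 1 \<theta>" if "\<theta> \<noteq> 0" for \<theta>
  proof (cases "\<theta> \<in> {-pi..pi}")
    case True
    have "0 < norm (1 - cis \<theta>)"
      using norm_1_minus_cis_ge[of \<theta>] True that by (auto simp: abs_le_iff intro: less_le_trans[of 0 "\<bar>\<theta>\<bar> / 3"])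
    hence "cis \<theta> \<noteq> 1" by auto
    hence "w (cis \<theta>) = norm (1 - cis \<theta>) powr (- 2 * d) *\<^sub>R P \<theta>" using w[of "cis \<theta>"] by (simp add: P)
    thus ?thesis by (simp add: f_def cis_conv_exp)
  qed simp
  have "(\<lambda>m. integral\<^sup>L lborel (\<lambda>\<theta>. indicator {-pi..pi} \<theta> *\<^sub>R f (reg_radius m) \<theta>)) \<longlonglongrightarrow> integral\<^sup>L lborel ?F"
  proof (rule integral_dominated_convergence)
    let ?D = "\<lambda>\<theta>. K * 6 powr (2 * d) * (indicator {-pi..pi} \<theta> *\<^sub>R \<bar>\<theta>\<bar> powr (- 2 * d))"
    show "integrable lborel ?D"
      using set_integrable_abs_powr[of "- 2 * d" pi] d by (auto simp: set_integrable_def)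
    \<comment> \<open>The value of w at 1 is arbitrary, so for measurability the integrand is
      corrected at the single point 0.\<close>
    have "?F = (\<lambda>\<theta>. indicator {-pi..pi} \<theta> *\<^sub>R f 1 \<theta> + indicator {0} \<theta> *\<^sub>R (?F 0 - f 1 0))"
    proof
      fix \<theta> show "?F \<theta> = indicator {-pi..pi} \<theta> *\<^sub>R f 1 \<theta> + indicator {0} \<theta> *\<^sub>R (?F 0 - f 1 0)"
        using F_eq[of \<theta>] by (cases "\<theta> = 0") simp_all
    qed
    moreover have "(\<lambda>\<theta>. indicator {-pi..pi} \<theta> *\<^sub>R f 1 \<theta> + indicator {0} \<theta> *\<^sub>R (?F 0 - f 1 0)) \<in> borel_measurable lborel"
      using meas[of 1] by simp
    ultimately show "?F \<in> borel_measurable lborel" by simp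
    show "(\<lambda>\<theta>. indicator {-pi..pi} \<theta> *\<^sub>R f (reg_radius m) \<theta>) \<in> borel_measurable lborel" for m
      using meas[of "reg_radius m"] by simp
    have ne: "AE \<theta> in lborel. \<theta> \<noteq> (0 :: real)" by (rule AE_lborel_singleton)
    from ne show "AE \<theta> in lborel. (\<lambda>m. indicator {-pi..pi} \<theta> *\<^sub>R f (reg_radius m) \<theta>) \<longlonglongrightarrow> ?F \<theta>"
    proof eventually_elim
      case (elim \<theta>)
      have "(\<lambda>m. f (reg_radius m) \<theta>) \<longlonglongrightarrow> f 1 \<theta>" if "\<theta> \<in> {-pi..pi}"
      proof -
        have "0 < norm (1 - cis \<theta>)"
          using norm_1_minus_cis_ge[of \<theta>] that elim by (auto simp: abs_le_iff intro: less_le_trans[of 0 "\<bar>\<theta>\<bar> / 3"])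
        thus ?thesis unfolding f_def
          by (intro mscale.tendsto tendsto_intros reg_radius_tendsto) auto
      qed
      thus ?case unfolding F_eq[OF elim] by (cases "\<theta> \<in> {-pi..pi}") simp_all
    qed
    show "AE \<theta> in lborel. norm (indicator {-pi..pi} \<theta> *\<^sub>R f (reg_radius m) \<theta>) \<le> ?D \<theta>" for m
      using ne
    proof eventually_elim
      case (elim \<theta>)
      show ?case
      proof (cases "\<theta> \<in> {-pi..pi}")
        case True
        \<comment> \<open>Moving \<zeta> to r\<zeta> costs 1 - r, which is itself at most |1 -
          r\<zeta>|. This factor 2 turns the 3 of \<open>norm_1_minus_cis_ge\<close> into 6.\<close>
        have "norm (1 - cis \<theta>) \<le> norm (1 - of_real (reg_radius m) * cis \<theta>) + norm (of_real (reg_radius m) * cis \<theta> - cis \<theta>)"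
          using norm_triangle_ineq[of "1 - of_real (reg_radius m) * cis \<theta>" "of_real (reg_radius m) * cis \<theta> - cis \<theta>"] by simp
        also have "of_real (reg_radius m) * cis \<theta> - cis \<theta> = of_real (reg_radius m - 1) * cis \<theta>" by (simp add: algebra_simps)
        also have "norm (of_real (reg_radius m - 1) * cis \<theta>) = 1 - reg_radius m"
          unfolding norm_mult norm_of_real using reg_radius[of m] by simp
        also have "1 - reg_radius m \<le> norm (1 - of_real (reg_radius m) * cis \<theta>)"
          using norm_triangle_ineq2[of 1 "of_real (reg_radius m) * cis \<theta>"] reg_radius[of m] by (simp add: norm_mult)
        finally have "\<bar>\<theta>\<bar> / 6 \<le> norm (1 - of_real (reg_radius m) * cis \<theta>)"
          using norm_1_minus_cis_ge[of \<theta>] True by (simp add: abs_le_iff)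
        hence "norm (1 - of_real (reg_radius m) * cis \<theta>) powr (- 2 * d) \<le> (\<bar>\<theta>\<bar> / 6) powr (- 2 * d)"
          using elim d by (intro powr_mono2') auto
        also have "\<dots> = 6 powr (2 * d) * \<bar>\<theta>\<bar> powr (- 2 * d)"
          by (simp add: powr_divide powr_minus field_simps)
        finally have "norm (1 - of_real (reg_radius m) * cis \<theta>) powr (- 2 * d) * norm (P \<theta>)
            \<le> 6 powr (2 * d) * \<bar>\<theta>\<bar> powr (- 2 * d) * K"
          by (intro mult_mono P_le) auto
        moreover have "norm (exp (- \<i> * of_int k * complex_of_real \<theta>)) = 1" by simp
        ultimately show ?thesis using True by (simp add: f_def norm_mscale mult_ac)
      qed simp
    qed
  qed
  hence "(\<lambda>m. (1 / (2 * pi)) *\<^sub>R integral\<^sup>L lborel (\<lambda>\<theta>. indicator {-pi..pi} \<theta> *\<^sub>R f (reg_radius m) \<theta>))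
      \<longlonglongrightarrow> (1 / (2 * pi)) *\<^sub>R integral\<^sup>L lborel ?F"
    by (intro tendsto_intros)
  thus ?thesis
    unfolding coeff by (simp only: fourier_coeff_def set_lebesgue_integral_def)
qed

end

text \<open>Entrywise, a nonzero coefficient would make the zero of the series at 0 isolated, while
  the sum vanishes identically.\<close>

lemma matrix_power_series_eq_0:
  fixes c :: "nat \<Rightarrow> complex^'q^'q"
  assumes "\<And>z. norm z < 1 \<Longrightarrow> (\<lambda>n. mscale (z ^ n) (c n)) sums 0"
  shows "c n = 0"
proof -
  have "c n $ i $ j = 0" for i j
  proof (rule ccontr)
    assume nz: "c n $ i $ j \<noteq> 0"
    have sums: "(\<lambda>n. c n $ i $ j * (z - 0) ^ n) sums 0" if "norm (z - 0) < 1" for z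
    proof -
      have "(\<lambda>n. mscale (z ^ n) (c n)) sums 0" using assms that by simp
      hence "(\<lambda>m. (\<Sum>n<m. mscale (z ^ n) (c n)) $ i $ j) \<longlonglongrightarrow> 0 $ i $ j"
        unfolding sums_def by (intro tendsto_vec_nth)
      thus ?thesis by (simp add: sums_def mscale_def mult.commute)
    qed
    have "c 0 $ i $ j = 0"
      using sums[of 0] by (simp add: powser_sums_zero_iff)
    hence n: "0 < n" using nz by (cases n) auto
    show False
    proof (rule powser_0_nonzero[of 1 0 "\<lambda>n. c n $ i $ j" "\<lambda>_. 0" n])
      fix s :: real assume s: "0 < s" "\<And>z. z \<in> cball (0 :: complex) s - {0} \<Longrightarrow> (0 :: complex) \<noteq> 0"
      have "of_real s \<in> cball (0 :: complex) s - {0}" using s(1) by auto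
      from s(2)[OF this] show False by simp
    qed (use sums nz n in auto)
  qed
  thus ?thesis by (simp add: vec_eq_iff)
qed

lemma matrix_inv_unique:
  fixes A :: "complex^'q^'q"
  assumes "A ** B = mat 1"
  shows "matrix_inv A = B"
proof -
  have "det A * det B = 1" using assms det_mul[of A B] by simp
  hence "det A \<noteq> 0" by auto
  have "matrix_inv A = matrix_inv A ** (A ** B)" using assms by simp
  also have "\<dots> = B" using \<open>det A \<noteq> 0\<close> by (simp add: matrix_mul_assoc matrix_inv_inverse)
  finally show ?thesis .
qed

section \<open>The limits of the factors and of the finite inverses\<close>

context toeplitz_symbol begin

text \<open>The Taylor coefficients of (1 - z)^d times the inverse of gs, that is, of the inverse of
  k without regularization.\<close>

definition ki1 :: "nat \<Rightarrow> complex^'q^'q" where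
  "ki1 j = (\<Sum>i\<le>j. bseq d 1 i ** Gsi (j - i))"

lemma ki1_sums:
  assumes z: "norm z < 1"
  shows "(\<lambda>n. mscale (z ^ n) (ki1 n)) sums mscale ((1 - z) powr of_real d) (matrix_inv (gs z))"
proof -
  define \<beta> where "\<beta> n = complex_of_real ((- 1) ^ n * (d gchoose n))" for n
  have b: "bseq d 1 n ** X = mscale (\<beta> n) X" for n X
    by (simp add: bseq_def \<beta>_def mscale_mult_left)
  have "(\<lambda>n. mscale (z ^ n) (bseq d 1 n)) sums mscale ((1 - of_real 1 * z) powr of_real d) (mat 1 :: complex^'q^'q)"
    by (rule sums_bseq) (use z in simp)
  hence "(\<lambda>m. (\<Sum>n<m. mscale (z ^ n) (bseq d 1 n)) $ i $ i)
      \<longlonglongrightarrow> mscale ((1 - z) powr of_real d) (mat 1 :: complex^'q^'q) $ i $ i" for i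
    unfolding sums_def by (intro tendsto_vec_nth) simp
  hence s1: "(\<lambda>n. z ^ n * \<beta> n) sums (1 - z) powr of_real d"
    by (simp add: sums_def mscale_def mat_def bseq_def \<beta>_def)
  have n1: "summable (\<lambda>n. norm (z ^ n * \<beta> n))"
  proof (rule summable_comparison_test'[of "\<lambda>n. 4 * norm z ^ n" 0])
    show "summable (\<lambda>n. 4 * norm z ^ n)" using z by (intro summable_mult summable_geometric) simp
    show "norm (norm (z ^ n * \<beta> n)) \<le> 4 * norm z ^ n" for n
      using gbinomial_bdd(3)[of n] by (simp add: \<beta>_def norm_mult norm_power mult.commute mult_right_mono)
  qed
  have s2: "(\<lambda>n. mscale (z ^ n) (Gsi n)) sums matrix_inv (gs z)"
    using ps(4) z by (simp add: power_series_on_cdisk_def)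
  have n2: "summable (\<lambda>n. norm (z ^ n * Gsi n $ i $ j))" for i j
  proof (rule summable_comparison_test'[OF power_series_summable(1)[OF ps(4)], of 0])
    fix n
    have "norm (z ^ n * Gsi n $ i $ j) \<le> 1 * norm (Gsi n $ i $ j)"
      unfolding norm_mult norm_power using z by (intro mult_right_mono power_le_one) auto
    also have "\<dots> \<le> norm (Gsi n)"
      using Finite_Cartesian_Product.norm_nth_le[of "Gsi n $ i" j] Finite_Cartesian_Product.norm_nth_le[of "Gsi n" i] by simp
    finally show "norm (norm (z ^ n * Gsi n $ i $ j)) \<le> norm (Gsi n)" by simp
  qed
  have "(\<lambda>n. (mscale (z ^ n) (ki1 n)) $ i $ j) sums (mscale ((1 - z) powr of_real d) (matrix_inv (gs z)) $ i $ j)" for i j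
  proof -
    have "(\<lambda>m. (\<Sum>n<m. mscale (z ^ n) (Gsi n)) $ i $ j) \<longlonglongrightarrow> matrix_inv (gs z) $ i $ j"
      using s2 unfolding sums_def by (intro tendsto_vec_nth)
    hence s2': "(\<lambda>n. z ^ n * Gsi n $ i $ j) sums (matrix_inv (gs z) $ i $ j)"
      by (simp add: sums_def mscale_def)
    have "(\<Sum>i'\<le>n. (z ^ i' * \<beta> i') * (z ^ (n - i') * Gsi (n - i') $ i $ j)) = mscale (z ^ n) (ki1 n) $ i $ j" for n
    proof -
      have "(z ^ i' * \<beta> i') * (z ^ (n - i') * Gsi (n - i') $ i $ j) = z ^ n * (\<beta> i' * Gsi (n - i') $ i $ j)"
        if "i' \<le> n" for i'
        using power_add[of z i' "n - i'"] that by simp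
      hence "(\<Sum>i'\<le>n. (z ^ i' * \<beta> i') * (z ^ (n - i') * Gsi (n - i') $ i $ j))
          = (\<Sum>i'\<le>n. z ^ n * (\<beta> i' * Gsi (n - i') $ i $ j))" by (intro sum.cong) auto
      thus ?thesis by (simp add: mscale_def ki1_def b sum_distrib_left)
    qed
    with Cauchy_product_sums[OF n1 n2, of i j] s1 s2' show ?thesis
      by (simp add: sums_iff mscale_def)
  qed
  thus ?thesis
    unfolding sums_def by (intro vec_tendstoI) simp
qed

text \<open>Conjugating both the argument and the value leaves the powers of z in place and
  conjugates the coefficients. The minus sign will cancel in the products that form the
  inverse.\<close>

lemma ki1_eq:
  assumes a: "\<And>\<zeta>. norm \<zeta> < 1 \<Longrightarrow> (\<lambda>k. mscale (\<zeta> ^ k) (a k)) sums (- matrix_inv (h_tilde d gs \<zeta>))"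
  shows "a n = - hermitian_conj (ki1 n)"
proof -
  have "a n + hermitian_conj (ki1 n) = 0"
  proof (rule matrix_power_series_eq_0)
    fix z :: complex assume z: "norm z < 1"
    let ?z = "cnj z"
    have nz: "1 - ?z \<noteq> 0" using z by auto
    have "h_tilde d gs z ** hermitian_conj (mscale ((1 - ?z) powr of_real d) (matrix_inv (gs ?z)))
        = hermitian_conj (mscale ((1 - ?z) powr of_real d) (matrix_inv (gs ?z)) ** mscale ((1 - ?z) powr of_real (- d)) (gs ?z))"
      by (simp add: h_tilde_def h_sharp_def hermitian_conj_mult)
    also have "\<dots> = mat 1"
      using z nz det(2)[of ?z] by (simp add: mscale_mult_left mscale_mult_right matrix_inv_inverse flip: powr_add)
    finally have inv: "matrix_inv (h_tilde d gs z) = hermitian_conj (mscale ((1 - ?z) powr of_real d) (matrix_inv (gs ?z)))"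
      by (rule matrix_inv_unique)
    have "(\<lambda>n. hermitian_conj (mscale (?z ^ n) (ki1 n))) sums matrix_inv (h_tilde d gs z)"
      unfolding inv by (rule bounded_linear.sums[OF bounded_linear_hermitian_conj ki1_sums]) (use z in simp)
    hence "(\<lambda>n. mscale (z ^ n) (hermitian_conj (ki1 n))) sums matrix_inv (h_tilde d gs z)"
      by (simp add: hermitian_conj_mscale)
    from sums_add[OF a[OF z] this] show "(\<lambda>n. mscale (z ^ n) (a n + hermitian_conj (ki1 n))) sums 0"
      by (simp add: mscale.add_right)
  qed
  thus ?thesis by (simp add: add_eq_0_iff)
qed

lemma ki_limit: "(\<lambda>m. coeff_at (frac_factor d (reg_radius m) Gsi) (int j)) \<longlonglongrightarrow> ki1 j"
proof -
  have "coeff_at (frac_factor d (reg_radius m) Gsi) (int j) = (\<Sum>i\<le>j. bseq d (reg_radius m) i ** Gsi (j - i))" for m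
    unfolding frac_factor_def
    by (rule coeff_at_wiener_of_mult[OF summable_bseq(2)[OF gbinomial_bdd(3) reg_radius] power_series_summable(1)[OF ps(4)]])
  moreover have "(\<lambda>m. \<Sum>i\<le>j. bseq d (reg_radius m) i ** Gsi (j - i)) \<longlonglongrightarrow> ki1 j"
    unfolding ki1_def bseq_def
    by (intro tendsto_sum mmult.tendsto mscale.tendsto tendsto_intros reg_radius_tendsto)
  ultimately show ?thesis by simp
qed

lemma norm_ki1_le:
  "norm (ki1 j) \<le> CA * (real j + 1) powr (- 1 - d)"
proof (rule LIMSEQ_le_const2[OF tendsto_norm[OF ki_limit]])
  interpret W: wiener_factors "frac_factor (- d) (reg_radius m) G" "frac_factor d (reg_radius m) Gi" "frac_factor (- d) (reg_radius m) Gs"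
    "frac_factor d (reg_radius m) Gsi" d "min (d/2) (1/4)" CA CC RHO for m
    by (rule wiener_factors[OF reg_radius]) (use d in auto)
  show "\<exists>N. \<forall>m\<ge>N. norm (coeff_at (frac_factor d (reg_radius m) Gsi) (int j)) \<le> CA * (real j + 1) powr (- 1 - d)"
    using W.ki_le[of "int j"] by simp
qed

definition SA where "SA = CA * (1 + 1 / d)"

lemma sum_ki1_le: "finite A \<Longrightarrow> (\<Sum>j\<in>A. norm (ki1 j)) \<le> SA"
proof -
  assume A: "finite A"
  have CA: "0 \<le> CA" using order_trans[OF norm_ge_zero norm_ki1_le[of 0]] by simp
  have "(\<Sum>j\<in>A. norm (ki1 j)) \<le> (\<Sum>j\<in>A. CA * real_of_int (int j + 1) powr (- 1 - d))"
    using norm_ki1_le by (intro sum_mono) simp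
  also have "\<dots> = CA * (\<Sum>l\<in>(\<lambda>j. int j + 1) ` A. real_of_int l powr (- 1 - d))"
    by (subst sum.reindex) (auto simp: inj_on_def sum_distrib_left)
  also have "\<dots> \<le> CA * (1 + 1 / d)"
    using A d CA by (intro mult_left_mono sum_powr_from_1_le) auto
  finally show ?thesis by (simp add: SA_def)
qed

lemma SA_nonneg: "0 \<le> SA"
  using sum_ki1_le[of "{}"] by simp

definition Tinf :: "nat \<Rightarrow> nat \<Rightarrow> complex^'q^'q" where
  "Tinf s t = (\<Sum>l=1..min s t. ki1 (s - l) ** hermitian_conj (ki1 (t - l)))"

text \<open>The inverse is a product of a lower and an upper triangular Toeplitz matrix, each with
  column sums at most SA. The bound is uniform in t and n, so the inverse acts boundedly on summable
  sequences.\<close>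

lemma sum_norm_Tinf_le: "(\<Sum>s=1..n. norm (Tinf s t)) \<le> SA * SA"
proof -
  have "norm (Tinf s t) \<le> (\<Sum>l=1..t. (if l \<le> s then norm (ki1 (s - l)) else 0) * norm (ki1 (t - l)))" for s
  proof -
    have "norm (Tinf s t) \<le> (\<Sum>l=1..min s t. norm (ki1 (s - l) ** hermitian_conj (ki1 (t - l))))"
      unfolding Tinf_def by (rule norm_sum)
    also have "\<dots> \<le> (\<Sum>l=1..min s t. (if l \<le> s then norm (ki1 (s - l)) else 0) * norm (ki1 (t - l)))"
      by (intro sum_mono order_trans[OF norm_matrix_mult_le]) simp
    also have "\<dots> \<le> (\<Sum>l=1..t. (if l \<le> s then norm (ki1 (s - l)) else 0) * norm (ki1 (t - l)))"
      by (intro sum_mono2) auto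
    finally show ?thesis .
  qed
  hence "(\<Sum>s=1..n. norm (Tinf s t))
      \<le> (\<Sum>s=1..n. \<Sum>l=1..t. (if l \<le> s then norm (ki1 (s - l)) else 0) * norm (ki1 (t - l)))"
    by (intro sum_mono)
  also have "\<dots> = (\<Sum>l=1..t. (\<Sum>s=1..n. if l \<le> s then norm (ki1 (s - l)) else 0) * norm (ki1 (t - l)))"
    unfolding sum_distrib_right by (rule sum.swap)
  also have "\<dots> \<le> (\<Sum>l=1..t. SA * norm (ki1 (t - l)))"
  proof (intro sum_mono mult_right_mono)
    fix l
    have "(\<Sum>s=1..n. if l \<le> s then norm (ki1 (s - l)) else 0) = (\<Sum>s\<in>{s\<in>{1..n}. l \<le> s}. norm (ki1 (s - l)))"
      by (rule sum.inter_filter[symmetric]) simp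
    also have "\<dots> = (\<Sum>j\<in>(\<lambda>s. s - l) ` {s\<in>{1..n}. l \<le> s}. norm (ki1 j))"
      by (subst sum.reindex) (auto simp: inj_on_def)
    also have "\<dots> \<le> SA" by (rule sum_ki1_le) simp
    finally show "(\<Sum>s=1..n. if l \<le> s then norm (ki1 (s - l)) else 0) \<le> SA" .
  qed auto
  also have "\<dots> = SA * (\<Sum>j\<in>(\<lambda>l. t - l) ` {1..t}. norm (ki1 j))"
    by (subst sum.reindex) (auto simp: inj_on_def sum_distrib_left)
  also have "\<dots> \<le> SA * SA"
    by (intro mult_left_mono sum_ki1_le SA_nonneg) simp
  finally show ?thesis .
qed

text \<open>For fixed n the column estimate gives a bound on the regularized inverses, so they
  converge together with the matrices, and the estimate passes to the limit with a constant
  independent of n.\<close>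

lemma ex_toeplitz_inverse:
  assumes w: "\<And>\<zeta>. norm \<zeta> = 1 \<Longrightarrow> \<zeta> \<noteq> 1 \<Longrightarrow>
      w \<zeta> = (norm (1 - \<zeta>) powr (- 2 * d)) *\<^sub>R (g \<zeta> ** hermitian_conj (g \<zeta>))"
    and eps: "0 < \<epsilon>" "\<epsilon> < d" "\<epsilon> \<le> 1/4"
  shows "\<exists>K\<ge>0. \<forall>n. \<exists>B. is_block_inverse n (toeplitz w) B \<and>
    (\<forall>t\<in>{1..n}. (\<Sum>s=1..n. norm (B s t - Tinf s t)) \<le> K * real (n - t + 1) powr (\<epsilon> - d))"
proof -
  interpret W: wiener_factors "frac_factor (- d) (reg_radius m) G" "frac_factor d (reg_radius m) Gi" "frac_factor (- d) (reg_radius m) Gs"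
    "frac_factor d (reg_radius m) Gsi" d \<epsilon> CA CC RHO for m
    by (rule wiener_factors[OF reg_radius eps])
  have CA: "0 \<le> CA" by (rule W.Ca_nonneg)
  define K where "K = max 0 W.CK"
  have K: "0 \<le> K" "W.CK \<le> K" by (simp_all add: K_def)
  show ?thesis
  proof (intro exI[of _ K] conjI allI K)
    fix n
    define T where "T m s t = (\<Sum>l=1..min s t. coeff_at (frac_factor d (reg_radius m) Gsi) (int (s - l))
        ** hermitian_conj (coeff_at (frac_factor d (reg_radius m) Gsi) (int (t - l))))" for m s t
    define A where "A m s t = coeff_at (frac_factor (- d) (reg_radius m) G * star (frac_factor (- d) (reg_radius m) G)) (int s - int t)"
      for m and s t :: nat
    have "\<forall>m. \<exists>B. is_block_inverse n (A m) B \<and>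
        (\<forall>t\<in>{1..n}. (\<Sum>s=1..n. norm (B s t - T m s t)) \<le> W.CK * real (n - t + 1) powr (\<epsilon> - d))"
      using W.ex_block_inverse[of n] by (simp add: A_def[abs_def] T_def)
    from choice[OF this] obtain B where "\<forall>m. is_block_inverse n (A m) (B m) \<and>
        (\<forall>t\<in>{1..n}. (\<Sum>s=1..n. norm (B m s t - T m s t)) \<le> W.CK * real (n - t + 1) powr (\<epsilon> - d))" ..
    hence B: "\<And>m. is_block_inverse n (A m) (B m)"
      "\<And>m t. t \<in> {1..n} \<Longrightarrow> (\<Sum>s=1..n. norm (B m s t - T m s t)) \<le> W.CK * real (n - t + 1) powr (\<epsilon> - d)"
      by simp_all
    have A_lim: "(\<lambda>m. A m s t) \<longlonglongrightarrow> toeplitz w s t" for s t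
      unfolding A_def toeplitz_def by (rule fourier_coeff_limit[OF w])
    have T_lim: "(\<lambda>m. T m s t) \<longlonglongrightarrow> Tinf s t" for s t
      unfolding T_def Tinf_def
      by (intro tendsto_sum mmult.tendsto bounded_linear.tendsto[OF bounded_linear_hermitian_conj] ki_limit)
    \<comment> \<open>A crude bound that grows with n suffices: n is fixed here and only boundedness
      in m matters.\<close>
    have T_le: "norm (T m s t) \<le> real n * (CA * CA)" if "s \<in> {1..n}" for m s t
    proof -
      have ki: "norm (coeff_at (frac_factor d (reg_radius m) Gsi) (int j)) \<le> CA" for j
      proof -
        have "(real j + 1) powr (- 1 - d) \<le> (real j + 1) powr 0" using d by (intro powr_mono) auto
        hence "CA * (real j + 1) powr (- 1 - d) \<le> CA * 1" using CA by (intro mult_left_mono) auto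
        thus ?thesis using W.ki_le[of "int j" m] by simp
      qed
      have "norm (T m s t) \<le> (\<Sum>l=1..min s t. CA * CA)"
        unfolding T_def using CA
        by (intro sum_norm_le order_trans[OF norm_matrix_mult_le] mult_mono) (auto intro: ki simp del: of_nat_diff)
      also have "\<dots> = real (min s t) * (CA * CA)" by simp
      also have "\<dots> \<le> real n * (CA * CA)" using that CA by (intro mult_right_mono) auto
      finally show ?thesis .
    qed
    have B_le: "norm (B m s t) \<le> K + real n * (CA * CA)" if st: "s \<in> {1..n}" "t \<in> {1..n}" for m s t
    proof -
      have "norm (B m s t - T m s t) \<le> (\<Sum>s=1..n. norm (B m s t - T m s t))"
        using st by (intro member_le_sum) auto
      also have "\<dots> \<le> W.CK * real (n - t + 1) powr (\<epsilon> - d)" by (rule B(2)[OF st(2)])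
      also have "\<dots> \<le> K * 1"
      proof (intro mult_mono K)
        have "real (n - t + 1) powr (\<epsilon> - d) \<le> real (n - t + 1) powr 0" using eps by (intro powr_mono) auto
        thus "real (n - t + 1) powr (\<epsilon> - d) \<le> 1" by simp
      qed auto
      finally have "norm (B m s t - T m s t) \<le> K" by simp
      thus ?thesis using norm_triangle_sub[of "B m s t" "T m s t"] T_le[OF st(1), of m t] by linarith
    qed
    obtain B' where B': "is_block_inverse n (toeplitz w) B'"
      "\<And>s t. s \<in> {1..n} \<Longrightarrow> t \<in> {1..n} \<Longrightarrow> (\<lambda>m. B m s t) \<longlonglongrightarrow> B' s t"
      using block_inverse_limit[of n A "toeplitz w" B "K + real n * (CA * CA)", OF A_lim B(1) B_le] K CA by auto
    show "\<exists>B. is_block_inverse n (toeplitz w) B \<and>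
      (\<forall>t\<in>{1..n}. (\<Sum>s=1..n. norm (B s t - Tinf s t)) \<le> K * real (n - t + 1) powr (\<epsilon> - d))"
    proof (intro exI[of _ B'] conjI ballI B'(1))
      fix t assume t: "t \<in> {1..n}"
      show "(\<Sum>s=1..n. norm (B' s t - Tinf s t)) \<le> K * real (n - t + 1) powr (\<epsilon> - d)"
      proof (rule LIMSEQ_le_const2)
        show "(\<lambda>m. \<Sum>s=1..n. norm (B m s t - T m s t)) \<longlonglongrightarrow> (\<Sum>s=1..n. norm (B' s t - Tinf s t))"
          using t by (intro tendsto_intros B'(2) T_lim) auto
        show "\<exists>N. \<forall>m\<ge>N. (\<Sum>s=1..n. norm (B m s t - T m s t)) \<le> K * real (n - t + 1) powr (\<epsilon> - d)"
          using B(2)[OF t] mult_right_mono[OF K(2), of "real (n - t + 1) powr (\<epsilon> - d)"]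
          by (intro exI[of _ 0] allI impI) (meson order_trans powr_ge_zero)
      qed
    qed
  qed
qed

end

section \<open>The rate of convergence\<close>

lemma has_sum_sum:
  fixes f :: "'a \<Rightarrow> 'b \<Rightarrow> 'c::real_normed_vector"
  assumes "finite S" "\<And>s. s \<in> S \<Longrightarrow> (f s has_sum F s) A"
  shows "((\<lambda>t. \<Sum>s\<in>S. f s t) has_sum (\<Sum>s\<in>S. F s)) A"
  using assms by (induction S rule: finite_induct) (auto intro: has_sum_add)

lemma infsum_tail_tendsto_0:
  fixes f :: "nat \<Rightarrow> real"
  assumes f: "f summable_on {1..}" "\<And>k. 0 \<le> f k" and m: "filterlim m at_top sequentially"
  shows "(\<lambda>n. \<Sum>\<^sub>\<infinity>t\<in>{m n + 1..}. f t) \<longlonglongrightarrow> 0"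
proof -
  have split: "(\<Sum>\<^sub>\<infinity>t\<in>{k + 1..}. f t) = (\<Sum>\<^sub>\<infinity>t\<in>{1..}. f t) - (\<Sum>t=1..k. f t)" for k
  proof -
    have "{1..} = {1..k} \<union> {k + 1..}" by auto
    hence "(\<Sum>\<^sub>\<infinity>t\<in>{1..}. f t) = (\<Sum>\<^sub>\<infinity>t\<in>{1..k}. f t) + (\<Sum>\<^sub>\<infinity>t\<in>{k + 1..}. f t)"
      by (simp only:) (rule infsum_Un_disjoint, auto intro: summable_on_subset_banach[OF f(1)])
    thus ?thesis by simp
  qed
  have "(\<lambda>k. \<Sum>t=1..k. f t) \<longlonglongrightarrow> (\<Sum>\<^sub>\<infinity>t\<in>{1..}. f t)"
  proof -
    have "((\<lambda>t. f (t + 1)) has_sum (\<Sum>\<^sub>\<infinity>t\<in>{1..}. f t)) UNIV"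
    proof -
      have "bij_betw (\<lambda>t::nat. t + 1) UNIV {1..}"
        by (rule bij_betwI[where g = "\<lambda>t. t - 1"]) auto
      from has_sum_reindex_bij_betw[OF this, of f] show ?thesis
        using has_sum_infsum[OF f(1)] by simp
    qed
    hence "(\<lambda>k. \<Sum>t<k. f (t + 1)) \<longlonglongrightarrow> (\<Sum>\<^sub>\<infinity>t\<in>{1..}. f t)"
      using has_sum_imp_sums by (simp add: sums_def)
    moreover have "(\<Sum>t<k. f (t + 1)) = (\<Sum>t=1..k. f t)" for k
      by (rule sum.reindex_bij_witness[of _ "\<lambda>t. t - 1" "\<lambda>t. t + 1"]) auto
    ultimately show ?thesis by simp
  qed
  hence "(\<lambda>k. (\<Sum>\<^sub>\<infinity>t\<in>{1..}. f t) - (\<Sum>t=1..k. f t)) \<longlonglongrightarrow> (\<Sum>\<^sub>\<infinity>t\<in>{1..}. f t) - (\<Sum>\<^sub>\<infinity>t\<in>{1..}. f t)"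
    by (intro tendsto_intros)
  hence "(\<lambda>k. \<Sum>\<^sub>\<infinity>t\<in>{k + 1..}. f t) \<longlonglongrightarrow> 0" by (simp only: split diff_self)
  from filterlim_compose[OF this m] show ?thesis .
qed

context toeplitz_symbol begin

text \<open>The difference splits into the column errors for t up to n, weighted by y, and the
  truncated part t > n of the semi-infinite sum, where bounded column sums leave a multiple of the
  tail of y.\<close>

lemma solution_difference_le:
  fixes a y z :: "nat \<Rightarrow> complex^'q^'q" and zn :: "nat \<Rightarrow> nat \<Rightarrow> complex^'q^'q"
  assumes w: "\<And>\<zeta>. norm \<zeta> = 1 \<Longrightarrow> \<zeta> \<noteq> 1 \<Longrightarrow>
      w \<zeta> = (norm (1 - \<zeta>) powr (- 2 * d)) *\<^sub>R (g \<zeta> ** hermitian_conj (g \<zeta>))"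
    and a: "\<And>\<zeta>. norm \<zeta> < 1 \<Longrightarrow> (\<lambda>k. mscale (\<zeta> ^ k) (a k)) sums (- matrix_inv (h_tilde d gs \<zeta>))"
    and y: "(\<lambda>k. norm (y k)) summable_on {1..}"
    and z: "\<And>s. 1 \<le> s \<Longrightarrow> z s = (\<Sum>\<^sub>\<infinity>t\<in>{1..}. toeplitz_inf_inverse a s t ** y t)"
    and zn: "\<And>n s. s \<in> {1..n} \<Longrightarrow> zn n s = (\<Sum>t=1..n. block_inverse n (toeplitz w) s t ** y t)"
    and eps: "0 < \<epsilon>" "\<epsilon> < d" "\<epsilon> \<le> 1/4"
  shows "\<exists>K\<ge>0. \<forall>n. (\<Sum>s=1..n. norm (z s - zn n s))
    \<le> K * (\<Sum>t=1..n. real (n - t + 1) powr (\<epsilon> - d) * norm (y t)) + K * (\<Sum>\<^sub>\<infinity>t\<in>{n + 1..}. norm (y t))"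
proof -
  have Tinf: "toeplitz_inf_inverse a s t = Tinf s t" for s t
    unfolding toeplitz_inf_inverse_def Tinf_def
    by (intro sum.cong refl) (simp add: ki1_eq[OF a] hermitian_conj_minus mmult.minus_left mmult.minus_right)
  obtain K where K: "0 \<le> K" "\<And>n. \<exists>B. is_block_inverse n (toeplitz w) B \<and>
    (\<forall>t\<in>{1..n}. (\<Sum>s=1..n. norm (B s t - Tinf s t)) \<le> K * real (n - t + 1) powr (\<epsilon> - d))"
    using ex_toeplitz_inverse[OF w eps] by blast
  define K' where "K' = max K (SA * SA)"
  have K': "0 \<le> K'" "K \<le> K'" "SA * SA \<le> K'" using K(1) by (auto simp: K'_def)
  have Tinf_le: "norm (Tinf s t) \<le> SA * SA" if "1 \<le> s" for s t
  proof -
    have "norm (Tinf s t) \<le> (\<Sum>s=1..s. norm (Tinf s t))"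
      using that by (intro member_le_sum) auto
    thus ?thesis using sum_norm_Tinf_le[of t s] by linarith
  qed
  have summ: "(\<lambda>t. norm (Tinf s t ** y t)) summable_on A" if "1 \<le> s" "A \<subseteq> {1..}" for s A
  proof (rule summable_on_comparison_test)
    show "(\<lambda>t. SA * SA * norm (y t)) summable_on A"
      using summable_on_subset_banach[OF y that(2)] by (intro summable_on_cmult_right)
    show "norm (Tinf s t ** y t) \<le> SA * SA * norm (y t)" for t
      by (rule order_trans[OF norm_matrix_mult_le]) (intro mult_right_mono Tinf_le that(1) norm_ge_zero)
  qed auto
  have "(\<Sum>s=1..n. norm (z s - zn n s))
      \<le> K' * (\<Sum>t=1..n. real (n - t + 1) powr (\<epsilon> - d) * norm (y t)) + K' * (\<Sum>\<^sub>\<infinity>t\<in>{n + 1..}. norm (y t))" for n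
  proof -
    obtain B where B: "is_block_inverse n (toeplitz w) B"
      "\<And>t. t \<in> {1..n} \<Longrightarrow> (\<Sum>s=1..n. norm (B s t - Tinf s t)) \<le> K * real (n - t + 1) powr (\<epsilon> - d)"
      using K(2) by blast
    have diff: "norm (z s - zn n s) \<le> (\<Sum>t=1..n. norm (B s t - Tinf s t) * norm (y t))
        + (\<Sum>\<^sub>\<infinity>t\<in>{n + 1..}. norm (Tinf s t) * norm (y t))" if s: "s \<in> {1..n}" for s
    proof -
      have s1: "1 \<le> s" using s by simp
      have "{1..} = {1..n} \<union> {n + 1..}" by auto
      hence "z s = (\<Sum>\<^sub>\<infinity>t\<in>{1..n} \<union> {n + 1..}. Tinf s t ** y t)" using z[OF s1] by (simp add: Tinf)
      also have "\<dots> = (\<Sum>\<^sub>\<infinity>t\<in>{1..n}. Tinf s t ** y t) + (\<Sum>\<^sub>\<infinity>t\<in>{n + 1..}. Tinf s t ** y t)"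
        by (rule infsum_Un_disjoint) (auto intro!: abs_summable_summable[OF summ[OF s1]])
      finally have z_eq: "z s = (\<Sum>t=1..n. Tinf s t ** y t) + (\<Sum>\<^sub>\<infinity>t\<in>{n + 1..}. Tinf s t ** y t)" by simp
      have "zn n s = (\<Sum>t=1..n. B s t ** y t)"
        unfolding zn[OF s] using s by (intro sum.cong) (auto simp: block_inverse_eq[OF B(1)])
      hence "z s - zn n s = (\<Sum>\<^sub>\<infinity>t\<in>{n + 1..}. Tinf s t ** y t) - (\<Sum>t=1..n. (B s t - Tinf s t) ** y t)"
        by (simp add: z_eq mmult.diff_left sum_subtractf)
      hence "norm (z s - zn n s) \<le> norm (\<Sum>\<^sub>\<infinity>t\<in>{n + 1..}. Tinf s t ** y t) + norm (\<Sum>t=1..n. (B s t - Tinf s t) ** y t)"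
        by (simp add: norm_triangle_ineq4)
      moreover have "norm (\<Sum>t=1..n. (B s t - Tinf s t) ** y t) \<le> (\<Sum>t=1..n. norm (B s t - Tinf s t) * norm (y t))"
        by (rule order_trans[OF norm_sum]) (intro sum_mono norm_matrix_mult_le)
      moreover have "norm (\<Sum>\<^sub>\<infinity>t\<in>{n + 1..}. Tinf s t ** y t) \<le> (\<Sum>\<^sub>\<infinity>t\<in>{n + 1..}. norm (Tinf s t ** y t))"
        by (rule norm_infsum_bound) (rule summ[OF s1], auto)
      moreover have "(\<Sum>\<^sub>\<infinity>t\<in>{n + 1..}. norm (Tinf s t ** y t)) \<le> (\<Sum>\<^sub>\<infinity>t\<in>{n + 1..}. norm (Tinf s t) * norm (y t))"
      proof (rule infsum_mono[OF summ[OF s1]])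
        show "(\<lambda>t. norm (Tinf s t) * norm (y t)) summable_on {n + 1..}"
        proof (rule summable_on_comparison_test)
          show "(\<lambda>t. SA * SA * norm (y t)) summable_on {n + 1..}"
            by (intro summable_on_cmult_right summable_on_subset_banach[OF y]) auto
        qed (auto intro!: mult_right_mono Tinf_le s1)
      qed (auto intro: norm_matrix_mult_le)
      ultimately show ?thesis by linarith
    qed
    have "(\<Sum>s=1..n. norm (z s - zn n s)) \<le> (\<Sum>s=1..n. (\<Sum>t=1..n. norm (B s t - Tinf s t) * norm (y t))
        + (\<Sum>\<^sub>\<infinity>t\<in>{n + 1..}. norm (Tinf s t) * norm (y t)))"
      by (intro sum_mono diff)
    also have "\<dots> = (\<Sum>t=1..n. (\<Sum>s=1..n. norm (B s t - Tinf s t)) * norm (y t))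
        + (\<Sum>s=1..n. \<Sum>\<^sub>\<infinity>t\<in>{n + 1..}. norm (Tinf s t) * norm (y t))"
      unfolding sum.distrib sum_distrib_right by (subst sum.swap) simp
    also have "\<dots> \<le> K' * (\<Sum>t=1..n. real (n - t + 1) powr (\<epsilon> - d) * norm (y t)) + K' * (\<Sum>\<^sub>\<infinity>t\<in>{n + 1..}. norm (y t))"
    proof (rule add_mono)
      have "(\<Sum>t=1..n. (\<Sum>s=1..n. norm (B s t - Tinf s t)) * norm (y t))
          \<le> (\<Sum>t=1..n. (K' * real (n - t + 1) powr (\<epsilon> - d)) * norm (y t))"
      proof (intro sum_mono mult_right_mono norm_ge_zero)
        fix t assume "t \<in> {1..n}"
        thus "(\<Sum>s=1..n. norm (B s t - Tinf s t)) \<le> K' * real (n - t + 1) powr (\<epsilon> - d)"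
          by (rule order_trans[OF B(2) mult_right_mono[OF K'(2)]]) simp
      qed
      thus "(\<Sum>t=1..n. (\<Sum>s=1..n. norm (B s t - Tinf s t)) * norm (y t))
          \<le> K' * (\<Sum>t=1..n. real (n - t + 1) powr (\<epsilon> - d) * norm (y t))"
        by (simp add: sum_distrib_left mult.assoc)
      have sm: "(\<lambda>t. norm (Tinf s t) * norm (y t)) summable_on {n + 1..}" if "s \<in> {1..n}" for s
      proof (rule summable_on_comparison_test)
        show "(\<lambda>t. SA * SA * norm (y t)) summable_on {n + 1..}"
          by (intro summable_on_cmult_right summable_on_subset_banach[OF y]) auto
      qed (use that in \<open>auto intro!: mult_right_mono Tinf_le\<close>)
      have "(\<Sum>s=1..n. \<Sum>\<^sub>\<infinity>t\<in>{n + 1..}. norm (Tinf s t) * norm (y t))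
          = (\<Sum>\<^sub>\<infinity>t\<in>{n + 1..}. \<Sum>s=1..n. norm (Tinf s t) * norm (y t))"
        by (rule infsumI[OF has_sum_sum[OF _ has_sum_infsum[OF sm]], symmetric]) auto
      also have "\<dots> \<le> (\<Sum>\<^sub>\<infinity>t\<in>{n + 1..}. K' * norm (y t))"
      proof (rule infsum_mono)
        show "(\<lambda>t. \<Sum>s=1..n. norm (Tinf s t) * norm (y t)) summable_on {n + 1..}"
          by (rule has_sum_imp_summable[OF has_sum_sum[OF _ has_sum_infsum[OF sm]]]) auto
        show "(\<lambda>t. K' * norm (y t)) summable_on {n + 1..}"
          by (intro summable_on_cmult_right summable_on_subset_banach[OF y]) auto
        fix t
        show "(\<Sum>s=1..n. norm (Tinf s t) * norm (y t)) \<le> K' * norm (y t)"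
          unfolding sum_distrib_right[symmetric]
          using sum_norm_Tinf_le[of t n] K'(3) by (intro mult_right_mono) auto
      qed
      also have "\<dots> = K' * (\<Sum>\<^sub>\<infinity>t\<in>{n + 1..}. norm (y t))"
        by (rule infsum_cmult_right) (rule summable_on_subset_banach[OF y], auto)
      finally show "(\<Sum>s=1..n. \<Sum>\<^sub>\<infinity>t\<in>{n + 1..}. norm (Tinf s t) * norm (y t)) \<le> K' * (\<Sum>\<^sub>\<infinity>t\<in>{n + 1..}. norm (y t))" .
    qed
    finally show ?thesis .
  qed
  thus ?thesis using K'(1) by blast
qed

end

text \<open>For \<open>t \<le> n powr \<kappa>\<close> the weight is controlled by \<open>n \<le> t * (n - t + 1)\<close>.\<close>

lemma sum_weight_le:
  fixes f :: "nat \<Rightarrow> real"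
  assumes f: "f summable_on {1..}" "\<And>t. 0 \<le> f t" and b: "0 \<le> b" and m: "real m \<le> real n powr \<kappa>" "m \<le> n"
  shows "(\<Sum>t=1..n. real (n - t + 1) powr (- b) * f t)
    \<le> real n powr (- b * (1 - \<kappa>)) * (\<Sum>\<^sub>\<infinity>t\<in>{1..}. f t) + (\<Sum>t=m+1..n. f t)"
proof -
  have "{1..n} = {1..m} \<union> {m+1..n}" "{1..m} \<inter> {m+1..n} = {}" using m(2) by auto
  hence "(\<Sum>t=1..n. real (n - t + 1) powr (- b) * f t)
      = (\<Sum>t=1..m. real (n - t + 1) powr (- b) * f t) + (\<Sum>t=m+1..n. real (n - t + 1) powr (- b) * f t)"
    by (simp add: sum.union_disjoint)
  also have "\<dots> \<le> real n powr (- b * (1 - \<kappa>)) * (\<Sum>\<^sub>\<infinity>t\<in>{1..}. f t) + (\<Sum>t=m+1..n. f t)"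
  proof (rule add_mono)
    have "(\<Sum>t=1..m. real (n - t + 1) powr (- b) * f t) \<le> (\<Sum>t=1..m. real n powr (- b * (1 - \<kappa>)) * f t)"
    proof (intro sum_mono mult_right_mono f)
      fix t assume t: "t \<in> {1..m}"
      hence n: "0 < n" using m(2) by auto
      have "real n \<le> real t * real (n - t + 1)"
      proof -
        obtain j where j: "n = t + j" using t m(2) by (metis atLeastAtMost_iff le_Suc_ex le_trans)
        have "real t * real (n - t + 1) - real n = (real t - 1) * real j" by (simp add: j algebra_simps)
        moreover have "0 \<le> (real t - 1) * real j" using t by (intro mult_nonneg_nonneg) auto
        ultimately show ?thesis by linarith
      qed
      also have "\<dots> \<le> real n powr \<kappa> * real (n - t + 1)"
        using t m(1) by (intro mult_right_mono) auto
      finally have "real n * real n powr (- \<kappa>) \<le> (real n powr \<kappa> * real (n - t + 1)) * real n powr (- \<kappa>)"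
        by (rule mult_right_mono) simp
      also have "\<dots> = real (n - t + 1) * (real n powr \<kappa> * real n powr (- \<kappa>))" by (simp add: mult_ac)
      also have "real n powr \<kappa> * real n powr (- \<kappa>) = 1" using n by (simp flip: powr_add)
      also have "real n * real n powr (- \<kappa>) = real n powr (1 - \<kappa>)"
        using n powr_add[of "real n" 1 "- \<kappa>"] by simp
      finally have "real n powr (1 - \<kappa>) \<le> real (n - t + 1)" by simp
      hence "real (n - t + 1) powr (- b) \<le> (real n powr (1 - \<kappa>)) powr (- b)"
        using n b by (intro powr_mono2') auto
      thus "real (n - t + 1) powr (- b) \<le> real n powr (- b * (1 - \<kappa>))"
        by (simp add: powr_powr mult.commute)
    qed
    also have "\<dots> \<le> real n powr (- b * (1 - \<kappa>)) * (\<Sum>\<^sub>\<infinity>t\<in>{1..}. f t)"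
      unfolding sum_distrib_left[symmetric]
      by (intro mult_left_mono finite_sum_le_infsum f) auto
    finally show "(\<Sum>t=1..m. real (n - t + 1) powr (- b) * f t) \<le> real n powr (- b * (1 - \<kappa>)) * (\<Sum>\<^sub>\<infinity>t\<in>{1..}. f t)" .
    show "(\<Sum>t=m+1..n. real (n - t + 1) powr (- b) * f t) \<le> (\<Sum>t=m+1..n. f t)"
    proof (rule sum_mono)
      fix t
      have "real (n - t + 1) powr (- b) \<le> real (n - t + 1) powr 0" using b by (intro powr_mono) auto
      thus "real (n - t + 1) powr (- b) * f t \<le> f t"
        using mult_right_mono[of "real (n - t + 1) powr (- b)" 1 "f t"] f(2)[of t] by simp
    qed
  qed
  finally show ?thesis .
qed

theorem theorem3p2:
  fixes d \<kappa> :: real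
    and w g g_sharp :: "complex \<Rightarrow> complex^'q^'q"
    and a y z :: "nat \<Rightarrow> complex^'q^'q"
    and zn :: "nat \<Rightarrow> nat \<Rightarrow> complex^'q^'q"
  assumes d: "0 < d" "d < 1/2"
    and g: "rational_invertible_cdisk g"
    and w: "\<And>\<zeta>. norm \<zeta> = 1 \<Longrightarrow> \<zeta> \<noteq> 1 \<Longrightarrow>
              w \<zeta> = (norm (1 - \<zeta>) powr (- 2 * d)) *\<^sub>R (g \<zeta> ** hermitian_conj (g \<zeta>))"
    and g_sharp: "rational_invertible_cdisk g_sharp"
    and g_g_sharp: "\<And>\<zeta>. norm \<zeta> = 1 \<Longrightarrow>
              g \<zeta> ** hermitian_conj (g \<zeta>) = hermitian_conj (g_sharp \<zeta>) ** g_sharp \<zeta>"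
    and a: "\<And>\<zeta>. norm \<zeta> < 1 \<Longrightarrow>
              (\<lambda>k. mscale (\<zeta> ^ k) (a k)) sums (- matrix_inv (h_tilde d g_sharp \<zeta>))"
    and y: "(\<lambda>k. spectral_norm (y k)) summable_on {1..}"
    and \<kappa>: "0 < \<kappa>" "\<kappa> < d / (1 - d)"
    and z: "\<And>s. 1 \<le> s \<Longrightarrow> z s = (\<Sum>\<^sub>\<infinity>t\<in>{1..}. toeplitz_inf_inverse a s t ** y t)"
    and zn: "\<And>n s. s \<in> {1..n} \<Longrightarrow>
              zn n s = (\<Sum>t=1..n. block_inverse n (toeplitz w) s t ** y t)"
  shows "(\<exists>u v :: nat \<Rightarrow> real.
            (\<forall>n. (\<Sum>k=1..n. spectral_norm (z k - zn n k)) = u n + v n) \<and>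
            u \<in> O(\<lambda>n. real n powr (- d + \<kappa> * (1 - d))) \<and>
            v \<in> O(\<lambda>n. \<Sum>\<^sub>\<infinity>t\<in>{nat \<lfloor>real n powr \<kappa>\<rfloor> + 1..}. spectral_norm (y t))) \<and>
         (\<lambda>n. \<Sum>k=1..n. spectral_norm (z k - zn n k)) \<longlonglongrightarrow> 0"
proof -
  obtain G where G: "power_series_on_cdisk G g"
    using rational_invertible_cdisk_power_series(1)[OF g] unfolding power_series_on_cdisk_def by blast
  obtain Gi where Gi: "power_series_on_cdisk Gi (\<lambda>z. matrix_inv (g z))"
    using rational_invertible_cdisk_power_series(2)[OF g] unfolding power_series_on_cdisk_def by blast
  obtain Gs where Gs: "power_series_on_cdisk Gs g_sharp"
    using rational_invertible_cdisk_power_series(1)[OF g_sharp] unfolding power_series_on_cdisk_def by blast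
  obtain Gsi where Gsi: "power_series_on_cdisk Gsi (\<lambda>z. matrix_inv (g_sharp z))"
    using rational_invertible_cdisk_power_series(2)[OF g_sharp] unfolding power_series_on_cdisk_def by blast
  interpret toeplitz_symbol d g g_sharp G Gi Gs Gsi
    using d G Gi Gs Gsi g g_sharp g_g_sharp by unfold_locales (auto simp: rational_invertible_cdisk_def)

  \<comment> \<open>The cut n^\<kappa> must not exceed n; \<kappa> < 1 follows from d < 1/2.\<close>
  have "d / (1 - d) < 1" using d by simp
  hence \<kappa>1: "\<kappa> < 1" using \<kappa>(2) by linarith
  have \<kappa>2: "\<kappa> * (1 - d) < d" using \<kappa>(2) d by (simp add: pos_less_divide_eq)
  \<comment> \<open>The exponent obtained below is -(d - \<epsilon>)(1 - \<kappa>) = -d + d\<kappa>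
    + \<epsilon>(1 - \<kappa>). It is at most -d + \<kappa>(1 - d) as soon as \<epsilon>(1 -
    \<kappa>) is at most \<kappa>(1 - 2d), which the last entry of the minimum guarantees.\<close>
  define \<epsilon> where "\<epsilon> = min (min (d / 2) (1 / 4)) (\<kappa> * (1 - 2 * d))"
  have eps: "0 < \<epsilon>" "\<epsilon> < d" "\<epsilon> \<le> 1/4" "\<epsilon> \<le> \<kappa> * (1 - 2 * d)" using d \<kappa> by (auto simp: \<epsilon>_def)
  define N where "N = real (CARD('q) * CARD('q))"
  have N: "norm A \<le> N * spectral_norm A" for A :: "complex^'q^'q"
    unfolding N_def by (rule norm_le_spectral_norm)
  have N0: "0 \<le> N" by (simp add: N_def)
  have yn: "(\<lambda>k. norm (y k)) summable_on {1..}"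
    by (rule summable_on_comparison_test[OF summable_on_cmult_right[OF y, of N]]) (auto intro: N)
  obtain K where K: "0 \<le> K" "\<And>n. (\<Sum>s=1..n. norm (z s - zn n s))
    \<le> K * (\<Sum>t=1..n. real (n - t + 1) powr (\<epsilon> - d) * norm (y t)) + K * (\<Sum>\<^sub>\<infinity>t\<in>{n + 1..}. norm (y t))"
    using solution_difference_le[OF w a yn z zn eps(1-3)] by blast

  define m where "m n = nat \<lfloor>real n powr \<kappa>\<rfloor>" for n
  define S where "S n = (\<Sum>k=1..n. spectral_norm (z k - zn n k))" for n
  define Y where "Y = (\<Sum>\<^sub>\<infinity>t\<in>{1..}. norm (y t))"
  define R where "R n = (\<Sum>\<^sub>\<infinity>t\<in>{m n + 1..}. spectral_norm (y t))" for n
  define p where "p = - d + \<kappa> * (1 - d)"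
  have Y0: "0 \<le> Y" unfolding Y_def by (rule infsum_nonneg) simp
  have R0: "0 \<le> R n" for n unfolding R_def by (rule infsum_nonneg) (simp add: spectral_norm_nonneg)
  have S0: "0 \<le> S n" for n unfolding S_def by (intro sum_nonneg spectral_norm_nonneg)
  have S_le: "S n \<le> K * Y * real n powr p + K * N * R n" for n
  proof (cases "n = 0")
    case True
    have "S n = 0" using True by (simp add: S_def)
    thus ?thesis using K(1) N0 R0[of n] Y0 by simp
  next
    case False
    have m: "real (m n) \<le> real n powr \<kappa>" by (simp add: m_def)
    have "real n powr \<kappa> \<le> real n powr 1" using False \<kappa>1 by (intro powr_mono) auto
    hence mn: "m n \<le> n" using m by simp
    have "S n \<le> (\<Sum>s=1..n. norm (z s - zn n s))"
      unfolding S_def by (intro sum_mono spectral_norm_le_norm)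
    also have "\<dots> \<le> K * (\<Sum>t=1..n. real (n - t + 1) powr (- (d - \<epsilon>)) * norm (y t)) + K * (\<Sum>\<^sub>\<infinity>t\<in>{n + 1..}. norm (y t))"
      using K(2)[of n] by simp
    also have "\<dots> \<le> K * (real n powr (- (d - \<epsilon>) * (1 - \<kappa>)) * Y + (\<Sum>t=m n+1..n. norm (y t))) + K * (\<Sum>\<^sub>\<infinity>t\<in>{n + 1..}. norm (y t))"
      unfolding Y_def using eps K(1) m mn
      by (intro add_right_mono mult_left_mono sum_weight_le[OF yn]) auto
    also have "\<dots> = K * Y * real n powr (- (d - \<epsilon>) * (1 - \<kappa>)) + K * ((\<Sum>t=m n+1..n. norm (y t)) + (\<Sum>\<^sub>\<infinity>t\<in>{n + 1..}. norm (y t)))"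
      by (simp add: algebra_simps)
    also have "(\<Sum>t=m n+1..n. norm (y t)) + (\<Sum>\<^sub>\<infinity>t\<in>{n + 1..}. norm (y t)) = (\<Sum>\<^sub>\<infinity>t\<in>{m n + 1..}. norm (y t))"
    proof -
      have "{m n + 1..} = {m n+1..n} \<union> {n + 1..}" using mn by auto
      moreover have "(\<Sum>\<^sub>\<infinity>t\<in>{m n+1..n} \<union> {n + 1..}. norm (y t))
          = (\<Sum>\<^sub>\<infinity>t\<in>{m n+1..n}. norm (y t)) + (\<Sum>\<^sub>\<infinity>t\<in>{n + 1..}. norm (y t))"
        by (rule infsum_Un_disjoint) (auto intro: summable_on_subset_banach[OF yn])
      ultimately show ?thesis by simp
    qed
    also have "(\<Sum>\<^sub>\<infinity>t\<in>{m n + 1..}. norm (y t)) \<le> (\<Sum>\<^sub>\<infinity>t\<in>{m n + 1..}. N * spectral_norm (y t))"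
      by (intro infsum_mono N summable_on_cmult_right summable_on_subset_banach[OF yn] summable_on_subset_banach[OF y]) auto
    also have "\<dots> = N * R n"
      unfolding R_def by (rule infsum_cmult_right) (rule summable_on_subset_banach[OF y], auto)
    finally have "S n \<le> K * Y * real n powr (- (d - \<epsilon>) * (1 - \<kappa>)) + K * (N * R n)"
      using K(1) by (simp add: mult_left_mono)
    also have "\<dots> \<le> K * Y * real n powr p + K * (N * R n)"
    proof (intro add_right_mono mult_left_mono powr_mono)
      have "\<epsilon> * (1 - \<kappa>) \<le> \<epsilon> * 1" using eps \<kappa> by (intro mult_left_mono) auto
      also have "\<dots> \<le> \<kappa> * (1 - 2 * d)" using eps by simp
      finally show "- (d - \<epsilon>) * (1 - \<kappa>) \<le> p" by (simp add: p_def algebra_simps)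
    qed (use False K(1) Y0 in auto)
    finally show ?thesis by (simp add: mult.assoc)
  qed

  \<comment> \<open>Splits S exactly into two terms: as S is at most the sum of the two bounds, what
    remains after capping it at the first bound is at most the second.\<close>
  define u where "u n = min (S n) (K * Y * real n powr p)" for n
  define v where "v n = S n - u n" for n
  have u: "u \<in> O(\<lambda>n. real n powr p)"
  proof (rule bigoI[of _ "K * Y"], rule always_eventually, rule allI)
    fix n
    have "0 \<le> K * Y * real n powr p" using K(1) Y0 by simp
    thus "norm (u n) \<le> K * Y * norm (real n powr p)" using S0[of n] by (simp add: u_def)
  qed
  have v: "v \<in> O(R)"
  proof (rule bigoI[of _ "K * N"], rule always_eventually, rule allI)
    fix n
    have "0 \<le> K * N * R n" using K(1) N0 R0 by simp
    thus "norm (v n) \<le> K * N * norm (R n)" using S_le[of n] R0[of n] by (simp add: v_def u_def)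
  qed
  have "S \<longlonglongrightarrow> 0"
  proof (rule tendsto_sandwich[OF always_eventually always_eventually tendsto_const])
    show "\<forall>n. 0 \<le> S n" using S0 by simp
    show "\<forall>n. S n \<le> K * Y * real n powr p + K * N * R n" using S_le by simp
    \<comment> \<open>The upper bound on \<kappa> is exactly the condition that the exponent be
      negative.\<close>
    have "p < 0" using \<kappa>2 by (simp add: p_def)
    hence "(\<lambda>n. real n powr p) \<longlonglongrightarrow> 0"
      by (intro tendsto_neg_powr filterlim_real_sequentially)
    moreover have "R \<longlonglongrightarrow> 0"
      unfolding R_def
    proof (rule infsum_tail_tendsto_0[OF y spectral_norm_nonneg])
      have "filterlim (\<lambda>n. real n powr \<kappa>) at_top sequentially"
      proof (rule filterlim_at_top[THEN iffD2], rule allI)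
        fix Z :: real
        have "eventually (\<lambda>n. max 1 \<bar>Z\<bar> powr (1 / \<kappa>) \<le> real n) sequentially"
          using filterlim_real_sequentially by (simp add: filterlim_at_top)
        thus "eventually (\<lambda>n. Z \<le> real n powr \<kappa>) sequentially"
        proof eventually_elim
          case (elim n)
          have "Z \<le> max 1 \<bar>Z\<bar>" by simp
          also have "\<dots> = (max 1 \<bar>Z\<bar> powr (1 / \<kappa>)) powr \<kappa>" using \<kappa> by (simp add: powr_powr)
          also have "\<dots> \<le> real n powr \<kappa>" using elim \<kappa> by (intro powr_mono2) auto
          finally show ?case .
        qed
      qed
      hence "filterlim (\<lambda>n. \<lfloor>real n powr \<kappa>\<rfloor>) at_top sequentially"
        by (rule filterlim_compose[OF filterlim_floor_sequentially])
      thus "filterlim m at_top sequentially"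
        unfolding m_def by (rule filterlim_compose[OF filterlim_nat_sequentially])
    qed
    ultimately have "(\<lambda>n. K * Y * real n powr p + K * N * R n) \<longlonglongrightarrow> K * Y * 0 + K * N * 0"
      by (intro tendsto_intros)
    thus "(\<lambda>n. K * Y * real n powr p + K * N * R n) \<longlonglongrightarrow> 0" by simp
  qed
  moreover have "\<forall>n. S n = u n + v n" by (simp add: v_def)
  ultimately show ?thesis
    using u v unfolding S_def R_def[abs_def] m_def p_def by blast
qed

end
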